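(* The invariant set $\mathrm{AD}_+^{\Omega}\setminus \mathrm{OT}_+^{\Omega}$ is a subset of $\mathrm{B}_+^{\Omega}$ of full (Lebesgue) measure, and it contains a countable intersection of open and dense subsets of $\mathrm{B}_+^{\Omega}$. For every $x\in \mathrm{AD}_+^{\Omega}\setminus \mathrm{OT}_+^{\Omega}$ the backward orbit $\varphi^\tau(x)$ converges, as $\tau\to-\infty$, to a point in $\Delta_{123}^-\cup\Delta_{132}^+$. In particular, for every such $x$ the limits as $\tau\to-\infty$ of the eigenvalues of the expansion-normalized Weingarten map $K(\tau)$ exist, are distinct, and are all strictly positive.
   Context: Stiff fluid case $\gamma=2$. Consider the autonomous system for $(M,P,\theta,\Sigma_+,\Sigma_-)\in\mathbb{R}^5$ (expansion-normalized Einstein equations for Bianchi type VI$_{-1/9}$ with an orthogonal stiff fluid), with $'=d/d\tau$: $$M'=[q+2\Sigma_++2\sqrt3\cos(\theta)\Sigma_-]M,$$ $$P'=[-(2-q)-(3+\sin^2\theta)\Sigma_++\sqrt3\cos(\theta)\Sigma_-]P,$$ $$\theta'=-2\sqrt3\,\Sigma_-\sin\theta,$$ $$\Sigma_+'=-(2-q)\Sigma_+-2M^2+3P^2,$$ $$\Sigma_-'=-(2-q)\Sigma_--\sqrt3\cos(\theta)\big(2M^2+P^2-\tfrac23\sin^2(\theta)\Sigma_+^2\big),$$ where $q=2-2(1+\tfrac13\sin^2\theta)M^2$. Put $\Omega=1-(1+\tfrac13\sin^2\theta)(M^2+\Sigma_+^2)-P^2-\Sigma_-^2$; along solutions $\Omega'=-2(2-q)\Omega$.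 Phase space: $\mathrm{B}_+=\{(M,P,\theta,\Sigma_+,\Sigma_-)\in\mathbb{R}^5: M>0,\ P\ge0,\ \theta\in(0,\pi),\ \Omega\ge0\}$; non-vacuum part $\mathrm{B}_+^{\Omega}=\mathrm{B}_+\cap\{\Omega>0\}$; orthogonally-transitive part $\mathrm{OT}_+^{\Omega}=\mathrm{B}_+^{\Omega}\cap\{P=0\}$. All are invariant under the (complete) flow $\varphi^\tau$ of the system. For every $x\in\mathrm{B}_+^{\Omega}$ the limit $\lim_{\tau\to-\infty}\varphi^\tau(x)$ exists and has the form $(0,0,\psi(x),s_+(x),s_-(x))$. Define $\mathrm{AD}_+^{\Omega}=\{x\in\mathrm{B}_+^{\Omega}:\sin(\psi(x))=0\text{ and } (s_+(x),s_-(x))\ne(0,0)\}$ (asymptotically-diagonalizing orbits). Limit sets: $\Delta^-_{123}=\{(0,0,\pi,\Sigma_+,\Sigma_-):\Sigma_+<-\tfrac1{\sqrt3}\Sigma_-<0,\ \Sigma_+-\sqrt3\Sigma_->-1\}$, $\Delta^+_{132}=\{(0,0,0,\Sigma_+,\Sigma_-):\Sigma_+<\tfrac1{\sqrt3}\Sigma_-<0,\ \Sigma_++\sqrt3\Sigma_->-1\}$. The expansion-normalized Weingarten map is represented, in a canonical orthonormal frame, by the symmetric $3\times3$ matrix $K=\Sigma+\tfrac13 I$ with $\Sigma_{11}=-\tfrac23\Sigma_+$, $\Sigma_{22}=\tfrac13(\Sigma_++\sqrt3\Sigma_-)$, $\Sigma_{33}=\tfrac13(\Sigma_+-\sqrt3\Sigma_-)$,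 $\Sigma_{23}=\tfrac13\Sigma_+\sin\theta$, $\Sigma_{31}=\tfrac1{\sqrt3}P\cos(\theta/2)$, $\Sigma_{12}=\tfrac1{\sqrt3}P\sin(\theta/2)$; $K(\tau)$ is this matrix evaluated at $\varphi^\tau(x)$. *)

theory Defs
  imports
    "HOL-Analysis.Analysis"
    "HOL-Computational_Algebra.Polynomial"
    "Jordan_Normal_Form.Char_Poly"
begin

text \<open>A state is a tuple (M, P, theta, Sigma_plus, Sigma_minus); as a nested product of reals it is
  a Euclidean space carrying the usual five-dimensional Lebesgue measure.\<close>

type_synonym state = "real \<times> real \<times> real \<times> real \<times> real"

definition decel :: "real \<Rightarrow> real \<Rightarrow> real" where
  "decel M \<theta> = 2 - 2 * (1 + 1/3 * (sin \<theta>)^2) * M^2"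

definition vfield :: "state \<Rightarrow> state" where
  "vfield = (\<lambda>(M, P, \<theta>, Sp, Sm). let q = decel M \<theta> in
     ((q + 2 * Sp + 2 * sqrt 3 * cos \<theta> * Sm) * M,
      (- (2 - q) - (3 + (sin \<theta>)^2) * Sp + sqrt 3 * cos \<theta> * Sm) * P,
      - 2 * sqrt 3 * Sm * sin \<theta>,
      - (2 - q) * Sp - 2 * M^2 + 3 * P^2,
      - (2 - q) * Sm - sqrt 3 * cos \<theta> * (2 * M^2 + P^2 - 2/3 * (sin \<theta>)^2 * Sp^2)))"

definition Omega :: "state \<Rightarrow> real" where
  "Omega = (\<lambda>(M, P, \<theta>, Sp, Sm).
     1 - (1 + 1/3 * (sin \<theta>)^2) * (M^2 + Sp^2) - P^2 - Sm^2)"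

definition B_plus :: "state set" where
  "B_plus = {(M, P, \<theta>, Sp, Sm) |M P \<theta> Sp Sm.
     M > 0 \<and> P \<ge> 0 \<and> 0 < \<theta> \<and> \<theta> < pi \<and> Omega (M, P, \<theta>, Sp, Sm) \<ge> 0}"

definition B_plus_Omega :: "state set" where
  "B_plus_Omega = B_plus \<inter> {x. Omega x > 0}"

definition OT_plus_Omega :: "state set" where
  "OT_plus_Omega = B_plus_Omega \<inter> {(M, P, \<theta>, Sp, Sm) |M P \<theta> Sp Sm. P = 0}"

definition global_solution :: "state \<Rightarrow> (real \<Rightarrow> state) \<Rightarrow> bool" where
  "global_solution x u \<longleftrightarrow>
     u 0 = x \<and> (\<forall>\<tau>. (u has_vector_derivative vfield (u \<tau>)) (at \<tau>))"

text \<open>The vector field is smooth, so global solutions are unique, and for initial values in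
  \<^term>\<open>B_plus\<close> they exist. Outside \<^term>\<open>B_plus\<close> the value of the flow is irrelevant.\<close>

definition flow :: "real \<Rightarrow> state \<Rightarrow> state" where
  "flow \<tau> x = (THE u. global_solution x u) \<tau>"

definition AD_plus_Omega :: "state set" where
  "AD_plus_Omega = {x \<in> B_plus_Omega. \<exists>\<psi> sp sm.
     ((\<lambda>\<tau>. flow \<tau> x) \<longlongrightarrow> (0, 0, \<psi>, sp, sm)) at_bot \<and> sin \<psi> = 0 \<and> (sp, sm) \<noteq> (0, 0)}"

definition Delta_minus_123 :: "state set" where
  "Delta_minus_123 = {(0, 0, pi, Sp, Sm) |Sp Sm.
     Sp < - (1 / sqrt 3) * Sm \<and> - (1 / sqrt 3) * Sm < 0 \<and> Sp - sqrt 3 * Sm > -1}"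

definition Delta_plus_132 :: "state set" where
  "Delta_plus_132 = {(0, 0, 0, Sp, Sm) |Sp Sm.
     Sp < (1 / sqrt 3) * Sm \<and> (1 / sqrt 3) * Sm < 0 \<and> Sp + sqrt 3 * Sm > -1}"

definition shear :: "state \<Rightarrow> real mat" where
  "shear = (\<lambda>(M, P, \<theta>, Sp, Sm).
     let s12 = 1 / sqrt 3 * P * sin (\<theta> / 2);
         s31 = 1 / sqrt 3 * P * cos (\<theta> / 2);
         s23 = 1/3 * Sp * sin \<theta>
     in mat_of_rows_list 3
       [[- 2/3 * Sp, s12, s31],
        [s12, 1/3 * (Sp + sqrt 3 * Sm), s23],
        [s31, s23, 1/3 * (Sp - sqrt 3 * Sm)]])"

definition weingarten :: "state \<Rightarrow> real mat" where
  "weingarten x = shear x + (1/3) \<cdot>\<^sub>m 1\<^sub>m 3"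

text \<open>The real eigenvalues in increasing order, repeated according to algebraic multiplicity.
  The matrix \<^term>\<open>weingarten x\<close> is symmetric, so for it the list has length 3.\<close>

definition eigenvalue_list :: "real mat \<Rightarrow> real list" where
  "eigenvalue_list A = sorted_list_of_multiset (proots (char_poly A))"

end

theory Submission
  imports Defs
begin

text \<open>Backwards in time, Omega increases to a positive limit, so the squares of M and P are integrable,
  M and P vanish in the limit and Sigma-plus converges. Up to an integrable perturbation
  (Sigma-minus, cos theta) then follows a linear saddle flow, whence the orbit converges. For P > 0
  the limit has nonzero shear and satisfies either sin theta = 0, or theta = pi/2, Sigma-minus = 0 and
  Sigma-plus < 0. In the first case the growth rates of M, P and sin theta are nonnegative at the limit;
  if one of them vanished, the corresponding rate would be bounded above by an integrable function and the
  variable could not tend to 0. Strict positivity of the three rates is membership in the limit sets.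
  In the second case a cone condition for an indefinite quadratic form shows that the
  points whose backward orbit stays near a given equilibrium meet each line in a fixed direction at most
  once; such a set has infinitely many disjoint translates, hence measure zero, and empty interior.\<close>

section \<open>Global solutions of bounded Lipschitz fields\<close>

text \<open>The flow is a \<open>THE\<close> over global solutions, so existence, uniqueness and
  Lipschitz dependence on the initial point come before any dynamics. The field is Lipschitz only on
  bounded sets, which is why a cutoff appears. The possible limits are not isolated: they form
  families of equilibria with zero eigenvalues along the family. Hyperbolic invariant manifold
  theory therefore does not apply directly; the cone argument replaces it and needs only one
  spectral gap. At theta = pi/2, Sigma-plus = a with -1 < a < 0, the eigenvalues are 2 + 2a, -4a, 0,
  2a, -2a, and the number a separates 2a from all the others. The same degeneracy is the obstacle at
  sin theta = 0, where a limiting rate could vanish. There the rate of M or P is, up to O(sin^2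
  theta), bounded by a linear function of Sigma-plus and Sigma-minus that moves only slowly.
  Exponential decay of sin theta has to be known first, so its rate is settled before those of M and
  P. The phase space has the boundary P = 0, so density arguments may only move points in directions
  that do not decrease P.\<close>

lemma has_vector_derivative_reflect:
  fixes f :: "real \<Rightarrow> 'a::real_normed_vector"
  assumes "(f has_vector_derivative f') (at (- t))"
  shows "((\<lambda>s. f (- s)) has_vector_derivative (- f')) (at t)"
proof -
  have "((f \<circ> uminus) has_vector_derivative ((- 1) *\<^sub>R f')) (at t)"
    by (rule vector_diff_chain_at) (auto intro!: derivative_eq_intros assms)
  then show ?thesis by (simp add: o_def)
qed

lemma antiderivative_exists:
  fixes h :: "real \<Rightarrow> 'a::euclidean_space"
  assumes "continuous_on UNIV h"
  obtains H where "H 0 = 0" "\<And>t. (H has_vector_derivative h t) (at t)"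
proof -
  have "isCont h x" for x
    using assms by (simp add: continuous_on_eq_continuous_at)
  then obtain F where F: "\<And>x. (F has_vector_derivative h x) (at x)"
    using einterval_antiderivative[of "-\<infinity>" "\<infinity>" h] by auto
  show ?thesis
    by (rule that[of "\<lambda>t. F t - F 0"]) (auto intro!: derivative_eq_intros F)
qed

text \<open>Integrating against the weight exp (k |t|) gains a factor 1 / k, which is what makes the
  Picard map a contraction for large k.\<close>

lemma antiderivative_exp_bound:
  fixes H :: "real \<Rightarrow> 'a::real_normed_vector"
  assumes H0: "H 0 = 0" and H: "\<And>t. (H has_vector_derivative h t) (at t)"
    and k: "k > 0" and bd: "\<And>t. norm (h t) \<le> C * exp (k * \<bar>t\<bar>)"
  shows "norm (H t) \<le> C / k * (exp (k * \<bar>t\<bar>) - 1)"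
proof -
  \<comment> \<open>Stated for arbitrary \<open>H\<close> and \<open>h\<close>, because the case t <
    0 applies it to the reflected pair.\<close>
  have pos: "norm (H t) \<le> C / k * (exp (k * t) - 1)"
    if t: "t > 0" and H0: "H 0 = 0" and H: "\<And>t. (H has_vector_derivative h t) (at t)"
      and bd: "\<And>t. norm (h t) \<le> C * exp (k * \<bar>t\<bar>)" for t and H h :: "real \<Rightarrow> 'a"
  proof -
    have "norm (H t - H 0) \<le> C / k * exp (k * t) - C / k * exp (k * 0)"
    proof (rule differentiable_bound_general[OF t])
      show "continuous_on {0..t} H"
        using H by (meson continuous_at_imp_continuous_on has_vector_derivative_continuous)
      show "(H has_vector_derivative h x) (at x)" for x by (rule H)
      show "((\<lambda>t. C / k * exp (k * t)) has_vector_derivative C * exp (k * x)) (at x)" for x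
        using k by (auto intro!: derivative_eq_intros
          simp: has_real_derivative_iff_has_vector_derivative[symmetric])
      show "norm (h x) \<le> C * exp (k * x)" if "0 < x" for x
        using bd[of x] that by simp
    qed (intro continuous_intros)
    then show ?thesis using H0 by (simp add: algebra_simps)
  qed
  consider "t = 0" | "t > 0" | "t < 0" by linarith
  then show ?thesis
  proof cases
    case 3
    have "norm (H (- (- t))) \<le> C / k * (exp (k * (- t)) - 1)"
    proof (rule pos[of "- t" "\<lambda>s. H (- s)" "\<lambda>s. - h (- s)"])
      show "((\<lambda>s. H (- s)) has_vector_derivative - h (- t)) (at t)" for t
        by (rule has_vector_derivative_reflect[OF H])
      show "norm (- h (- t)) \<le> C * exp (k * \<bar>t\<bar>)" for t
        using bd[of "- t"] by simp
    qed (use 3 H0 in auto)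
    then show ?thesis using 3 by simp
  qed (use pos[OF _ H0 H bd] H0 in auto)
qed

text \<open>For a large enough k, Picard iteration is a contraction in the norm weighted by
  exp (- k |t|), on the whole real line at once.\<close>

theorem bounded_lipschitz_global_solution:
  fixes G :: "'a::euclidean_space \<Rightarrow> 'a"
  assumes lip: "L-lipschitz_on UNIV G" and bdG: "\<And>x. norm (G x) \<le> C"
  shows "\<exists>u. u 0 = x \<and> (\<forall>t. (u has_vector_derivative G (u t)) (at t))"
proof -
  \<comment> \<open>The contraction factor will be L / k, hence at most 1/2; adding 1 keeps k
    positive when L = 0.\<close>
  define k where "k = 2 * (L + 1)"
  have L0: "L \<ge> 0" using lip by (rule lipschitz_on_nonneg)
  then have k: "k > 0" by (simp add: k_def)
  have C0: "C \<ge> 0" using bdG[of 0] norm_ge_zero order_trans by blast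
  \<comment> \<open>The unknown \<open>w\<close> is the deviation from \<open>x\<close> divided by
    the weight, so that the fixed point is sought in the complete space of bounded continuous
    functions.\<close>
  define W where "W w t = x + exp (k * \<bar>t\<bar>) *\<^sub>R apply_bcontfun w t"
    for w :: "real \<Rightarrow>\<^sub>C 'a" and t :: real
  have contG: "continuous_on A (\<lambda>t. G (g t))" if "continuous_on A g" for A and g :: "real \<Rightarrow> 'a"
    using lipschitz_on_continuous_on[OF lip] that continuous_on_compose2 by blast
  have contW: "continuous_on UNIV (\<lambda>t. G (W w t))" for w
    unfolding W_def by (intro contG continuous_intros) auto
  have "\<forall>w. \<exists>H. H 0 = 0 \<and> (\<forall>t. (H has_vector_derivative G (W w t)) (at t))"
    using antiderivative_exists[OF contW] by metis
  then obtain H where H0: "\<And>w. H w 0 = 0"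
    and H: "\<And>w t. (H w has_vector_derivative G (W w t)) (at t)"
    by metis
  have contH: "continuous_on UNIV (H w)" for w
    using H by (meson continuous_at_imp_continuous_on has_vector_derivative_continuous)
  define Tf where "Tf w t = exp (- (k * \<bar>t\<bar>)) *\<^sub>R H w t" for w t
  have normT: "norm (exp (- (k * \<bar>t\<bar>)) *\<^sub>R y) \<le> D / k"
    if "norm y \<le> D / k * (exp (k * \<bar>t\<bar>) - 1)" "D \<ge> 0" for y :: 'a and t D :: real
  proof -
    have "norm (exp (- (k * \<bar>t\<bar>)) *\<^sub>R y) \<le> exp (- (k * \<bar>t\<bar>)) * (D / k * (exp (k * \<bar>t\<bar>) - 1))"
      using mult_left_mono[OF that(1), of "exp (- (k * \<bar>t\<bar>))"] by simp
    also have "\<dots> = D / k * (1 - exp (- (k * \<bar>t\<bar>)))"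
      by (simp add: algebra_simps exp_minus)
    also have "\<dots> \<le> D / k" using that(2) k by (intro mult_left_le) auto
    finally show ?thesis .
  qed
  have bdT: "norm (Tf w t) \<le> C / k" for w t
    unfolding Tf_def
  proof (rule normT[OF antiderivative_exp_bound[OF H0 H k] C0])
    have "1 \<le> exp (k * \<bar>t\<bar>)" for t using k by simp
    then show "norm (G (W w t)) \<le> C * exp (k * \<bar>t\<bar>)" for t
      using bdG[of "W w t"] C0 by (smt (verit) mult_left_mono mult_cancel_left2)
  qed
  have Tb: "Tf w \<in> bcontfun" for w
    unfolding bcontfun_def
  proof (intro CollectI conjI)
    show "continuous_on UNIV (Tf w)"
      unfolding Tf_def by (intro continuous_intros contH)
    show "bounded (range (Tf w))" using bdT by (auto simp: bounded_iff)
  qed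
  define T where "T w = Bcontfun (Tf w)" for w
  have T: "apply_bcontfun (T w) = Tf w" for w
    unfolding T_def using Tb by (rule Bcontfun_inverse)
  have "\<exists>!w. T w = w"
  proof (rule banach_fix_type)
    show "\<forall>v w. dist (T v) (T w) \<le> 1 / 2 * dist v w"
    proof (intro allI dist_bound)
      fix v w t
      have "norm (H v t - H w t) \<le> (L * dist v w) / k * (exp (k * \<bar>t\<bar>) - 1)"
      proof (rule antiderivative_exp_bound[OF _ _ k])
        show "((\<lambda>t. H v t - H w t) has_vector_derivative (G (W v t) - G (W w t))) (at t)" for t
          by (intro derivative_intros H)
        show "norm (G (W v t) - G (W w t)) \<le> L * dist v w * exp (k * \<bar>t\<bar>)" for t
        proof -
          have "norm (G (W v t) - G (W w t)) \<le> L * norm (W v t - W w t)"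
            using lipschitz_onD[OF lip] by (simp add: dist_norm)
          also have "W v t - W w t = exp (k * \<bar>t\<bar>) *\<^sub>R (apply_bcontfun v t - apply_bcontfun w t)"
            by (simp add: W_def algebra_simps)
          also have "L * norm \<dots> = L * (exp (k * \<bar>t\<bar>) * dist (apply_bcontfun v t) (apply_bcontfun w t))"
            by (simp add: dist_norm)
          also have "\<dots> \<le> L * (exp (k * \<bar>t\<bar>) * dist v w)"
            using L0 dist_bounded by (intro mult_left_mono) auto
          finally show ?thesis by (simp add: algebra_simps)
        qed
      qed (simp add: H0)
      then have "norm (exp (- (k * \<bar>t\<bar>)) *\<^sub>R (H v t - H w t)) \<le> (L * dist v w) / k"
        by (rule normT) (use L0 in simp)
      also have "(L * dist v w) / k = L / k * dist v w" by simp
      also have "\<dots> \<le> 1 / 2 * dist v w"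
        using L0 by (intro mult_right_mono) (auto simp: k_def field_simps)
      finally show "dist (apply_bcontfun (T v) t) (apply_bcontfun (T w) t) \<le> 1 / 2 * dist v w"
        by (simp add: T Tf_def dist_norm scaleR_diff_right)
    qed
  qed auto
  then obtain w where w: "T w = w" by blast
  have "H w t = exp (k * \<bar>t\<bar>) *\<^sub>R apply_bcontfun w t" for t
  proof -
    have "apply_bcontfun w t = exp (- (k * \<bar>t\<bar>)) *\<^sub>R H w t" using T[of w] w by (simp add: Tf_def)
    then show ?thesis by (simp add: mult_exp_exp)
  qed
  then have WH: "W w t = x + H w t" for t by (simp add: W_def)
  have "((\<lambda>t. x + H w t) has_vector_derivative G (x + H w t)) (at t)" for t
    using H[of w t] by (auto intro!: derivative_eq_intros simp: WH)
  then show ?thesis by (intro exI[of _ "\<lambda>t. x + H w t"]) (simp add: H0)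
qed

text \<open>By Cauchy-Schwarz the derivative of |u - v|^2 is at most 2 L |u - v|^2, so multiplying
  by exp (- 2 L t) gives a nonincreasing function.\<close>

lemma lipschitz_solutions_forward:
  fixes u v :: "real \<Rightarrow> 'a::real_inner"
  assumes u: "\<And>t. (u has_vector_derivative F (u t)) (at t)"
    and v: "\<And>t. (v has_vector_derivative F (v t)) (at t)"
    and lip: "L-lipschitz_on X F" and X: "\<And>t. u t \<in> X" "\<And>t. v t \<in> X"
    and t: "t \<ge> 0"
  shows "norm (u t - v t) \<le> exp (L * t) * norm (u 0 - v 0)"
proof -
  define \<phi> where "\<phi> t = exp (- (2 * L * t)) * inner (u t - v t) (u t - v t)" for t
  have "\<phi> t \<le> \<phi> 0"
  proof (rule DERIV_nonpos_imp_nonincreasing[OF t])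
    fix s
    have d: "((\<lambda>t. u t - v t) has_vector_derivative (F (u s) - F (v s))) (at s)"
      by (intro derivative_intros u v)
    have "((\<lambda>t. inner (u t - v t) (u t - v t)) has_vector_derivative
        (inner (u s - v s) (F (u s) - F (v s)) + inner (F (u s) - F (v s)) (u s - v s))) (at s)"
      using bounded_bilinear.has_vector_derivative[OF bounded_bilinear_inner d d] by simp
    then have q: "((\<lambda>t. inner (u t - v t) (u t - v t)) has_real_derivative
        (2 * inner (F (u s) - F (v s)) (u s - v s))) (at s)"
      by (simp add: has_real_derivative_iff_has_vector_derivative inner_commute)
    have e: "((\<lambda>t. exp (- (2 * L * t))) has_real_derivative - (2 * L) * exp (- (2 * L * s))) (at s)"
      by (auto intro!: derivative_eq_intros)
    have "(\<phi> has_real_derivative exp (- (2 * L * s)) * (2 * inner (F (u s) - F (v s)) (u s - v s)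
        - 2 * L * inner (u s - v s) (u s - v s))) (at s)"
      unfolding \<phi>_def
      by (rule DERIV_cong[OF DERIV_mult[OF e q]]) (simp add: algebra_simps)
    note D = this
    have "inner (F (u s) - F (v s)) (u s - v s) \<le> L * inner (u s - v s) (u s - v s)"
    proof -
      have "inner (F (u s) - F (v s)) (u s - v s) \<le> norm (F (u s) - F (v s)) * norm (u s - v s)"
        by (rule norm_cauchy_schwarz)
      also have "\<dots> \<le> (L * norm (u s - v s)) * norm (u s - v s)"
        using lipschitz_onD[OF lip X] by (intro mult_right_mono) (auto simp: dist_norm)
      finally show ?thesis by (simp add: power2_norm_eq_inner[symmetric] power2_eq_square)
    qed
    then show "\<exists>y. (\<phi> has_real_derivative y) (at s) \<and> y \<le> 0"
      by - (rule exI, rule conjI, rule D, simp add: mult_nonneg_nonpos)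
  qed
  then have "(norm (u t - v t))\<^sup>2 \<le> (exp (L * t) * norm (u 0 - v 0))\<^sup>2"
    by (simp add: \<phi>_def power2_norm_eq_inner exp_minus field_simps
        flip: exp_of_nat_mult exp_double)
  then show ?thesis by (rule power2_le_imp_le) simp
qed

lemma lipschitz_solutions_diverge:
  fixes u v :: "real \<Rightarrow> 'a::real_inner"
  assumes u: "\<And>t. (u has_vector_derivative F (u t)) (at t)"
    and v: "\<And>t. (v has_vector_derivative F (v t)) (at t)"
    and lip: "L-lipschitz_on X F" and X: "\<And>t. u t \<in> X" "\<And>t. v t \<in> X"
  shows "norm (u t - v t) \<le> exp (L * \<bar>t\<bar>) * norm (u 0 - v 0)"
proof (cases "t \<ge> 0")
  case True
  then show ?thesis using lipschitz_solutions_forward[OF u v lip X True] by simp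
next
  case False
  have "norm (u (- (- t)) - v (- (- t))) \<le> exp (L * (- t)) * norm (u (- 0) - v (- 0))"
  proof (rule lipschitz_solutions_forward)
    show "((\<lambda>s. u (- s)) has_vector_derivative - F (u (- t))) (at t)"
      "((\<lambda>s. v (- s)) has_vector_derivative - F (v (- t))) (at t)" for t
      by (intro has_vector_derivative_reflect u v)+
    show "L-lipschitz_on X (\<lambda>x. - F x)" using lip by (rule lipschitz_on_minus)
  qed (use False X in auto)
  then show ?thesis using False by simp
qed

section \<open>Scalar differential inequalities at minus infinity\<close>

lemma deriv_nonneg_mono_on_le:
  fixes f :: "real \<Rightarrow> real"
  assumes "\<And>t. (f has_real_derivative f' t) (at t)" "\<And>t. t \<le> T \<Longrightarrow> f' t \<ge> 0"
    and "s \<le> t" "t \<le> T"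
  shows "f s \<le> f t"
  using assms(3) by (rule DERIV_nonneg_imp_nondecreasing) (use assms in force)

lemma nondecreasing_bounded_below_limit_at_bot:
  fixes f :: "real \<Rightarrow> real"
  assumes d: "\<And>t. (f has_real_derivative f' t) (at t)" "\<And>t. t \<le> T \<Longrightarrow> f' t \<ge> 0"
    and b: "\<And>t. t \<le> T \<Longrightarrow> b \<le> f t"
  shows "\<exists>l. (f \<longlongrightarrow> l) at_bot"
proof -
  define l where "l = Inf (f ` {..T})"
  have bdd: "bdd_below (f ` {..T})" using b by (auto intro!: bdd_belowI)
  have l: "l \<le> f t" if "t \<le> T" for t
    unfolding l_def using bdd that by (auto intro!: cInf_lower)
  have "(f \<longlongrightarrow> l) at_bot"
  proof (rule order_tendstoI)
    fix a assume "a < l"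
    then show "eventually (\<lambda>t. a < f t) at_bot"
      unfolding eventually_at_bot_linorder using l by (intro exI[of _ T]) force
  next
    fix a assume "l < a"
    then obtain t0 where t0: "t0 \<le> T" "f t0 < a"
      using cInf_lessD[of "f ` {..T}" a] by (auto simp: l_def)
    then have "f t < a" if "t \<le> t0" for t
      using deriv_nonneg_mono_on_le[OF d that t0(1)] by simp
    then show "eventually (\<lambda>t. f t < a) at_bot"
      unfolding eventually_at_bot_linorder by blast
  qed
  then show ?thesis by blast
qed

lemma nondecreasing_ge_limit_at_bot:
  fixes f :: "real \<Rightarrow> real"
  assumes d: "\<And>t. (f has_real_derivative f' t) (at t)" "\<And>t. t \<le> T \<Longrightarrow> f' t \<ge> 0"
    and l: "(f \<longlongrightarrow> l) at_bot" and t: "t \<le> T"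
  shows "l \<le> f t"
  using l
proof (rule tendsto_upperbound)
  show "eventually (\<lambda>s. f s \<le> f t) at_bot"
    unfolding eventually_at_bot_linorder using deriv_nonneg_mono_on_le[OF d _ t] by blast
qed simp

text \<open>A value \<open>g t\<close> of size a forces \<open>g\<close> to stay above a / 2 on an
  interval of fixed length before t, on which \<open>W\<close> gains a fixed amount. A convergent
  monotone \<open>W\<close> cannot do this at arbitrarily early times.\<close>

lemma barbalat_at_bot:
  fixes g W :: "real \<Rightarrow> real"
  assumes g: "\<And>t. (g has_real_derivative g' t) (at t)" and g': "\<And>t. \<bar>g' t\<bar> \<le> C"
    and W: "\<And>t. (W has_real_derivative W' t) (at t)" and w: "(W \<longlongrightarrow> w) at_bot"
    and g0: "\<And>t. 0 \<le> g t" and dom: "\<And>t. g t \<le> W' t"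
  shows "(g \<longlongrightarrow> 0) at_bot"
proof (rule order_tendstoI)
  fix a :: real assume "a < 0"
  then show "eventually (\<lambda>t. a < g t) at_bot" 
    using g0 by (intro always_eventually allI) (rule less_le_trans)
next
  fix a :: real assume a: "0 < a"
  \<comment> \<open>\<open>g\<close> changes by at most D h = a / 2 over a time h; the maximum with
    1 keeps the divisor positive.\<close>
  define D where "D = max C 1"
  define h where "h = a / (2 * D)"
  have D: "D > 0" "C \<le> D" by (auto simp: D_def)
  then have h: "h > 0" using a by (simp add: h_def)
  have "eventually (\<lambda>t. W t < w + h * (a / 2)) at_bot"
    by (rule order_tendstoD[OF w]) (use a h in simp)
  then show "eventually (\<lambda>t. g t < a) at_bot"
  proof eventually_elim
    fix t assume t: "W t < w + h * (a / 2)"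
    show "g t < a"
    proof (rule ccontr)
      assume ga: "\<not> g t < a"
      have "t - h < t" using h by simp
      from MVT2[OF this W] obtain x where x: "t - h < x" "x < t" "W t - W (t - h) = h * W' x" by auto
      from MVT2[OF x(2) g] obtain y where y: "x < y" "y < t" "g t - g x = (t - x) * g' y" by auto
      have "(t - x) * g' y \<le> (t - x) * D" using x g'[of y] D by (intro mult_left_mono) auto
      also have "\<dots> \<le> h * D" using x D by (intro mult_right_mono) auto
      also have "\<dots> = a / 2" using D by (simp add: h_def)
      finally have "a / 2 \<le> W' x" using y ga dom[of x] by linarith
      then have "h * (a / 2) \<le> W t - W (t - h)" unfolding x(3) using h by simp
      moreover have "w \<le> W (t - h)"
        by (rule nondecreasing_ge_limit_at_bot[OF W _ w order_refl]) (use dom g0 order_trans in blast)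
      ultimately show False using t by linarith
    qed
  qed
qed

text \<open>If the limit is positive, \<open>f\<close> has no zeros at early times, so by the
  intermediate value theorem its sign is constant there.\<close>

lemma square_limit_imp_limit_at_bot:
  fixes f :: "real \<Rightarrow> real"
  assumes c: "continuous_on UNIV f" and L: "((\<lambda>t. (f t)\<^sup>2) \<longlongrightarrow> L) at_bot"
  shows "\<exists>l. l\<^sup>2 = L \<and> (f \<longlongrightarrow> l) at_bot"
proof -
  have L0: "L \<ge> 0" by (rule tendsto_lowerbound[OF L]) auto
  have abs: "((\<lambda>t. \<bar>f t\<bar>) \<longlongrightarrow> sqrt L) at_bot" using tendsto_real_sqrt[OF L] by simp
  show ?thesis
  proof (cases "L = 0")
    case True
    then show ?thesis using abs tendsto_rabs_zero_iff[of f at_bot] by auto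
  next
    case False
    with L0 have "sqrt L > 0" by simp
    from order_tendstoD(1)[OF abs this] obtain T where T: "\<And>t. t \<le> T \<Longrightarrow> f t \<noteq> 0"
      by (auto simp: eventually_at_bot_linorder)
    have cont: "continuous_on {t..T} f" for t using c continuous_on_subset by blast
    show ?thesis
    proof (cases "f T > 0")
      case True
      have pos: "f t > 0" if "t \<le> T" for t
        using IVT'[of f t 0 T, OF _ _ that cont] T True by force
      have "\<bar>f t\<bar> = f t" if "t \<le> T" for t
        using pos[OF that] by linarith
      then have "eventually (\<lambda>t. \<bar>f t\<bar> = f t) at_bot"
        unfolding eventually_at_bot_linorder by blast
      then have "(f \<longlongrightarrow> sqrt L) at_bot" by (rule Lim_transform_eventually[OF abs])
      then show ?thesis using L0 by (intro exI[of _ "sqrt L"]) auto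
    next
      case False
      have neg: "f t < 0" if "t \<le> T" for t
        using IVT2'[of f T 0 t, OF _ _ that cont] T False by force
      have "- \<bar>f t\<bar> = f t" if "t \<le> T" for t
        using neg[OF that] by linarith
      then have "eventually (\<lambda>t. - \<bar>f t\<bar> = f t) at_bot"
        unfolding eventually_at_bot_linorder by blast
      then have "(f \<longlongrightarrow> - sqrt L) at_bot"
        by (rule Lim_transform_eventually[OF tendsto_minus[OF abs]])
      then show ?thesis using L0 by (intro exI[of _ "- sqrt L"]) auto
    qed
  qed
qed

text \<open>By the mean value theorem on [T - 1, T], the increment of \<open>f\<close> is close to
  m, but it also tends to 0. Applied to the components of an orbit, this makes the limit point an
  equilibrium.\<close>

lemma derivative_limit_zero_at_bot:
  fixes f :: "real \<Rightarrow> real"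
  assumes f: "\<And>t. (f has_real_derivative f' t) (at t)"
    and l: "(f \<longlongrightarrow> l) at_bot" and m: "(f' \<longlongrightarrow> m) at_bot"
  shows "m = 0"
proof (rule ccontr)
  assume "m \<noteq> 0"
  then have e: "\<bar>m\<bar> / 4 > 0" by simp
  have "eventually (\<lambda>t. \<bar>f t - l\<bar> < \<bar>m\<bar> / 4 \<and> \<bar>f' t - m\<bar> < \<bar>m\<bar> / 4) at_bot"
    using tendstoD[OF l e] tendstoD[OF m e] by eventually_elim (auto simp: dist_real_def)
  then obtain T where T: "\<And>t. t \<le> T \<Longrightarrow> \<bar>f t - l\<bar> < \<bar>m\<bar> / 4 \<and> \<bar>f' t - m\<bar> < \<bar>m\<bar> / 4"
    by (auto simp: eventually_at_bot_linorder)
  have "T - 1 < T" by simp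
  from MVT2[OF this f] obtain x where x: "x < T" "f T - f (T - 1) = f' x" by auto
  then show False using T[of T] T[of "T - 1"] T[of x] by linarith
qed

text \<open>Once l > k, the quotient X exp (- k t) is nondecreasing, so before T it is bounded by
  its value at T.\<close>

lemma growth_rate_exp_bound:
  fixes X :: "real \<Rightarrow> real"
  assumes X: "\<And>t. (X has_real_derivative l t * X t) (at t)" and pos: "\<And>t. X t > 0"
    and l: "(l \<longlongrightarrow> r) at_bot" and k: "k < r"
  shows "\<exists>K>0. \<exists>T. \<forall>t\<le>T. X t \<le> K * exp (k * t)"
proof -
  obtain T where T: "\<And>t. t \<le> T \<Longrightarrow> k < l t"
    using order_tendstoD(1)[OF l k] by (auto simp: eventually_at_bot_linorder)
  have "X t * exp (- (k * t)) \<le> X T * exp (- (k * T))" if "t \<le> T" for t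
  proof (rule deriv_nonneg_mono_on_le[OF _ _ that order_refl])
    show "((\<lambda>t. X t * exp (- (k * t))) has_real_derivative (l t - k) * X t * exp (- (k * t))) (at t)" for t
      by (auto intro!: derivative_eq_intros X simp: algebra_simps)
    show "(l t - k) * X t * exp (- (k * t)) \<ge> 0" if "t \<le> T" for t
      using T[OF that] pos[of t] by simp
  qed
  then show ?thesis using pos[of T]
    by (intro exI[of _ "X T * exp (- (k * T))"] conjI exI[of _ T]) (auto simp: exp_minus field_simps)
qed

text \<open>A negative limiting rate would make X decreasing at early times, so backwards it would
  stay above a positive value.\<close>

lemma growth_rate_nonneg:
  fixes X :: "real \<Rightarrow> real"
  assumes X: "\<And>t. (X has_real_derivative l t * X t) (at t)" and pos: "\<And>t. X t > 0"
    and l: "(l \<longlongrightarrow> r) at_bot" and X0: "(X \<longlongrightarrow> 0) at_bot"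
  shows "r \<ge> 0"
proof (rule ccontr)
  assume "\<not> r \<ge> 0"
  then obtain T where T: "\<And>t. t \<le> T \<Longrightarrow> l t < 0"
    using order_tendstoD(2)[OF l, of 0] by (auto simp: eventually_at_bot_linorder)
  have "- 0 \<le> - X T"
  proof (rule nondecreasing_ge_limit_at_bot[OF _ _ tendsto_minus[OF X0] order_refl])
    show "((\<lambda>t. - X t) has_real_derivative - (l t * X t)) (at t)" for t
      by (intro derivative_intros X)
    show "- (l t * X t) \<ge> 0" if "t \<le> T" for t
      using T[OF that] pos[of t] by (simp add: mult_nonpos_nonneg)
  qed
  then show False using pos[of T] by simp
qed

text \<open>The difference K / k exp (k t) - y tends to 0 and is nondecreasing up to T, hence
  nonnegative.\<close>

lemma exp_derivative_bound_at_bot: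
  fixes y :: "real \<Rightarrow> real"
  assumes y: "\<And>t. (y has_real_derivative y' t) (at t)" and y0: "(y \<longlongrightarrow> 0) at_bot"
    and k: "k > 0" and y': "\<And>t. t \<le> T \<Longrightarrow> y' t \<le> K * exp (k * t)" and t: "t \<le> T"
  shows "y t \<le> K / k * exp (k * t)"
proof -
  have e: "((\<lambda>t. K / k * exp (k * t)) \<longlongrightarrow> K / k * 0) at_bot"
    by (intro tendsto_intros filterlim_compose[OF exp_at_bot] filterlim_tendsto_pos_mult_at_bot[OF tendsto_const k filterlim_ident])
  have "K / k * 0 - 0 \<le> K / k * exp (k * t) - y t"
  proof (rule nondecreasing_ge_limit_at_bot[OF _ _ tendsto_diff[OF e y0] t])
    show "((\<lambda>t. K / k * exp (k * t) - y t) has_real_derivative K * exp (k * t) - y' t) (at t)" for t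
      using k by (auto intro!: derivative_eq_intros y)
    show "K * exp (k * t) - y' t \<ge> 0" if "t \<le> T" for t using y'[OF that] by simp
  qed
  then show ?thesis by simp
qed

text \<open>The factor \<open>h\<close> is the exponential of minus the integrated upper bound of
  the rate. It makes X h nonincreasing up to T, and X h lies below X, so backwards X stays above the
  positive number X T * h T.\<close>

lemma integrable_rate_not_tendsto_zero:
  fixes X :: "real \<Rightarrow> real"
  assumes X: "\<And>t. (X has_real_derivative l t * X t) (at t)" and pos: "\<And>t. X t > 0"
    and k: "k > 0" and K: "K \<ge> 0" and l: "\<And>t. t \<le> T \<Longrightarrow> l t \<le> K * exp (k * t)"
  shows "\<not> (X \<longlongrightarrow> 0) at_bot"
proof
  assume X0: "(X \<longlongrightarrow> 0) at_bot"
  define h where "h t = exp (- (K / k * exp (k * t)))" for t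
  have h1: "h t \<le> 1" for t using k K by (simp add: h_def)
  have h0: "h t > 0" for t by (simp add: h_def)
  have lim: "((\<lambda>t. - (X t * h t)) \<longlongrightarrow> - 0) at_bot"
  proof (rule tendsto_minus, rule tendsto_sandwich[OF _ _ tendsto_const X0])
    show "eventually (\<lambda>t. 0 \<le> X t * h t) at_bot"
      using pos h0 by (auto intro!: always_eventually mult_nonneg_nonneg less_imp_le)
    show "eventually (\<lambda>t. X t * h t \<le> X t) at_bot"
      using pos h1 by (auto intro!: always_eventually mult_left_le less_imp_le)
  qed
  have "- 0 \<le> - (X T * h T)"
  proof (rule nondecreasing_ge_limit_at_bot[OF _ _ lim order_refl])
    show "((\<lambda>t. - (X t * h t)) has_real_derivative (K * exp (k * t) - l t) * X t * h t) (at t)" for t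
      unfolding h_def using k by (auto intro!: derivative_eq_intros X simp: algebra_simps)
    show "(K * exp (k * t) - l t) * X t * h t \<ge> 0" if "t \<le> T" for t
      using l[OF that] pos[of t] h0[of t] by simp
  qed
  moreover have "X T * h T > 0" using pos h0 by (intro mult_pos_pos)
  ultimately show False by simp
qed

text \<open>Used to carry a sign or a zero of y from time 0 to all times.\<close>

lemma linear_ode_solution:
  fixes y :: "real \<Rightarrow> real"
  assumes y: "\<And>t. (y has_real_derivative a t * y t) (at t)" and a: "continuous_on UNIV a"
  obtains A where "\<And>t. y t = y 0 * exp (A t)"
proof -
  obtain A where A0: "A 0 = 0" and A: "\<And>t. (A has_real_derivative a t) (at t)"
    using antiderivative_exists[OF a] by (auto simp: has_real_derivative_iff_has_vector_derivative)
  have "\<forall>t. ((\<lambda>t. y t * exp (- A t)) has_real_derivative 0) (at t)"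
    by (auto intro!: derivative_eq_intros y A)
  from DERIV_isconst_all[OF this] have "y t * exp (- A t) = y 0 * exp (- A 0)" for t
    by blast
  then have "y t = y 0 * exp (A t)" for t
    using A0 by (metis exp_minus_inverse exp_zero minus_zero mult.assoc mult.commute mult.right_neutral)
  then show ?thesis by (rule that)
qed

section \<open>The vector field and its derivative\<close>

lemma vfield_simps:
  "vfield (M, P, \<theta>, A, S) =
     ((2 - 2 * (1 + 1/3 * (sin \<theta>)\<^sup>2) * M\<^sup>2 + 2 * A + 2 * sqrt 3 * cos \<theta> * S) * M,
      (- (2 * (1 + 1/3 * (sin \<theta>)\<^sup>2) * M\<^sup>2) - (3 + (sin \<theta>)\<^sup>2) * A + sqrt 3 * cos \<theta> * S) * P,
      - 2 * sqrt 3 * S * sin \<theta>,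
      - (2 * (1 + 1/3 * (sin \<theta>)\<^sup>2) * M\<^sup>2) * A - 2 * M\<^sup>2 + 3 * P\<^sup>2,
      - (2 * (1 + 1/3 * (sin \<theta>)\<^sup>2) * M\<^sup>2) * S
        - sqrt 3 * cos \<theta> * (2 * M\<^sup>2 + P\<^sup>2 - 2/3 * (sin \<theta>)\<^sup>2 * A\<^sup>2))"
  by (simp add: vfield_def decel_def)

text \<open>The Jacobian of \<open>vfield\<close> at the first argument applied to the second;
  \<open>dk\<close> is the directional derivative of k = 2 - q.\<close>

definition dvfield :: "state \<Rightarrow> state \<Rightarrow> state" where
  "dvfield = (\<lambda>(M, P, \<theta>, A, S) (m, p, h, a, s).
     let k = 2 * (1 + 1/3 * (sin \<theta>)\<^sup>2) * M\<^sup>2;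
         dk = 4/3 * sin \<theta> * cos \<theta> * h * M\<^sup>2 + 4 * (1 + 1/3 * (sin \<theta>)\<^sup>2) * M * m
     in ((- dk + 2 * a + 2 * sqrt 3 * (cos \<theta> * s - sin \<theta> * h * S)) * M
           + (2 - k + 2 * A + 2 * sqrt 3 * cos \<theta> * S) * m,
         (- dk - 2 * sin \<theta> * cos \<theta> * h * A - (3 + (sin \<theta>)\<^sup>2) * a
             + sqrt 3 * (cos \<theta> * s - sin \<theta> * h * S)) * P
           + (- k - (3 + (sin \<theta>)\<^sup>2) * A + sqrt 3 * cos \<theta> * S) * p,
         - 2 * sqrt 3 * (s * sin \<theta> + S * cos \<theta> * h),
         - dk * A - k * a - 4 * M * m + 6 * P * p,
         - dk * S - k * s + sqrt 3 * sin \<theta> * h * (2 * M\<^sup>2 + P\<^sup>2 - 2/3 * (sin \<theta>)\<^sup>2 * A\<^sup>2)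
           - sqrt 3 * cos \<theta> * (4 * M * m + 2 * P * p - 4/3 * sin \<theta> * cos \<theta> * h * A\<^sup>2
                                - 4/3 * (sin \<theta>)\<^sup>2 * A * a)))"

lemma vfield_path_derivative:
  "((\<lambda>t. vfield (z + t *\<^sub>R d)) has_vector_derivative dvfield (z + t *\<^sub>R d) d) (at t)"
proof -
  obtain M P \<theta> A S where z: "z = (M, P, \<theta>, A, S)" by (metis surj_pair)
  obtain m p h a s where d: "d = (m, p, h, a, s)" by (metis surj_pair)
  show ?thesis
    unfolding z d add_Pair scaleR_Pair vfield_simps dvfield_def Let_def split real_scaleR_def
    by (intro has_vector_derivative_Pair;
        unfold has_real_derivative_iff_has_vector_derivative[symmetric];
        (rule derivative_eq_intros refl)+; simp add: field_simps power2_eq_square)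
qed

lemma continuous_on_dvfield [continuous_intros]:
  fixes f g :: "'a::t2_space \<Rightarrow> state"
  assumes "continuous_on X f" "continuous_on X g"
  shows "continuous_on X (\<lambda>x. dvfield (f x) (g x))"
  unfolding dvfield_def Let_def split_beta
  by (auto intro!: continuous_intros assms)

lemma dvfield_scaleR: "dvfield z (c *\<^sub>R d) = c *\<^sub>R dvfield z d"
  by (cases z; cases d) (simp add: dvfield_def Let_def field_simps)

text \<open>Pairing with a fixed vector \<open>e\<close> makes the mean value theorem an equality
  for a vector-valued map; the intermediate point depends on \<open>e\<close>.\<close>

lemma vfield_mvt:
  obtains \<xi> where "0 < \<xi>" "\<xi> < 1"
    "inner e (vfield x - vfield y) = inner e (dvfield (y + \<xi> *\<^sub>R (x - y)) (x - y))"
proof -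
  have d: "((\<lambda>t. inner e (vfield (y + t *\<^sub>R (x - y)))) has_real_derivative
      inner e (dvfield (y + t *\<^sub>R (x - y)) (x - y))) (at t)" for t
    unfolding has_real_derivative_iff_has_vector_derivative
    by (rule bounded_linear.has_vector_derivative[OF bounded_linear_inner_right vfield_path_derivative])
  from MVT2[of 0 1, OF _ d] that show ?thesis by (auto simp: inner_diff_right)
qed

text \<open>Compactness of K times the unit sphere gives the bound for unit vectors, and homogeneity
  in \<open>d\<close> gives the rest.\<close>

lemma dvfield_bound:
  assumes "compact K"
  obtains L where "L \<ge> 0" "\<And>z d. z \<in> K \<Longrightarrow> norm (dvfield z d) \<le> L * norm d"
proof -
  have "compact ((\<lambda>w. dvfield (fst w) (snd w)) ` (K \<times> sphere 0 1))"
    by (intro compact_continuous_image compact_Times assms compact_sphere continuous_intros)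
  then obtain L where L: "L > 0" "\<And>z d. z \<in> K \<Longrightarrow> norm d = 1 \<Longrightarrow> norm (dvfield z d) \<le> L"
    by (auto dest!: compact_imp_bounded simp: bounded_pos)
  show ?thesis
  proof (rule that[of L])
    show "norm (dvfield z d) \<le> L * norm d" if z: "z \<in> K" for z d
    proof (cases "d = 0")
      case True
      then show ?thesis using dvfield_scaleR[of z 0 d] by simp
    next
      case False
      have "dvfield z d = norm d *\<^sub>R dvfield z (d /\<^sub>R norm d)"
        unfolding dvfield_scaleR[symmetric] using False by simp
      also have "norm \<dots> \<le> norm d * L"
        using L(2)[OF z, of "d /\<^sub>R norm d"] False by (simp add: mult_left_mono)
      finally show ?thesis by (simp add: mult.commute)
    qed
  qed (use L in simp)
qed

lemma vfield_lipschitz_cball: "\<exists>L. L-lipschitz_on (cball 0 R) vfield"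
proof -
  obtain L where L: "L \<ge> 0" "\<And>z d. z \<in> cball 0 R \<Longrightarrow> norm (dvfield z d) \<le> L * norm d"
    using dvfield_bound[OF compact_cball] by blast
  have "L-lipschitz_on (cball 0 R) vfield"
  proof (rule lipschitz_onI)
    fix x y :: state assume xy: "x \<in> cball 0 R" "y \<in> cball (0::state) R"
    \<comment> \<open>Testing the mean value identity against the difference itself yields its
      squared norm.\<close>
    define e where "e = vfield x - vfield y"
    obtain \<xi> where \<xi>: "0 < \<xi>" "\<xi> < 1"
      "inner e (vfield x - vfield y) = inner e (dvfield (y + \<xi> *\<^sub>R (x - y)) (x - y))"
      by (rule vfield_mvt)
    have "y + \<xi> *\<^sub>R (x - y) = (1 - \<xi>) *\<^sub>R y + \<xi> *\<^sub>R x" by (simp add: algebra_simps)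
    also have "\<dots> \<in> cball 0 R" using convex_cball[of 0 R] xy \<xi> by (intro convexD) auto
    finally have "norm (dvfield (y + \<xi> *\<^sub>R (x - y)) (x - y)) \<le> L * norm (x - y)" by (rule L(2))
    moreover have "(norm e)\<^sup>2 \<le> norm e * norm (dvfield (y + \<xi> *\<^sub>R (x - y)) (x - y))"
      using norm_cauchy_schwarz[of e] \<xi>(3) by (simp add: power2_norm_eq_inner e_def)
    ultimately have "norm e * norm e \<le> norm e * (L * norm (x - y))"
      by (smt (verit) mult_left_mono norm_ge_zero power2_eq_square)
    then have "norm e \<le> L * norm (x - y)"
      using L(1) by (cases "norm e = 0") auto
    then show "dist (vfield x) (vfield y) \<le> L * dist x y" by (simp add: e_def dist_norm)
  qed (rule L)
  then show ?thesis by blast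
qed

text \<open>\<open>\<kappa>\<close> is 1 on the ball of radius R and 0 outside that of radius R + 1.
  It has Lipschitz constant 1, and \<open>F\<close> is bounded by \<open>C\<close> wherever
  \<open>\<kappa>\<close> is nonzero, so the product has Lipschitz constant C + L.\<close>

lemma cutoff_lipschitz:
  fixes F :: "'a::euclidean_space \<Rightarrow> 'b::real_normed_vector"
  assumes lip: "L-lipschitz_on (cball 0 (R + 1)) F" and R: "R > 0"
  defines "\<kappa> \<equiv> \<lambda>z. max 0 (min 1 (R + 1 - norm z))"
  obtains L' C where "L'-lipschitz_on UNIV (\<lambda>z. \<kappa> z *\<^sub>R F z)" "\<And>z. norm (\<kappa> z *\<^sub>R F z) \<le> C"
proof -
  have L: "L \<ge> 0" using lip by (rule lipschitz_on_nonneg)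
  have "compact (F ` cball 0 (R + 1))"
    using lipschitz_on_continuous_on[OF lip] by (rule compact_continuous_image) simp
  then obtain C where C: "C > 0" "\<And>z. norm z \<le> R + 1 \<Longrightarrow> norm (F z) \<le> C"
    by (auto dest!: compact_imp_bounded simp: bounded_pos)
  have \<kappa>: "0 \<le> \<kappa> z" "\<kappa> z \<le> 1" for z by (auto simp: \<kappa>_def)
  have \<kappa>0: "\<kappa> z = 0" if "norm z > R + 1" for z using that by (simp add: \<kappa>_def)
  have \<kappa>L: "\<bar>\<kappa> x - \<kappa> y\<bar> \<le> norm (x - y)" for x y
    using norm_triangle_ineq3[of x y] by (auto simp: \<kappa>_def max_def min_def)
  \<comment> \<open>Only \<open>x\<close> is required to lie in the large ball; exchanging
    \<open>x\<close> and \<open>y\<close> then covers every case except both points outside, where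
    the product vanishes.\<close>
  have half: "norm (\<kappa> x *\<^sub>R F x - \<kappa> y *\<^sub>R F y) \<le> (C + L) * norm (x - y)"
    if "norm x \<le> R + 1" for x y
  proof (cases "norm y \<le> R + 1")
    case True
    have "\<kappa> x *\<^sub>R F x - \<kappa> y *\<^sub>R F y = (\<kappa> x - \<kappa> y) *\<^sub>R F x + \<kappa> y *\<^sub>R (F x - F y)"
      by (simp add: algebra_simps)
    also have "norm \<dots> \<le> \<bar>\<kappa> x - \<kappa> y\<bar> * norm (F x) + \<kappa> y * norm (F x - F y)"
      using \<kappa>[of y] norm_triangle_ineq by (metis abs_of_nonneg norm_scaleR)
    also have "\<dots> \<le> norm (x - y) * C + 1 * (L * norm (x - y))"
    proof (intro add_mono mult_mono \<kappa>L \<kappa> C(2) that)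
      show "norm (F x - F y) \<le> L * norm (x - y)"
        using lipschitz_onD[OF lip, of x y] that True by (simp add: dist_norm)
    qed (use L in auto)
    finally show ?thesis by (simp add: algebra_simps)
  next
    case False
    have "norm (\<kappa> x *\<^sub>R F x - \<kappa> y *\<^sub>R F y) = \<bar>\<kappa> x - \<kappa> y\<bar> * norm (F x)"
      using False \<kappa>0 by simp
    also have "\<dots> \<le> norm (x - y) * C" using that by (intro mult_mono \<kappa>L C(2)) auto
    also have "\<dots> \<le> (C + L) * norm (x - y)" using L by (simp add: algebra_simps)
    finally show ?thesis .
  qed
  show ?thesis
  proof (rule that)
    show "(C + L)-lipschitz_on UNIV (\<lambda>z. \<kappa> z *\<^sub>R F z)"
    proof (rule lipschitz_onI)
      fix x y
      show "dist (\<kappa> x *\<^sub>R F x) (\<kappa> y *\<^sub>R F y) \<le> (C + L) * dist x y"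
        using half[of x y] half[of y x] \<kappa>0[of x] \<kappa>0[of y] C L
        by (cases "norm x \<le> R + 1"; cases "norm y \<le> R + 1") (auto simp: dist_norm norm_minus_commute)
    qed (use C L in simp)
    show "norm (\<kappa> z *\<^sub>R F z) \<le> C" for z
    proof (cases "norm z \<le> R + 1")
      case True
      have "\<kappa> z * norm (F z) \<le> 1 * C" using \<kappa> C(2)[OF True] by (intro mult_mono) auto
      then show ?thesis using \<kappa> by simp
    qed (use \<kappa>0 C in simp)
  qed
qed

lemma B_plus_Omega_iff:
  "(M, P, \<theta>, A, S) \<in> B_plus_Omega \<longleftrightarrow>
     M > 0 \<and> P \<ge> 0 \<and> 0 < \<theta> \<and> \<theta> < pi \<and> Omega (M, P, \<theta>, A, S) > 0"
  by (auto simp: B_plus_Omega_def B_plus_def)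

lemma Omega_bounds:
  assumes "Omega (M, P, \<theta>, A, S) > 0"
  shows "M\<^sup>2 < 1" "P\<^sup>2 < 1" "A\<^sup>2 < 1" "S\<^sup>2 < 1" "\<bar>M\<bar> < 1" "\<bar>P\<bar> < 1" "\<bar>A\<bar> < 1" "\<bar>S\<bar> < 1"
proof -
  define w where "w = 1/3 * (sin \<theta>)\<^sup>2 * (M\<^sup>2 + A\<^sup>2)"
  have "Omega (M, P, \<theta>, A, S) = 1 - (M\<^sup>2 + A\<^sup>2) - w - P\<^sup>2 - S\<^sup>2"
    by (simp add: Omega_def w_def algebra_simps)
  moreover have "w \<ge> 0" by (simp add: w_def)
  ultimately have "M\<^sup>2 + A\<^sup>2 + P\<^sup>2 + S\<^sup>2 < 1" using assms by linarith
  then show *: "M\<^sup>2 < 1" "P\<^sup>2 < 1" "A\<^sup>2 < 1" "S\<^sup>2 < 1"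
    using zero_le_power2[of M] zero_le_power2[of P] zero_le_power2[of A] zero_le_power2[of S] by linarith+
  then show "\<bar>M\<bar> < 1" "\<bar>P\<bar> < 1" "\<bar>A\<bar> < 1" "\<bar>S\<bar> < 1"
    by (simp_all add: abs_square_less_1)
qed

text \<open>The radius is 1 for each of M, P, Sigma-plus, Sigma-minus, plus 4 as a bound for
  pi.\<close>

lemma B_plus_Omega_subset_cball: "B_plus_Omega \<subseteq> cball 0 8"
proof
  fix z assume z: "z \<in> B_plus_Omega"
  obtain M P \<theta> A S where e: "z = (M, P, \<theta>, A, S)" by (metis surj_pair)
  have "norm z \<le> norm M + (norm P + (norm \<theta> + (norm A + norm S)))"
    unfolding e by (meson norm_Pair_le add_left_mono order_trans)
  also have "\<dots> \<le> 8"
    using z Omega_bounds[of M P \<theta> A S] pi_less_4 by (auto simp: e B_plus_Omega_iff)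
  finally show "z \<in> cball 0 8" by simp
qed

section \<open>The flow\<close>

lemma has_vector_derivative_components:
  fixes u :: "real \<Rightarrow> state"
  assumes "(u has_vector_derivative w) (at t)"
  shows "((\<lambda>t. fst (u t)) has_real_derivative fst w) (at t)"
    "((\<lambda>t. fst (snd (u t))) has_real_derivative fst (snd w)) (at t)"
    "((\<lambda>t. fst (snd (snd (u t)))) has_real_derivative fst (snd (snd w))) (at t)"
    "((\<lambda>t. fst (snd (snd (snd (u t))))) has_real_derivative fst (snd (snd (snd w)))) (at t)"
    "((\<lambda>t. snd (snd (snd (snd (u t))))) has_real_derivative snd (snd (snd (snd w)))) (at t)"
  unfolding has_real_derivative_iff_has_vector_derivative
  by (intro assms bounded_linear.has_vector_derivative[OF bounded_linear_fst]
      bounded_linear.has_vector_derivative[OF bounded_linear_snd])+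

text \<open>With g = 1 this is Omega' = -2 (2 - q) Omega; the factor \<open>g\<close> covers the
  cut-off field as well.\<close>

lemma Omega_derivative:
  fixes M P \<theta> A S :: "real \<Rightarrow> real" and g :: real
  assumes "vfield (M t, P t, \<theta> t, A t, S t) = (m, p, h, a, s)"
    and "(M has_real_derivative g * m) (at t)" "(P has_real_derivative g * p) (at t)"
    "(\<theta> has_real_derivative g * h) (at t)" "(A has_real_derivative g * a) (at t)"
    "(S has_real_derivative g * s) (at t)"
  shows "((\<lambda>t. Omega (M t, P t, \<theta> t, A t, S t)) has_real_derivative
     g * (- 4 * (1 + 1/3 * (sin (\<theta> t))\<^sup>2) * (M t)\<^sup>2) * Omega (M t, P t, \<theta> t, A t, S t)) (at t)"
  using assms(1)[symmetric] assms(2-) unfolding Omega_def split vfield_simps prod.inject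
  by (auto intro!: derivative_eq_intros) (simp add: field_simps power2_eq_square)

text \<open>Multiplying the field by a scalar factor preserves the linear equations that
  govern the signs of M, P, sin theta and Omega. Hence a cutoff can make the field globally
  Lipschitz without affecting invariance.\<close>

lemma B_plus_Omega_invariant:
  assumes u: "\<And>t. (u has_vector_derivative g t *\<^sub>R vfield (u t)) (at t)"
    and g: "continuous_on UNIV g" and u0: "u 0 \<in> B_plus_Omega"
  shows "u t \<in> B_plus_Omega"
proof -
  define M P \<theta> A S where "M = (\<lambda>t. fst (u t))" and "P = (\<lambda>t. fst (snd (u t)))"
    and "\<theta> = (\<lambda>t. fst (snd (snd (u t))))" and "A = (\<lambda>t. fst (snd (snd (snd (u t)))))"
    and "S = (\<lambda>t. snd (snd (snd (snd (u t)))))"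
  note defs = M_def P_def \<theta>_def A_def S_def
  have u_eq: "u t = (M t, P t, \<theta> t, A t, S t)" for t by (simp add: defs)
  define m p h a s where "m = (\<lambda>t. fst (vfield (u t)))" and "p = (\<lambda>t. fst (snd (vfield (u t))))"
    and "h = (\<lambda>t. fst (snd (snd (vfield (u t)))))" and "a = (\<lambda>t. fst (snd (snd (snd (vfield (u t))))))"
    and "s = (\<lambda>t. snd (snd (snd (snd (vfield (u t))))))"
  have v_eq: "vfield (M t, P t, \<theta> t, A t, S t) = (m t, p t, h t, a t, s t)" for t
    by (simp add: m_def p_def h_def a_def s_def u_eq)
  have d: "(M has_real_derivative g t * m t) (at t)" "(P has_real_derivative g t * p t) (at t)"
    "(\<theta> has_real_derivative g t * h t) (at t)" "(A has_real_derivative g t * a t) (at t)"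
    "(S has_real_derivative g t * s t) (at t)" for t
    using has_vector_derivative_components[OF u[of t]]
    unfolding defs m_def p_def h_def a_def s_def fst_scaleR snd_scaleR real_scaleR_def by this
  have cont: "continuous_on UNIV M" "continuous_on UNIV P" "continuous_on UNIV \<theta>"
    "continuous_on UNIV A" "continuous_on UNIV S"
    by (intro continuous_at_imp_continuous_on ballI, rule DERIV_isCont, rule d)+
  define lM where "lM t = g t * (2 - 2 * (1 + 1/3 * (sin (\<theta> t))\<^sup>2) * (M t)\<^sup>2 + 2 * A t
    + 2 * sqrt 3 * cos (\<theta> t) * S t)" for t
  define lP where "lP t = g t * (- (2 * (1 + 1/3 * (sin (\<theta> t))\<^sup>2) * (M t)\<^sup>2) - (3 + (sin (\<theta> t))\<^sup>2) * A t
    + sqrt 3 * cos (\<theta> t) * S t)" for t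
  define l\<theta> where "l\<theta> t = g t * (- 2 * sqrt 3 * S t * cos (\<theta> t))" for t
  define lO where "lO t = g t * (- 4 * (1 + 1/3 * (sin (\<theta> t))\<^sup>2) * (M t)\<^sup>2)" for t
  have cl: "continuous_on UNIV lM" "continuous_on UNIV lP" "continuous_on UNIV l\<theta>" "continuous_on UNIV lO"
    unfolding lM_def lP_def l\<theta>_def lO_def by (auto intro!: continuous_intros cont g)
  have "(M has_real_derivative lM t * M t) (at t)" for t
    using d(1)[of t] v_eq[of t] by (auto simp: vfield_simps lM_def mult.assoc)
  from linear_ode_solution[OF this cl(1)] obtain KM where KM: "\<And>t. M t = M 0 * exp (KM t)" by blast
  have "(P has_real_derivative lP t * P t) (at t)" for t
    using d(2)[of t] v_eq[of t] by (auto simp: vfield_simps lP_def mult.assoc)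
  from linear_ode_solution[OF this cl(2)] obtain KP where KP: "\<And>t. P t = P 0 * exp (KP t)" by blast
  have "((\<lambda>t. sin (\<theta> t)) has_real_derivative l\<theta> t * sin (\<theta> t)) (at t)" for t
  proof -
    have "h t = - 2 * sqrt 3 * S t * sin (\<theta> t)" using v_eq[of t] by (simp add: vfield_simps)
    then show ?thesis by (auto intro!: derivative_eq_intros d(3) simp: l\<theta>_def)
  qed
  from linear_ode_solution[OF this cl(3)] obtain K\<theta>
    where K\<theta>: "\<And>t. sin (\<theta> t) = sin (\<theta> 0) * exp (K\<theta> t)" by blast
  have "((\<lambda>t. Omega (M t, P t, \<theta> t, A t, S t)) has_real_derivative
      lO t * Omega (M t, P t, \<theta> t, A t, S t)) (at t)" for t
    unfolding lO_def by (rule Omega_derivative[OF v_eq d])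
  from linear_ode_solution[OF this cl(4)] obtain KO where
    KO: "\<And>t. Omega (M t, P t, \<theta> t, A t, S t) = Omega (M 0, P 0, \<theta> 0, A 0, S 0) * exp (KO t)" by blast
  have init: "M 0 > 0" "P 0 \<ge> 0" "0 < \<theta> 0" "\<theta> 0 < pi" "Omega (M 0, P 0, \<theta> 0, A 0, S 0) > 0"
    using u0 by (simp_all add: u_eq B_plus_Omega_iff)
  have sinpos: "sin (\<theta> t) > 0" for t
    unfolding K\<theta>[of t] using init sin_gt_zero by simp
  have \<theta>_cont: "continuous_on X \<theta>" for X using cont(3) continuous_on_subset by blast
  \<comment> \<open>A positive sine fixes theta only modulo 2 pi. Continuity does the rest: leaving
    (0, pi) would mean passing through a zero of the sine.\<close>
  have IVT: "\<exists>r. \<theta> r = y" if "\<theta> x \<le> y" "y \<le> \<theta> z" for x y z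
    using IVT'[OF that _ \<theta>_cont] IVT2'[OF that _ \<theta>_cont] linear[of x z] by blast
  have "0 < \<theta> t"
  proof (rule ccontr)
    assume "\<not> 0 < \<theta> t"
    then obtain r where "\<theta> r = 0" using IVT[of t 0 0] init by auto
    then show False using sinpos[of r] by simp
  qed
  moreover have "\<theta> t < pi"
  proof (rule ccontr)
    assume "\<not> \<theta> t < pi"
    then obtain r where "\<theta> r = pi" using IVT[of 0 pi t] init by auto
    then show False using sinpos[of r] by simp
  qed
  ultimately show ?thesis
    unfolding u_eq B_plus_Omega_iff KO[of t] using init by (simp add: KM[of t] KP[of t])
qed

lemma global_solution_in_B_plus_Omega:
  assumes "global_solution x u" "x \<in> B_plus_Omega"
  shows "u t \<in> B_plus_Omega"
proof (rule B_plus_Omega_invariant)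
  show "(u has_vector_derivative 1 *\<^sub>R vfield (u t)) (at t)" for t
    using assms by (simp add: global_solution_def)
qed (use assms in \<open>simp_all add: global_solution_def\<close>)

text \<open>The solution of the cut-off field never leaves \<open>B_plus_Omega\<close>, hence stays
  in the ball of radius 8, where the cutoff is 1; so it solves the original equation.\<close>

lemma global_solution_exists:
  assumes x: "x \<in> B_plus_Omega"
  shows "\<exists>u. global_solution x u"
proof -
  define \<kappa> :: "state \<Rightarrow> real" where "\<kappa> z = max 0 (min 1 (8 + 1 - norm z))" for z
  obtain L where L: "L-lipschitz_on (cball 0 (8 + 1)) vfield" using vfield_lipschitz_cball by blast
  have "(8 :: real) > 0" by simp
  from cutoff_lipschitz[OF L this, folded \<kappa>_def] obtain L' C where
    G: "L'-lipschitz_on UNIV (\<lambda>z. \<kappa> z *\<^sub>R vfield z)" "\<And>z. norm (\<kappa> z *\<^sub>R vfield z) \<le> C"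
    by blast
  from bounded_lipschitz_global_solution[OF G, of x] obtain u where
    u: "u 0 = x" "\<And>t. (u has_vector_derivative \<kappa> (u t) *\<^sub>R vfield (u t)) (at t)" by blast
  have "continuous_on UNIV u"
    using u(2) by (meson continuous_at_imp_continuous_on has_vector_derivative_continuous)
  then have "continuous_on UNIV (\<lambda>t. \<kappa> (u t))"
    unfolding \<kappa>_def by (intro continuous_intros)
  from B_plus_Omega_invariant[OF u(2) this] have "u t \<in> B_plus_Omega" for t
    using u(1) x by simp
  then have "norm (u t) \<le> 8" for t
    using subsetD[OF B_plus_Omega_subset_cball] unfolding mem_cball_0 by blast
  then have "1 \<le> 8 + 1 - norm (u t)" for t by (simp add: algebra_simps)
  then have "\<kappa> (u t) = 1" for t by (simp add: \<kappa>_def min_absorb1)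
  then show ?thesis using u by (auto simp: global_solution_def intro!: exI[of _ u])
qed

text \<open>One constant for the whole phase space, so that each time map of the flow is globally
  Lipschitz there.\<close>

definition lipschitz_rate :: real where
  "lipschitz_rate = (SOME L. L-lipschitz_on B_plus_Omega vfield)"

lemma lipschitz_rate: "lipschitz_rate-lipschitz_on B_plus_Omega vfield"
  unfolding lipschitz_rate_def
  using vfield_lipschitz_cball lipschitz_on_subset[OF _ B_plus_Omega_subset_cball]
  by (metis someI_ex)

lemma global_solutions_diverge:
  assumes "global_solution x u" "global_solution y v" "x \<in> B_plus_Omega" "y \<in> B_plus_Omega"
  shows "norm (u t - v t) \<le> exp (lipschitz_rate * \<bar>t\<bar>) * norm (x - y)"
  using lipschitz_solutions_diverge[OF _ _ lipschitz_rate, of u v t]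
    global_solution_in_B_plus_Omega[OF assms(1,3)] global_solution_in_B_plus_Omega[OF assms(2,4)]
    assms(1,2) by (auto simp: global_solution_def)

text \<open>Two solutions with equal initial points have distance 0 by the divergence estimate; this
  uniqueness evaluates the \<open>THE\<close> in \<open>flow\<close>.\<close>

lemma flow_eq:
  assumes "global_solution x u" "x \<in> B_plus_Omega"
  shows "flow t x = u t"
proof -
  have "v = u" if "global_solution x v" for v
    using global_solutions_diverge[OF that assms(1) assms(2) assms(2)] by auto
  then have "(THE u. global_solution x u) = u" using assms(1) by (intro the_equality)
  then show ?thesis by (simp add: flow_def)
qed

lemma flow_global_solution: "x \<in> B_plus_Omega \<Longrightarrow> global_solution x (\<lambda>t. flow t x)"
  using global_solution_exists[of x] flow_eq by (metis (no_types, lifting) ext)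

lemma flow_in_B_plus_Omega: "x \<in> B_plus_Omega \<Longrightarrow> flow t x \<in> B_plus_Omega"
  using flow_global_solution global_solution_in_B_plus_Omega by blast

lemma flow_0: "x \<in> B_plus_Omega \<Longrightarrow> flow 0 x = x"
  using flow_global_solution by (auto simp: global_solution_def)

lemma flow_has_vector_derivative:
  "x \<in> B_plus_Omega \<Longrightarrow> ((\<lambda>t. flow t x) has_vector_derivative vfield (flow t x)) (at t)"
  using flow_global_solution by (auto simp: global_solution_def)

lemma flow_flow:
  assumes x: "x \<in> B_plus_Omega"
  shows "flow s (flow t x) = flow (s + t) x"
proof (rule flow_eq)
  show "global_solution (flow t x) (\<lambda>s. flow (s + t) x)"
    unfolding global_solution_def
  proof (intro conjI allI)
    fix r
    have "((\<lambda>s. flow (s + t) x) has_vector_derivative 1 *\<^sub>R vfield (flow (r + t) x)) (at r)"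
      by (rule vector_diff_chain_at[OF _ flow_has_vector_derivative[OF x], unfolded o_def])
        (auto intro!: derivative_eq_intros)
    then show "((\<lambda>s. flow (s + t) x) has_vector_derivative vfield (flow (r + t) x)) (at r)" by simp
  qed simp
qed (rule flow_in_B_plus_Omega[OF x])

lemma flow_lipschitz:
  assumes "x \<in> B_plus_Omega" "y \<in> B_plus_Omega"
  shows "norm (flow t x - flow t y) \<le> exp (lipschitz_rate * \<bar>t\<bar>) * norm (x - y)"
  by (intro global_solutions_diverge flow_global_solution assms)

lemma continuous_on_flow: "continuous_on B_plus_Omega (flow t)"
proof (rule lipschitz_on_continuous_on)
  show "(exp (lipschitz_rate * \<bar>t\<bar>))-lipschitz_on B_plus_Omega (flow t)"
    by (rule lipschitz_onI) (use flow_lipschitz in \<open>auto simp: dist_norm\<close>)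
qed

section \<open>Backward asymptotics of a non-OT orbit\<close>

lemma square_limit_zero_at_bot:
  fixes f :: "real \<Rightarrow> real"
  assumes "((\<lambda>t. (f t)\<^sup>2) \<longlongrightarrow> 0) at_bot"
  shows "(f \<longlongrightarrow> 0) at_bot"
  using tendsto_real_sqrt[OF assms] tendsto_rabs_zero_iff[of f at_bot] by simp

lemma abs_square_rate_le:
  fixes f r :: real
  assumes "f\<^sup>2 < 1" "\<bar>r\<bar> \<le> K"
  shows "\<bar>2 * (r * f) * f\<bar> \<le> 2 * K"
proof -
  have "\<bar>2 * (r * f) * f\<bar> = 2 * (\<bar>r\<bar> * f\<^sup>2)" by (simp add: abs_mult power2_eq_square)
  also have "\<dots> \<le> 2 * (K * 1)" using assms by (intro mult_left_mono mult_mono) auto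
  finally show ?thesis by simp
qed

text \<open>A scalar equation whose linear part has a constant sign keeps the square of its solution
  monotone up to the summable perturbation.\<close>

lemma signed_rate_limit_at_bot:
  fixes f W :: "real \<Rightarrow> real"
  assumes f: "\<And>t. (f has_real_derivative h t * f t + r t) (at t)"
    and W: "\<And>t. (W has_real_derivative W' t) (at t)" and w: "(W \<longlongrightarrow> w) at_bot"
    and r: "\<And>t. \<bar>r t\<bar> \<le> K * W' t" and B: "\<And>t. \<bar>f t\<bar> \<le> B"
    and K: "K \<ge> 0" and \<sigma>: "\<bar>\<sigma>\<bar> = 1" and h: "\<And>t. t \<le> T \<Longrightarrow> \<sigma> * h t \<ge> 0"
  shows "\<exists>l. (f \<longlongrightarrow> l) at_bot"
proof -
  have B0: "B \<ge> 0" using B[of 0] by linarith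
  have KW0: "K * W' t \<ge> 0" for t using r[of t] by linarith
  have \<sigma>2: "\<sigma> * \<sigma> = 1" using \<sigma> by (auto simp: abs_if split: if_splits)
  \<comment> \<open>The cross term in the derivative of f^2 is 2 f r, of size at most 2 B K W'; the
    added multiple of \<open>W\<close> compensates exactly this.\<close>
  define \<phi> where "\<phi> t = \<sigma> * (f t)\<^sup>2 + 2 * B * K * W t" for t
  define \<phi>' where "\<phi>' t = 2 * (\<sigma> * h t) * (f t)\<^sup>2 + 2 * (\<sigma> * (f t * r t)) + 2 * B * (K * W' t)" for t
  have d\<phi>: "(\<phi> has_real_derivative \<phi>' t) (at t)" for t
    unfolding \<phi>_def[abs_def] \<phi>'_def
    by (auto intro!: derivative_eq_intros f W simp: algebra_simps power2_eq_square)
  have \<phi>'0: "\<phi>' t \<ge> 0" if "t \<le> T" for t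
  proof -
    have "\<bar>\<sigma> * (f t * r t)\<bar> = \<bar>f t\<bar> * \<bar>r t\<bar>" using \<sigma> by (simp add: abs_mult)
    also have "\<dots> \<le> B * (K * W' t)" using B[of t] r[of t] B0 by (intro mult_mono) auto
    finally have "- (B * (K * W' t)) \<le> \<sigma> * (f t * r t)" by linarith
    moreover have "0 \<le> (\<sigma> * h t) * (f t)\<^sup>2" using h[OF that] by simp
    ultimately show ?thesis unfolding \<phi>'_def by linarith
  qed
  have "\<exists>l. (\<phi> \<longlongrightarrow> l) at_bot"
  proof (rule nondecreasing_bounded_below_limit_at_bot[OF d\<phi> \<phi>'0])
    fix t assume t: "t \<le> T"
    have f2: "(f t)\<^sup>2 \<le> B\<^sup>2" using B[of t] by (metis abs_ge_zero power2_abs power_mono)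
    have "\<bar>\<sigma> * (f t)\<^sup>2\<bar> \<le> B\<^sup>2" using \<sigma> f2 by (simp add: abs_mult)
    moreover have "B * (K * w) \<le> B * (K * W t)"
    proof (rule mult_left_mono[OF _ B0])
      show "K * w \<le> K * W t"
      proof (rule nondecreasing_ge_limit_at_bot[OF _ _ tendsto_mult_left[OF w] t])
        show "((\<lambda>t. K * W t) has_real_derivative K * W' t) (at t)" for t
          by (auto intro!: derivative_eq_intros W)
      qed (rule KW0)
    qed
    ultimately show "- B\<^sup>2 + 2 * (B * (K * w)) \<le> \<phi> t" unfolding \<phi>_def by linarith
  qed
  then obtain l where l: "(\<phi> \<longlongrightarrow> l) at_bot" by blast
  have "(f t)\<^sup>2 = \<sigma> * (\<phi> t - 2 * B * K * W t)" for t
    using \<sigma>2 by (simp add: \<phi>_def mult.assoc[symmetric])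
  moreover have "((\<lambda>t. \<sigma> * (\<phi> t - 2 * B * K * W t)) \<longlongrightarrow> \<sigma> * (l - 2 * B * K * w)) at_bot"
    by (intro tendsto_intros l w)
  ultimately have "((\<lambda>t. (f t)\<^sup>2) \<longlongrightarrow> \<sigma> * (l - 2 * B * K * w)) at_bot" by simp
  moreover have "continuous_on UNIV f"
    by (intro continuous_at_imp_continuous_on ballI, rule DERIV_isCont, rule f)
  ultimately show ?thesis using square_limit_imp_limit_at_bot by blast
qed

locale orbit =
  fixes M P \<theta> A S :: "real \<Rightarrow> real"
  assumes solution: "\<And>t. ((\<lambda>t. (M t, P t, \<theta> t, A t, S t)) has_vector_derivative
      vfield (M t, P t, \<theta> t, A t, S t)) (at t)"
    and in_B: "\<And>t. (M t, P t, \<theta> t, A t, S t) \<in> B_plus_Omega"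
    and P_pos: "\<And>t. P t > 0"
begin

definition "s t = sin (\<theta> t)"
definition "c t = cos (\<theta> t)"
text \<open>In terms of the deceleration parameter, k = 2 - q.\<close>

definition "k t = 2 * (1 + 1/3 * (s t)\<^sup>2) * (M t)\<^sup>2"
definition "Om t = Omega (M t, P t, \<theta> t, A t, S t)"

abbreviation "rate_M t \<equiv> 2 - k t + 2 * A t + 2 * sqrt 3 * c t * S t"
abbreviation "rate_P t \<equiv> - k t - (3 + (s t)\<^sup>2) * A t + sqrt 3 * c t * S t"

lemma dM: "(M has_real_derivative rate_M t * M t) (at t)"
  and dP: "(P has_real_derivative rate_P t * P t) (at t)"
  and d\<theta>: "(\<theta> has_real_derivative - 2 * sqrt 3 * S t * s t) (at t)"
  and dA: "(A has_real_derivative - k t * A t - 2 * (M t)\<^sup>2 + 3 * (P t)\<^sup>2) (at t)"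
  and dS: "(S has_real_derivative - k t * S t
      - sqrt 3 * c t * (2 * (M t)\<^sup>2 + (P t)\<^sup>2 - 2/3 * (s t)\<^sup>2 * (A t)\<^sup>2)) (at t)"
  using has_vector_derivative_components[OF solution[of t]]
  by (simp_all only: vfield_simps fst_conv snd_conv s_def c_def k_def)

lemma ds: "(s has_real_derivative - 2 * sqrt 3 * S t * c t * s t) (at t)"
  unfolding s_def[abs_def] c_def[abs_def]
  by (auto intro!: derivative_eq_intros d\<theta> simp: s_def)

lemma dc: "(c has_real_derivative 2 * sqrt 3 * S t * (s t)\<^sup>2) (at t)"
  unfolding c_def[abs_def]
  by (auto intro!: derivative_eq_intros d\<theta> simp: s_def power2_eq_square)

lemma dOm: "(Om has_real_derivative - 2 * k t * Om t) (at t)"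
proof -
  have "(Om has_real_derivative 1 * (- 4 * (1 + 1/3 * (sin (\<theta> t))\<^sup>2) * (M t)\<^sup>2) * Om t) (at t)"
    unfolding Om_def[abs_def]
    by (rule Omega_derivative[OF vfield_simps]) (use dM dP d\<theta> dA dS in \<open>simp_all add: s_def c_def k_def\<close>)
  then show ?thesis by (rule DERIV_cong) (simp add: k_def s_def field_simps)
qed

lemma sc: "(s t)\<^sup>2 + (c t)\<^sup>2 = 1"
  by (simp add: s_def c_def)

lemma M_pos: "M t > 0" and Om_pos: "Om t > 0" and s_pos: "s t > 0"
  using in_B[of t] by (auto simp: B_plus_Omega_iff Om_def s_def intro!: sin_gt_zero)

lemmas bounds = Omega_bounds[OF Om_pos[unfolded Om_def]]

lemma c_le: "\<bar>c t\<bar> \<le> 1"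
  by (simp add: c_def)

lemma s2_le: "(s t)\<^sup>2 \<le> 1"
  using sc[of t] zero_le_power2[of "c t"] by linarith

lemma k_bounds: "2 * (M t)\<^sup>2 \<le> k t" "k t \<le> 8/3 * (M t)\<^sup>2" "0 \<le> k t"
proof -
  have *: "k t = 2 * (M t)\<^sup>2 + 2/3 * ((s t)\<^sup>2 * (M t)\<^sup>2)" by (simp add: k_def field_simps)
  have "(s t)\<^sup>2 * (M t)\<^sup>2 \<le> 1 * (M t)\<^sup>2" using s2_le by (intro mult_right_mono) auto
  moreover have "0 \<le> (s t)\<^sup>2 * (M t)\<^sup>2" by simp
  ultimately show "2 * (M t)\<^sup>2 \<le> k t" "k t \<le> 8/3 * (M t)\<^sup>2" "0 \<le> k t"
    unfolding * using zero_le_power2[of "M t"] by linarith+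
qed

lemma sqrt3: "sqrt 3 \<le> 2" "sqrt 3 > 0"
  by (auto intro: real_le_lsqrt)

lemma abs_cS: "\<bar>sqrt 3 * c t * S t\<bar> \<le> 2 * \<bar>S t\<bar>"
proof -
  have "\<bar>sqrt 3 * c t * S t\<bar> = (sqrt 3 * \<bar>c t\<bar>) * \<bar>S t\<bar>" by (simp add: abs_mult)
  also have "\<dots> \<le> (2 * 1) * \<bar>S t\<bar>"
    using c_le sqrt3 by (intro mult_right_mono mult_mono) auto
  finally show ?thesis by simp
qed

lemma abs_kA: "\<bar>k t * A t\<bar> \<le> k t" and abs_kS: "\<bar>k t * S t\<bar> \<le> k t"
  using bounds(7,8)[of t] k_bounds(3)[of t] by (simp_all add: abs_mult mult_left_le)

text \<open>Crude bounds, whose only task is to give M^2 and P^2 bounded slopes for the Barbalat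
  argument.\<close>

lemma abs_rates: "\<bar>rate_M t\<bar> \<le> 11" "\<bar>rate_P t\<bar> \<le> 9"
proof -
  have "\<bar>(3 + (s t)\<^sup>2) * A t\<bar> \<le> 4 * 1"
    unfolding abs_mult using s2_le bounds(7)[of t] by (intro mult_mono) auto
  then show "\<bar>rate_M t\<bar> \<le> 11" "\<bar>rate_P t\<bar> \<le> 9"
    using abs_cS[of t] k_bounds[of t] bounds(1,7,8)[of t] by linarith+
qed

text \<open>W1 and W2 are bounded monotone functions with W1' = k and W2' at least 3 P^2;
  every error term below is dominated by the derivative of their sum W.\<close>

definition "W1 t = - ln (Om t) / 2"

lemma dW1: "(W1 has_real_derivative k t) (at t)"
  unfolding W1_def[abs_def] using Om_pos[of t]
  by (auto intro!: derivative_eq_intros dOm simp: field_simps)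

lemma Om_le: "Om t \<le> 1"
proof -
  have "0 \<le> (1 + 1/3 * (sin (\<theta> t))\<^sup>2) * ((M t)\<^sup>2 + (A t)\<^sup>2)" by simp
  then show ?thesis unfolding Om_def Omega_def split
    using zero_le_power2[of "P t"] zero_le_power2[of "S t"] by linarith
qed

lemma W1_nonneg: "W1 t \<ge> 0"
  using Om_le[of t] Om_pos[of t] by (simp add: W1_def)

lemma W1_limit: "\<exists>w. (W1 \<longlongrightarrow> w) at_bot"
  by (rule nondecreasing_bounded_below_limit_at_bot[OF dW1, of 0 0]) (use k_bounds W1_nonneg in auto)

lemma Om_eq: "Om t = exp (- 2 * W1 t)"
  using Om_pos[of t] by (simp add: W1_def)

lemma Om_limit: "\<exists>l>0. (Om \<longlongrightarrow> l) at_bot"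
proof -
  obtain w where "(W1 \<longlongrightarrow> w) at_bot" using W1_limit by blast
  then have "((\<lambda>t. exp (- 2 * W1 t)) \<longlongrightarrow> exp (- 2 * w)) at_bot" by (intro tendsto_intros)
  then show ?thesis unfolding Om_eq[abs_def] by (intro exI[of _ "exp (- 2 * w)"]) simp
qed

lemma M_limit: "(M \<longlongrightarrow> 0) at_bot"
proof -
  obtain w where w: "(W1 \<longlongrightarrow> w) at_bot" using W1_limit by blast
  have "((\<lambda>t. (M t)\<^sup>2) \<longlongrightarrow> 0) at_bot"
  proof (rule barbalat_at_bot[OF _ _ dW1 w])
    show "((\<lambda>t. (M t)\<^sup>2) has_real_derivative 2 * (rate_M t * M t) * M t) (at t)" for t
      by (auto intro!: derivative_eq_intros dM)
    show "\<bar>2 * (rate_M t * M t) * M t\<bar> \<le> 2 * 11" for t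
      by (intro abs_square_rate_le abs_rates bounds)
    show "(M t)\<^sup>2 \<le> k t" for t using k_bounds(1)[of t] zero_le_power2[of "M t"] by linarith
  qed simp
  then show ?thesis by (rule square_limit_zero_at_bot)
qed

definition "W2 t = A t + 2 * W1 t"
abbreviation "W2' t \<equiv> - k t * A t - 2 * (M t)\<^sup>2 + 3 * (P t)\<^sup>2 + 2 * k t"

lemma dW2: "(W2 has_real_derivative W2' t) (at t)"
  unfolding W2_def[abs_def] by (auto intro!: derivative_eq_intros dA dW1)

text \<open>Both |k A| and 2 M^2 are at most k, so the term 2 k from 2 \<open>W1\<close> absorbs
  every part of A' that could be negative.\<close>

lemma W2'_ge: "3 * (P t)\<^sup>2 \<le> W2' t"
  using abs_kA[of t] k_bounds(1)[of t] by (simp add: abs_le_iff)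

lemma W2_limit: "\<exists>w. (W2 \<longlongrightarrow> w) at_bot"
proof (rule nondecreasing_bounded_below_limit_at_bot[OF dW2, of 0 "-1"])
  show "W2' t \<ge> 0" for t using W2'_ge[of t] zero_le_power2[of "P t"] by linarith
  show "- 1 \<le> W2 t" for t using bounds(7)[of t] W1_nonneg[of t] by (simp add: W2_def)
qed

lemma P_limit: "(P \<longlongrightarrow> 0) at_bot"
proof -
  obtain w where w: "(W2 \<longlongrightarrow> w) at_bot" using W2_limit by blast
  have "((\<lambda>t. (P t)\<^sup>2) \<longlongrightarrow> 0) at_bot"
  proof (rule barbalat_at_bot[OF _ _ dW2 w])
    show "((\<lambda>t. (P t)\<^sup>2) has_real_derivative 2 * (rate_P t * P t) * P t) (at t)" for t
      by (auto intro!: derivative_eq_intros dP)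
    show "\<bar>2 * (rate_P t * P t) * P t\<bar> \<le> 2 * 9" for t
      by (intro abs_square_rate_le abs_rates bounds)
    show "(P t)\<^sup>2 \<le> W2' t" for t using W2'_ge[of t] zero_le_power2[of "P t"] by linarith
  qed simp
  then show ?thesis by (rule square_limit_zero_at_bot)
qed

lemma A_limit: "\<exists>l. (A \<longlongrightarrow> l) at_bot"
proof -
  obtain w1 w2 where w: "(W1 \<longlongrightarrow> w1) at_bot" "(W2 \<longlongrightarrow> w2) at_bot"
    using W1_limit W2_limit by blast
  have "((\<lambda>t. W2 t - 2 * W1 t) \<longlongrightarrow> w2 - 2 * w1) at_bot" by (intro tendsto_intros w)
  then show ?thesis by (auto simp: W2_def)
qed

text \<open>En is the conserved quantity of the limiting system for (Sigma-minus, theta).\<close>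

definition "En t = (S t)\<^sup>2 + 1/3 * (s t)\<^sup>2 * (A t)\<^sup>2"

text \<open>The constraint expresses \<open>En\<close> through quantities whose limits are already
  known.\<close>

lemma En_eq: "En t = 1 - Om t - k t / 2 - (A t)\<^sup>2 - (P t)\<^sup>2"
  by (simp add: En_def Om_def Omega_def k_def s_def field_simps)

lemma k_limit: "(k \<longlongrightarrow> 0) at_bot"
proof (rule tendsto_sandwich[OF _ _ tendsto_const])
  have "((\<lambda>t. 8/3 * (M t)\<^sup>2) \<longlongrightarrow> 8/3 * 0\<^sup>2) at_bot" by (intro tendsto_intros M_limit)
  then show "((\<lambda>t. 8/3 * (M t)\<^sup>2) \<longlongrightarrow> 0) at_bot" by simp
qed (use k_bounds in \<open>auto intro!: always_eventually\<close>)

lemma En_limit: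
  assumes "(Om \<longlongrightarrow> o1) at_bot" "(A \<longlongrightarrow> a) at_bot"
  shows "(En \<longlongrightarrow> 1 - o1 - a\<^sup>2) at_bot"
proof -
  have "(En \<longlongrightarrow> 1 - o1 - 0 / 2 - a\<^sup>2 - 0\<^sup>2) at_bot"
    unfolding En_eq[abs_def] by (intro tendsto_intros assms k_limit P_limit) simp
  then show ?thesis by simp
qed

definition "W t = W1 t + W2 t"
abbreviation "W' t \<equiv> k t + W2' t"

lemma dW: "(W has_real_derivative W' t) (at t)"
  unfolding W_def[abs_def] by (intro derivative_intros dW1 dW2)

lemma W_limit: "\<exists>w. (W \<longlongrightarrow> w) at_bot"
  using W1_limit W2_limit tendsto_add unfolding W_def[abs_def] by blast

lemma W'_ge: "k t + 3 * (P t)\<^sup>2 \<le> W' t"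
  using W2'_ge[of t] by linarith

end

section \<open>Convergence of theta and Sigma-minus\<close>

context orbit
begin

lemma cont_S: "continuous_on UNIV S"
  by (intro continuous_at_imp_continuous_on ballI, rule DERIV_isCont, rule dS)

lemma angle_bounds: "0 < \<theta> t" "\<theta> t < pi"
  using in_B[of t] by (auto simp: B_plus_Omega_iff)

text \<open>Since theta stays in (0, pi), it is recovered continuously from its cosine by
  \<open>arccos\<close>.\<close>

lemma limit_of_angle:
  assumes "(c \<longlongrightarrow> c0) at_bot"
  shows "\<bar>c0\<bar> \<le> 1" "(\<theta> \<longlongrightarrow> arccos c0) at_bot"
proof -
  have "((\<lambda>t. \<bar>c t\<bar>) \<longlongrightarrow> \<bar>c0\<bar>) at_bot" using assms by (rule tendsto_rabs)
  then show c0: "\<bar>c0\<bar> \<le> 1"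
    by (rule tendsto_upperbound) (auto intro!: always_eventually c_le)
  have "((\<lambda>t. arccos (c t)) \<longlongrightarrow> arccos c0) at_bot"
    using c0 c_le
    by (intro continuous_on_tendsto_compose[OF continuous_on_arccos' assms])
       (auto simp: abs_le_iff intro!: always_eventually)
  moreover have "arccos (c t) = \<theta> t" for t
    using angle_bounds[of t] by (simp add: c_def arccos_cos)
  ultimately show "(\<theta> \<longlongrightarrow> arccos c0) at_bot" by simp
qed

text \<open>With A frozen, (S, cos theta) moves by the linear saddle
  with eigenvalues 2A and -2A (up to the time change by the squared sine) whose eigencoordinates
  are S + A cos theta / sqrt 3 and S - A cos theta / sqrt 3.\<close>

lemma eigencoordinate_limit:
  assumes a: "(A \<longlongrightarrow> a) at_bot" "a \<noteq> 0" and e: "\<bar>e\<bar> = 1"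
  shows "\<exists>l. ((\<lambda>t. S t + e * (c t * A t / sqrt 3)) \<longlongrightarrow> l) at_bot"
proof -
  obtain w where w: "(W \<longlongrightarrow> w) at_bot" using W_limit by blast
  have e2: "e * e = 1" using e by (auto simp: abs_if split: if_splits)
  \<comment> \<open>Everything outside the saddle: each term carries a factor k, M^2 or P^2 and is
    therefore integrable.\<close>
  define r where "r t = - k t * S t - sqrt 3 * c t * (2 * (M t)\<^sup>2 + (P t)\<^sup>2)
    + e * (c t * (- k t * A t - 2 * (M t)\<^sup>2 + 3 * (P t)\<^sup>2) / sqrt 3)" for t
  \<comment> \<open>At early times the linear coefficient 2 e A s^2 has the sign of e a.\<close>
  define \<sigma> where "\<sigma> = sgn (e * a)"
  have "e * a \<noteq> 0" using a e by auto
  then have \<sigma>: "\<bar>\<sigma>\<bar> = 1" by (simp add: \<sigma>_def)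
  have "\<sigma> * (e * a) = \<bar>e * a\<bar>" by (simp add: \<sigma>_def abs_sgn mult.commute)
  then have "\<sigma> * (e * a) > 0" using \<open>e * a \<noteq> 0\<close> by simp
  moreover have "((\<lambda>t. \<sigma> * (e * A t)) \<longlongrightarrow> \<sigma> * (e * a)) at_bot" by (intro tendsto_intros a)
  ultimately have "eventually (\<lambda>t. \<sigma> * (e * A t) > 0) at_bot" by (rule order_tendstoD[rotated])
  then obtain T where T: "\<And>t. t \<le> T \<Longrightarrow> \<sigma> * (e * A t) > 0"
    by (auto simp: eventually_at_bot_linorder)
  have inv3: "1 / sqrt 3 = sqrt 3 / 3" by (simp add: field_simps)
  show ?thesis
  proof (rule signed_rate_limit_at_bot[OF _ dW w _ _ _ \<sigma>])
    show "((\<lambda>t. S t + e * (c t * A t / sqrt 3)) has_real_derivative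
      (2 * e * A t * (s t)\<^sup>2) * (S t + e * (c t * A t / sqrt 3)) + r t) (at t)" for t
    proof -
      have "((\<lambda>t. S t + e * (c t * A t / sqrt 3)) has_real_derivative
        (- k t * S t - sqrt 3 * c t * (2 * (M t)\<^sup>2 + (P t)\<^sup>2 - 2/3 * (s t)\<^sup>2 * (A t)\<^sup>2))
        + e * ((2 * sqrt 3 * S t * (s t)\<^sup>2 * A t
           + (- k t * A t - 2 * (M t)\<^sup>2 + 3 * (P t)\<^sup>2) * c t) / sqrt 3)) (at t)"
        by (rule DERIV_add[OF dS DERIV_cmult[OF DERIV_cdivide[OF DERIV_mult[OF dc dA]]]])
      moreover have "(2 * e * A t * (s t)\<^sup>2) * (e * (c t * A t / sqrt 3))
          = sqrt 3 * c t * (2/3 * (s t)\<^sup>2 * (A t)\<^sup>2)"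
      proof -
        have "(2 * e * A t * (s t)\<^sup>2) * (e * (c t * A t / sqrt 3))
          = (e * e) * (2 * (s t)\<^sup>2 * (A t)\<^sup>2 * c t) * (1 / sqrt 3)" by (simp add: power2_eq_square)
        then show ?thesis unfolding e2 inv3 by simp
      qed
      ultimately show ?thesis
        by (elim DERIV_cong) (simp add: r_def algebra_simps add_divide_distrib diff_divide_distrib)
    qed
    \<comment> \<open>The three parts are at most k, 4 M^2 + 2 P^2 and k + 2 M^2 + 3 P^2; with 6 M^2
      <= 3 k their sum is at most 5 (k + P^2).\<close>
    show "\<bar>r t\<bar> \<le> 5 * W' t" for t
    proof -
      have M2: "0 \<le> (M t)\<^sup>2" and P2: "0 \<le> (P t)\<^sup>2" by auto
      define x where "x = sqrt 3 * c t * (2 * (M t)\<^sup>2 + (P t)\<^sup>2)"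
      define y where "y = e * (c t * (- k t * A t - 2 * (M t)\<^sup>2 + 3 * (P t)\<^sup>2) / sqrt 3)"
      have "r t = - (k t * S t) - x + y" by (simp add: r_def x_def y_def)
      moreover have "\<bar>x\<bar> \<le> (2 * 1) * (2 * (M t)\<^sup>2 + (P t)\<^sup>2)"
        unfolding x_def abs_mult using sqrt3 c_le[of t] M2 P2
        by (intro mult_mono) auto
      moreover have "\<bar>y\<bar> \<le> k t + 2 * (M t)\<^sup>2 + 3 * (P t)\<^sup>2"
      proof -
        have ab: "\<bar>- k t * A t - 2 * (M t)\<^sup>2 + 3 * (P t)\<^sup>2\<bar> \<le> k t + 2 * (M t)\<^sup>2 + 3 * (P t)\<^sup>2"
          using abs_kA[of t] M2 P2 by linarith
        have "\<bar>e * (c t * (- k t * A t - 2 * (M t)\<^sup>2 + 3 * (P t)\<^sup>2) / sqrt 3)\<bar>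
          = \<bar>c t\<bar> * \<bar>- k t * A t - 2 * (M t)\<^sup>2 + 3 * (P t)\<^sup>2\<bar> * (1 / sqrt 3)"
          using e by (simp add: abs_mult)
        also have "\<dots> \<le> 1 * (k t + 2 * (M t)\<^sup>2 + 3 * (P t)\<^sup>2) * 1"
          using c_le[of t] k_bounds(3)[of t] by (intro mult_mono ab) auto
        finally show ?thesis by (simp add: y_def)
      qed
      ultimately show ?thesis
        using abs_kS[of t] k_bounds(1,3)[of t] W'_ge[of t] M2 P2 by argo
    qed
    show "\<bar>S t + e * (c t * A t / sqrt 3)\<bar> \<le> 2" for t
    proof -
      have "\<bar>e * (c t * A t / sqrt 3)\<bar> = \<bar>c t\<bar> * \<bar>A t\<bar> * (1 / sqrt 3)" using e by (simp add: abs_mult)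
      also have "\<dots> \<le> 1 * 1 * 1" using c_le[of t] bounds(7)[of t] by (intro mult_mono) auto
      finally show ?thesis using bounds(8)[of t] by linarith
    qed
    show "\<sigma> * (2 * e * A t * (s t)\<^sup>2) \<ge> 0" if "t \<le> T" for t
    proof -
      have *: "\<sigma> * (2 * e * A t * (s t)\<^sup>2) = 2 * (\<sigma> * (e * A t)) * (s t)\<^sup>2" by simp
      have "0 \<le> 2 * (\<sigma> * (e * A t))" using T[OF that] by linarith
      then show ?thesis unfolding * by (rule mult_nonneg_nonneg) simp
    qed
  qed simp
qed

text \<open>S is the half-sum of the two eigencoordinates; cos theta is their half-difference
  divided by A / sqrt 3, which is where a nonzero limit of A enters.\<close>

lemma limit_of_A_nonzero:
  assumes a: "(A \<longlongrightarrow> a) at_bot" "a \<noteq> 0"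
  shows "\<exists>c0 b. (c \<longlongrightarrow> c0) at_bot \<and> (S \<longlongrightarrow> b) at_bot"
proof -
  obtain l where l: "((\<lambda>t. S t + 1 * (c t * A t / sqrt 3)) \<longlongrightarrow> l) at_bot"
    using eigencoordinate_limit[OF a, of 1] by auto
  obtain m where m: "((\<lambda>t. S t + (-1) * (c t * A t / sqrt 3)) \<longlongrightarrow> m) at_bot"
    using eigencoordinate_limit[OF a, of "-1"] by auto
  have "((\<lambda>t. ((S t + 1 * (c t * A t / sqrt 3)) + (S t + (-1) * (c t * A t / sqrt 3))) / 2)
      \<longlongrightarrow> (l + m) / 2) at_bot"
    by (intro tendsto_intros l m) simp
  then have S: "(S \<longlongrightarrow> (l + m) / 2) at_bot" by simp
  have "((\<lambda>t. ((S t + 1 * (c t * A t / sqrt 3)) - (S t + (-1) * (c t * A t / sqrt 3))) * (sqrt 3 / 2) / A t)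
      \<longlongrightarrow> (l - m) * (sqrt 3 / 2) / a) at_bot"
    by (intro tendsto_intros l m a)
  moreover have "eventually (\<lambda>t. A t \<noteq> 0) at_bot" using a by (rule tendsto_imp_eventually_ne)
  then have "eventually (\<lambda>t. ((S t + 1 * (c t * A t / sqrt 3)) - (S t + (-1) * (c t * A t / sqrt 3)))
      * (sqrt 3 / 2) / A t = c t) at_bot"
    by eventually_elim (simp add: field_simps)
  ultimately have "(c \<longlongrightarrow> (l - m) * (sqrt 3 / 2) / a) at_bot" by (rule Lim_transform_eventually)
  with S show ?thesis by blast
qed

text \<open>When A tends to 0, the part s^2 A^2 / 3 of \<open>En\<close> vanishes in the limit, and
  the convergence of \<open>En\<close> becomes that of S^2.\<close>

lemma limit_of_S:
  assumes a: "(A \<longlongrightarrow> 0) at_bot" and o1: "(Om \<longlongrightarrow> o1) at_bot"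
  shows "\<exists>b. b\<^sup>2 = 1 - o1 \<and> (S \<longlongrightarrow> b) at_bot"
proof (rule square_limit_imp_limit_at_bot[OF cont_S])
  have "((\<lambda>t. (s t)\<^sup>2 * (A t)\<^sup>2) \<longlongrightarrow> 0) at_bot"
  proof (rule tendsto_sandwich[OF _ _ tendsto_const])
    have "((\<lambda>t. (A t)\<^sup>2) \<longlongrightarrow> 0\<^sup>2) at_bot" by (intro tendsto_intros a)
    then show "((\<lambda>t. (A t)\<^sup>2) \<longlongrightarrow> 0) at_bot" by simp
    show "eventually (\<lambda>t. (s t)\<^sup>2 * (A t)\<^sup>2 \<le> (A t)\<^sup>2) at_bot"
      using s2_le by (intro always_eventually allI mult_left_le_one_le) auto
  qed auto
  then have "((\<lambda>t. En t - 1/3 * ((s t)\<^sup>2 * (A t)\<^sup>2)) \<longlongrightarrow> (1 - o1 - 0\<^sup>2) - 1/3 * 0) at_bot"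
    by (intro tendsto_intros En_limit a o1)
  then show "((\<lambda>t. (S t)\<^sup>2) \<longlongrightarrow> 1 - o1) at_bot" by (simp add: En_def)
qed

text \<open>The derivative 2 sqrt 3 S s^2 of cos theta eventually has the sign of b, so cos theta is
  monotone and bounded.\<close>

lemma limit_of_c:
  assumes b: "(S \<longlongrightarrow> b) at_bot" "b \<noteq> 0"
  shows "\<exists>c0. (c \<longlongrightarrow> c0) at_bot"
proof -
  define \<sigma> where "\<sigma> = sgn b"
  have \<sigma>: "\<bar>\<sigma>\<bar> = 1" "\<sigma> * b > 0" "\<sigma> * \<sigma> = 1" using b by (auto simp: \<sigma>_def sgn_if)
  have "((\<lambda>t. \<sigma> * S t) \<longlongrightarrow> \<sigma> * b) at_bot" by (intro tendsto_intros b)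
  from order_tendstoD(1)[OF this \<sigma>(2)] obtain T where T: "\<And>t. t \<le> T \<Longrightarrow> \<sigma> * S t > 0"
    by (auto simp: eventually_at_bot_linorder)
  have "\<exists>l. ((\<lambda>t. \<sigma> * c t) \<longlongrightarrow> l) at_bot"
  proof (rule nondecreasing_bounded_below_limit_at_bot)
    show "((\<lambda>t. \<sigma> * c t) has_real_derivative 2 * sqrt 3 * (\<sigma> * S t) * (s t)\<^sup>2) (at t)" for t
      by (auto intro!: derivative_eq_intros dc)
    show "2 * sqrt 3 * (\<sigma> * S t) * (s t)\<^sup>2 \<ge> 0" if "t \<le> T" for t using T[OF that] by simp
    show "-1 \<le> \<sigma> * c t" for t
    proof -
      have "\<bar>\<sigma> * c t\<bar> \<le> 1" unfolding abs_mult \<sigma>(1) using c_le by simp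
      then show ?thesis by linarith
    qed
  qed
  then obtain l where "((\<lambda>t. \<sigma> * c t) \<longlongrightarrow> l) at_bot" by blast
  then have "((\<lambda>t. \<sigma> * (\<sigma> * c t)) \<longlongrightarrow> \<sigma> * l) at_bot" by (rule tendsto_mult_left)
  then show ?thesis using \<sigma>(3) by (auto simp: mult.assoc[symmetric])
qed

text \<open>The matter term P is what forces the shear to survive: without shear the rate of P would be
  integrable.\<close>

lemma shear_limit_nonzero:
  assumes a: "(A \<longlongrightarrow> 0) at_bot" and b: "(S \<longlongrightarrow> 0) at_bot" and o1: "(Om \<longlongrightarrow> 1) at_bot"
  shows False
proof -
  have z: "((\<lambda>t. \<bar>sqrt 3 * c t * S t\<bar>) \<longlongrightarrow> 0) at_bot"
  proof (rule tendsto_sandwich[OF _ _ tendsto_const])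
    have "((\<lambda>t. 2 * \<bar>S t\<bar>) \<longlongrightarrow> 2 * \<bar>0\<bar>) at_bot" by (intro tendsto_intros b)
    then show "((\<lambda>t. 2 * \<bar>S t\<bar>) \<longlongrightarrow> 0) at_bot" by simp
  qed (auto intro!: always_eventually abs_cS)
  then have z: "((\<lambda>t. sqrt 3 * c t * S t) \<longlongrightarrow> 0) at_bot" by (simp only: tendsto_rabs_zero_iff)
  have "((\<lambda>t. 2 - k t + 2 * A t + 2 * (sqrt 3 * c t * S t)) \<longlongrightarrow> 2 - 0 + 2 * 0 + 2 * 0) at_bot"
    by (intro tendsto_intros k_limit a z)
  then have "((\<lambda>t. rate_M t) \<longlongrightarrow> 2) at_bot" by (simp add: mult.assoc)
  \<comment> \<open>Without shear the rate of M tends to 2; the exponent 1 is a choice below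
    it.\<close>
  from growth_rate_exp_bound[OF dM M_pos this, of 1] obtain K T where K: "K > 0"
    and KT: "\<And>t. t \<le> T \<Longrightarrow> M t \<le> K * exp (1 * t)" by auto
  have M2: "(M t)\<^sup>2 \<le> K\<^sup>2 * exp (2 * t)" if "t \<le> T" for t
  proof -
    have "(M t)\<^sup>2 \<le> (K * exp (1 * t))\<^sup>2"
      using KT[OF that] M_pos[of t] by (intro power_mono) auto
    then show ?thesis by (simp add: power_mult_distrib exp_double)
  qed
  \<comment> \<open>Integrating Omega' = -2 k Omega from minus infinity turns the decay of M^2 into
    the same decay of 1 - Omega.\<close>
  have Om1: "1 - Om t \<le> 6 * K\<^sup>2 / 2 * exp (2 * t)" if "t \<le> T" for t
  proof (rule exp_derivative_bound_at_bot[OF _ _ _ _ that])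
    show "((\<lambda>t. 1 - Om t) has_real_derivative 2 * k t * Om t) (at t)" for t
      by (auto intro!: derivative_eq_intros dOm)
    have "((\<lambda>t. 1 - Om t) \<longlongrightarrow> 1 - 1) at_bot" by (intro tendsto_intros o1)
    then show "((\<lambda>t. 1 - Om t) \<longlongrightarrow> 0) at_bot" by simp
    show "2 * k t * Om t \<le> 6 * K\<^sup>2 * exp (2 * t)" if "t \<le> T" for t
    proof -
      have "2 * k t * Om t \<le> 2 * k t * 1"
        using k_bounds(3)[of t] Om_le[of t] by (intro mult_left_mono) auto
      then show ?thesis using k_bounds(2)[of t] M2[OF that] zero_le_power2[of "M t"] by linarith
    qed
  qed simp
  \<comment> \<open>By the constraint, A^2 + S^2 <= 1 - Omega <= 3 K^2 exp (2 t).\<close>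
  define K' where "K' = sqrt 3 * K"
  have small: "\<bar>A t\<bar> \<le> K' * exp t" "\<bar>S t\<bar> \<le> K' * exp t" if "t \<le> T" for t
  proof -
    have "(K' * exp t)\<^sup>2 = 3 * K\<^sup>2 * exp (2 * t)"
      by (simp add: K'_def power_mult_distrib exp_double)
    moreover have "0 \<le> 1/3 * (s t)\<^sup>2 * (A t)\<^sup>2" by simp
    ultimately have "(A t)\<^sup>2 + (S t)\<^sup>2 \<le> (K' * exp t)\<^sup>2"
      using Om1[OF that] En_eq[of t] zero_le_power2[of "P t"] k_bounds(3)[of t] unfolding En_def
      by linarith
    then have "(A t)\<^sup>2 \<le> (K' * exp t)\<^sup>2" "(S t)\<^sup>2 \<le> (K' * exp t)\<^sup>2"
      using zero_le_power2[of "A t"] zero_le_power2[of "S t"] by linarith+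
    moreover have "K' * exp t \<ge> 0" using K by (simp add: K'_def)
    ultimately show "\<bar>A t\<bar> \<le> K' * exp t" "\<bar>S t\<bar> \<le> K' * exp t"
      by (simp_all add: abs_le_square_iff[symmetric])
  qed
  have "\<not> (P \<longlongrightarrow> 0) at_bot"
  proof (rule integrable_rate_not_tendsto_zero[OF dP P_pos, of 1 "6 * K'" T])
    show "rate_P t \<le> 6 * K' * exp (1 * t)" if "t \<le> T" for t
    proof -
      have "\<bar>(3 + (s t)\<^sup>2) * A t\<bar> \<le> 4 * \<bar>A t\<bar>"
        unfolding abs_mult using s2_le by (intro mult_right_mono) auto
      then show ?thesis
        using small[OF that] abs_cS[of t] k_bounds(3)[of t] by simp
    qed
  qed (use K in \<open>simp_all add: K'_def\<close>)
  then show False using P_limit by blast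
qed

text \<open>For a = 0 the saddle degenerates and the order changes: S converges first, by the
  conserved quantity, and its nonzero limit then makes cos theta monotone.\<close>

theorem limit_exists:
  obtains \<psi> a b where "(\<theta> \<longlongrightarrow> \<psi>) at_bot" "(A \<longlongrightarrow> a) at_bot" "(S \<longlongrightarrow> b) at_bot" "(a, b) \<noteq> (0, 0)"
proof -
  obtain a where a: "(A \<longlongrightarrow> a) at_bot" using A_limit by blast
  obtain o1 where o1: "(Om \<longlongrightarrow> o1) at_bot" using Om_limit by blast
  show ?thesis
  proof (cases "a = 0")
    case False
    then obtain c0 b where "(c \<longlongrightarrow> c0) at_bot" "(S \<longlongrightarrow> b) at_bot"
      using limit_of_A_nonzero[OF a] by blast
    then show ?thesis using that[OF limit_of_angle(2) a] False by blast
  next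
    case True
    with a have a: "(A \<longlongrightarrow> 0) at_bot" by simp
    then obtain b where b: "b\<^sup>2 = 1 - o1" "(S \<longlongrightarrow> b) at_bot" using limit_of_S[OF a o1] by blast
    have "b \<noteq> 0"
    proof
      assume "b = 0"
      then show False using shear_limit_nonzero[OF a] b o1 by simp
    qed
    then obtain c0 where "(c \<longlongrightarrow> c0) at_bot" using limit_of_c b by blast
    then show ?thesis using that[OF limit_of_angle(2) a b(2)] \<open>b \<noteq> 0\<close> by blast
  qed
qed

end

section \<open>Equilibrium conditions and strict positivity of the limiting growth rates\<close>

context orbit
begin

lemma slow_variable_bound:
  fixes y :: "real \<Rightarrow> real"
  assumes y: "\<And>t. (y has_real_derivative y' t) (at t)" and y0: "(y \<longlongrightarrow> 0) at_bot"
    and r: "r > 0" and K: "K \<ge> 0" and y': "\<And>t. t \<le> T \<Longrightarrow> y' t \<le> - k t * y t + K * exp (r * t)"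
  shows "\<exists>K'\<ge>0. \<forall>t\<le>T. y t \<le> K' * exp (r * t)"
proof -
  obtain w where w: "(W1 \<longlongrightarrow> w) at_bot" using W1_limit by blast
  define E where "E = exp (W1 T)"
  have E: "exp (W1 t) \<le> E" if "t \<le> T" for t
    unfolding E_def using deriv_nonneg_mono_on_le[OF dW1 k_bounds(3) that order_refl] by simp
  have v: "y t * exp (W1 t) \<le> K * E / r * exp (r * t)" if "t \<le> T" for t
  proof (rule exp_derivative_bound_at_bot[OF _ _ r _ that])
    show "((\<lambda>t. y t * exp (W1 t)) has_real_derivative (y' t + k t * y t) * exp (W1 t)) (at t)" for t
      by (auto intro!: derivative_eq_intros y dW1 simp: algebra_simps)
    have "((\<lambda>t. y t * exp (W1 t)) \<longlongrightarrow> 0 * exp w) at_bot" by (intro tendsto_intros y0 w)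
    then show "((\<lambda>t. y t * exp (W1 t)) \<longlongrightarrow> 0) at_bot" by simp
    show "(y' t + k t * y t) * exp (W1 t) \<le> K * E * exp (r * t)" if "t \<le> T" for t
    proof -
      have "(y' t + k t * y t) * exp (W1 t) \<le> (K * exp (r * t)) * exp (W1 t)"
        using y'[OF that] by (intro mult_right_mono) auto
      also have "\<dots> \<le> (K * exp (r * t)) * E" using E[OF that] K by (intro mult_left_mono) auto
      finally show ?thesis by (simp add: mult_ac)
    qed
  qed
  have KE: "K * E / r \<ge> 0" using K r by (simp add: E_def)
  have "y t \<le> K * E / r * exp (r * t)" if "t \<le> T" for t
  proof (cases "y t \<ge> 0")
    case True
    have "1 \<le> exp (W1 t)" using W1_nonneg by simp
    then have "y t \<le> y t * exp (W1 t)" using True by (simp add: mult_le_cancel_left1)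
    then show ?thesis using v[OF that] by linarith
  next
    case False
    have "0 \<le> K * E / r * exp (r * t)" using KE by (intro mult_nonneg_nonneg) auto
    then show ?thesis using False by linarith
  qed
  then show ?thesis using KE by blast
qed

text \<open>The tool for vanishing limiting rates. Here \<open>y\<close> is the rate with cos theta
  frozen at its limit and k left out; it is driven only by s^2, so it inherits the exponential bound
  of s^2 and makes the rate \<open>l\<close> integrable from above.\<close>

lemma slow_rate_not_tendsto_zero:
  fixes X y :: "real \<Rightarrow> real"
  assumes X: "\<And>t. (X has_real_derivative l t * X t) (at t)" and pos: "\<And>t. X t > 0"
    and X0: "(X \<longlongrightarrow> 0) at_bot"
    and y: "\<And>t. (y has_real_derivative y' t) (at t)" and y0: "(y \<longlongrightarrow> 0) at_bot"
    and r: "r > 0" and s: "\<And>t. t \<le> T \<Longrightarrow> (s t)\<^sup>2 \<le> K * exp (r * t)"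
    and y': "\<And>t. t \<le> T \<Longrightarrow> y' t \<le> - k t * y t + D * (s t)\<^sup>2"
    and l: "\<And>t. t \<le> T \<Longrightarrow> l t \<le> y t + D * (s t)\<^sup>2" and D: "D \<ge> 0"
  shows False
proof -
  have "0 \<le> K * exp (r * T)" using s[of T] zero_le_power2[of "s T"] by linarith
  then have K: "K \<ge> 0" by (simp add: zero_le_mult_iff)
  have Ds: "D * (s t)\<^sup>2 \<le> D * K * exp (r * t)" if "t \<le> T" for t
    using mult_left_mono[OF s[OF that] D] by (simp add: mult.assoc)
  have "\<exists>K'\<ge>0. \<forall>t\<le>T. y t \<le> K' * exp (r * t)"
  proof (rule slow_variable_bound[OF y y0 r])
    show "y' t \<le> - k t * y t + D * K * exp (r * t)" if "t \<le> T" for t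
      using y'[OF that] Ds[OF that] by linarith
  qed (use K D in simp)
  then obtain K' where K': "K' \<ge> 0" "\<And>t. t \<le> T \<Longrightarrow> y t \<le> K' * exp (r * t)" by blast
  have "\<not> (X \<longlongrightarrow> 0) at_bot"
  proof (rule integrable_rate_not_tendsto_zero[OF X pos r])
    show "l t \<le> (K' + D * K) * exp (r * t)" if "t \<le> T" for t
      using l[OF that] Ds[OF that] K'(2)[OF that] by (simp add: algebra_simps)
  qed (use K K' D in simp)
  then show False using X0 by blast
qed

context
  fixes \<psi> a b :: real
  assumes lim\<theta>: "(\<theta> \<longlongrightarrow> \<psi>) at_bot" and limA: "(A \<longlongrightarrow> a) at_bot" and limS: "(S \<longlongrightarrow> b) at_bot"
begin

lemma limit_c: "(c \<longlongrightarrow> cos \<psi>) at_bot" and limit_s: "(s \<longlongrightarrow> sin \<psi>) at_bot"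
  unfolding c_def[abs_def] s_def[abs_def] by (intro tendsto_intros lim\<theta>)+

lemma limit_angle_bounds: "0 \<le> \<psi>" "\<psi> \<le> pi"
  using tendsto_lowerbound[OF lim\<theta>, of 0] tendsto_upperbound[OF lim\<theta>, of pi] angle_bounds
  by (auto simp: less_imp_le)

lemma limit_rates:
  "(rate_M \<longlongrightarrow> 2 + 2 * a + 2 * sqrt 3 * cos \<psi> * b) at_bot"
  "(rate_P \<longlongrightarrow> - (3 + (sin \<psi>)\<^sup>2) * a + sqrt 3 * cos \<psi> * b) at_bot"
  "((\<lambda>t. - 2 * sqrt 3 * S t * c t) \<longlongrightarrow> - 2 * sqrt 3 * b * cos \<psi>) at_bot"
proof -
  have "(rate_M \<longlongrightarrow> 2 - 0 + 2 * a + 2 * sqrt 3 * cos \<psi> * b) at_bot"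
    "(rate_P \<longlongrightarrow> - 0 - (3 + (sin \<psi>)\<^sup>2) * a + sqrt 3 * cos \<psi> * b) at_bot"
    by (intro tendsto_intros limit_c limit_s limA limS k_limit)+
  then show "(rate_M \<longlongrightarrow> 2 + 2 * a + 2 * sqrt 3 * cos \<psi> * b) at_bot"
    "(rate_P \<longlongrightarrow> - (3 + (sin \<psi>)\<^sup>2) * a + sqrt 3 * cos \<psi> * b) at_bot"
    by (simp_all only: diff_0_right minus_zero diff_0 minus_mult_left)
qed (intro tendsto_intros limit_c limS)

text \<open>In the limit the constraint leaves 1 minus the limit of Omega for the shear, and that
  limit is positive.\<close>

lemma limit_shear_lt_1: "a\<^sup>2 + b\<^sup>2 < 1"
proof -
  obtain o1 where o1: "o1 > 0" "(Om \<longlongrightarrow> o1) at_bot" using Om_limit by blast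
  have "(En \<longlongrightarrow> b\<^sup>2 + 1/3 * (sin \<psi>)\<^sup>2 * a\<^sup>2) at_bot"
    unfolding En_def[abs_def] by (intro tendsto_intros limS limit_s limA)
  with En_limit[OF o1(2) limA] have "1 - o1 - a\<^sup>2 = b\<^sup>2 + 1/3 * (sin \<psi>)\<^sup>2 * a\<^sup>2"
    using tendsto_unique trivial_limit_at_bot_linorder by blast
  moreover have "0 \<le> 1/3 * (sin \<psi>)\<^sup>2 * a\<^sup>2" by simp
  ultimately show ?thesis using o1(1) by linarith
qed

lemma limit_rate_P_nonneg: "- (3 + (sin \<psi>)\<^sup>2) * a + sqrt 3 * cos \<psi> * b \<ge> 0"
  by (rule growth_rate_nonneg[OF dP P_pos limit_rates(2) P_limit])

text \<open>If sin \<psi> is nonzero, the vanishing limit of (cos theta)' forces b = 0, and that of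
  S' then forces cos \<psi> = 0. The sign of a comes from the rate of P, which tends to -4
  a.\<close>

lemma limit_stationary:
  assumes "(a, b) \<noteq> (0, 0)"
  shows "sin \<psi> = 0 \<or> \<psi> = pi / 2 \<and> b = 0 \<and> a < 0"
proof (cases "sin \<psi> = 0")
  case False
  have "((\<lambda>t. 2 * sqrt 3 * S t * (s t)\<^sup>2) \<longlongrightarrow> 2 * sqrt 3 * b * (sin \<psi>)\<^sup>2) at_bot"
    by (intro tendsto_intros limS limit_s)
  from derivative_limit_zero_at_bot[OF dc limit_c this] False have b: "b = 0" by simp
  have "((\<lambda>t. - k t * S t - sqrt 3 * c t * (2 * (M t)\<^sup>2 + (P t)\<^sup>2 - 2/3 * (s t)\<^sup>2 * (A t)\<^sup>2))
    \<longlongrightarrow> - 0 * b - sqrt 3 * cos \<psi> * (2 * 0\<^sup>2 + 0\<^sup>2 - 2/3 * (sin \<psi>)\<^sup>2 * a\<^sup>2)) at_bot"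
    by (intro tendsto_intros limA limS limit_s limit_c k_limit M_limit P_limit)
  from derivative_limit_zero_at_bot[OF dS limS this] False b assms have cos: "cos \<psi> = 0" by simp
  then have "cos \<psi> = cos (pi / 2)" by simp
  then have \<psi>: "\<psi> = pi / 2"
    using limit_angle_bounds cos_inj_pi[of \<psi> "pi / 2"] by simp
  have "a \<le> 0" using limit_rate_P_nonneg cos \<psi> by simp
  then show ?thesis using b \<psi> assms by auto
qed simp

context
  assumes diag: "sin \<psi> = 0" and shear: "(a, b) \<noteq> (0, 0)"
begin

lemma cos_limit_cases: "cos \<psi> = 1 \<or> cos \<psi> = -1"
  using diag sin_zero_abs_cos_one by fastforce

text \<open>The factor cos \<psi> = 1 or -1 treats both ends at once. With x = cos \<psi> * c t one
  has s^2 = (1 - x) (1 + x), and 1 + x >= 1 as soon as x >= 0.\<close>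

lemma eventually_near_axis:
  "\<exists>T. \<forall>t\<le>T. cos \<psi> * c t \<ge> 0 \<and> 1 - cos \<psi> * c t \<le> (s t)\<^sup>2"
proof -
  have "((\<lambda>t. cos \<psi> * c t) \<longlongrightarrow> cos \<psi> * cos \<psi>) at_bot" by (intro tendsto_intros limit_c)
  then have "((\<lambda>t. cos \<psi> * c t) \<longlongrightarrow> 1) at_bot" using cos_limit_cases by auto
  from order_tendstoD(1)[OF this, of 0] obtain T where T: "\<And>t. t \<le> T \<Longrightarrow> cos \<psi> * c t > 0"
    by (auto simp: eventually_at_bot_linorder)
  have "1 - cos \<psi> * c t \<le> (s t)\<^sup>2" if "t \<le> T" for t
  proof -
    have "(cos \<psi> * c t)\<^sup>2 = (c t)\<^sup>2" using cos_limit_cases by auto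
    moreover have "(1 - x) * (1 + x) = 1 - x\<^sup>2" for x :: real
      by (simp add: algebra_simps power2_eq_square)
    ultimately have "(s t)\<^sup>2 = (1 - cos \<psi> * c t) * (1 + cos \<psi> * c t)"
      using sc[of t] by simp
    moreover have "cos \<psi> * c t \<le> 1" using cos_limit_cases c_le[of t] by auto
    then have "(1 - cos \<psi> * c t) * 1 \<le> (1 - cos \<psi> * c t) * (1 + cos \<psi> * c t)"
      using T[OF that] by (intro mult_left_mono) auto
    ultimately show ?thesis by simp
  qed
  then show ?thesis using T by (intro exI[of _ T]) (auto simp: less_imp_le)
qed

lemma limit_rate_s_nonneg: "cos \<psi> * b \<le> 0"
proof -
  have "(s \<longlongrightarrow> 0) at_bot" using limit_s diag by simp
  from growth_rate_nonneg[OF ds s_pos limit_rates(3) this]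
  have "0 \<le> (2 * sqrt 3) * (- (cos \<psi> * b))" by (simp add: mult_ac)
  then show ?thesis unfolding zero_le_mult_iff by auto
qed

text \<open>If b = 0, all of M, P, and hence S are exponentially small, so that the rate of the sine of
  theta would be integrable.\<close>

lemma limit_S_nonzero: "b \<noteq> 0"
proof
  assume b: "b = 0"
  with shear limit_rate_P_nonneg diag have a: "a < 0" by auto
  have a1: "a > -1" using limit_shear_lt_1 b by (simp add: abs_square_less_1)
  \<comment> \<open>Half the smaller of the limiting rates of P and M, both positive because -1 < a
    < 0.\<close>
  define r where "r = min (- 3 * a) (2 + 2 * a) / 2"
  have r: "r > 0" "r < - 3 * a" "r < 2 + 2 * a" using a a1 by (auto simp: r_def)
  have "(rate_M \<longlongrightarrow> 2 + 2 * a) at_bot" "(rate_P \<longlongrightarrow> - 3 * a) at_bot"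
    using limit_rates(1,2) b diag by simp_all
  from growth_rate_exp_bound[OF dM M_pos this(1) r(3)] growth_rate_exp_bound[OF dP P_pos this(2) r(2)]
  obtain K1 T1 K2 T2 where K1: "\<And>t. t \<le> T1 \<Longrightarrow> M t \<le> K1 * exp (r * t)"
    and K2: "\<And>t. t \<le> T2 \<Longrightarrow> P t \<le> K2 * exp (r * t)" by blast
  define T where "T = min T1 T2"
  \<comment> \<open>The factor 10 dominates the coefficients 28/3 of M^2 and 6 of P^2 in the
    estimate of \<open>E'\<close> below.\<close>
  define K where "K = 10 * (K1\<^sup>2 + K2\<^sup>2)"
  have MP: "10 * ((M t)\<^sup>2 + (P t)\<^sup>2) \<le> K * exp (2 * r * t)" if "t \<le> T" for t
  proof -
    have "(M t)\<^sup>2 \<le> (K1 * exp (r * t))\<^sup>2" "(P t)\<^sup>2 \<le> (K2 * exp (r * t))\<^sup>2"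
      using K1[of t] K2[of t] that M_pos[of t] P_pos[of t] by (auto simp: T_def intro!: power_mono)
    moreover have "(exp (r * t))\<^sup>2 = exp (2 * r * t)" by (simp add: exp_double[symmetric] mult.assoc)
    ultimately show ?thesis by (simp add: K_def power_mult_distrib algebra_simps)
  qed
  \<comment> \<open>In the derivative of \<open>En\<close> the two saddle terms, multiples of c s^2
    A^2 S, cancel; what is left carries k, M^2 or P^2.\<close>
  define E' where "E' t = - 2 * k t * (S t)\<^sup>2 - 2 * (sqrt 3 * c t * S t) * (2 * (M t)\<^sup>2 + (P t)\<^sup>2)
    + 2/3 * (s t)\<^sup>2 * (- k t * (A t)\<^sup>2 - 2 * (M t)\<^sup>2 * A t + 3 * (P t)\<^sup>2 * A t)" for t
  have dE: "(En has_real_derivative E' t) (at t)" for t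
    unfolding En_def[abs_def] E'_def
    by (rule derivative_eq_intros dS ds dA refl)+
       (simp add: field_simps power2_eq_square)
  have E'_le: "E' t \<le> K * exp (2 * r * t)" if "t \<le> T" for t
  proof -
    have M2: "0 \<le> (M t)\<^sup>2" and P2: "0 \<le> (P t)\<^sup>2" and kS: "0 \<le> k t * (S t)\<^sup>2" and kA: "0 \<le> k t * (A t)\<^sup>2"
      using k_bounds(3) by auto
    define x where "x = (sqrt 3 * c t * S t) * (2 * (M t)\<^sup>2 + (P t)\<^sup>2)"
    define y where "y = (s t)\<^sup>2 * (- k t * (A t)\<^sup>2 - 2 * (M t)\<^sup>2 * A t + 3 * (P t)\<^sup>2 * A t)"
    have "E' t = - 2 * (k t * (S t)\<^sup>2) - 2 * x + 2/3 * y" by (simp add: E'_def x_def y_def)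
    moreover have "\<bar>x\<bar> \<le> 2 * (2 * (M t)\<^sup>2 + (P t)\<^sup>2)"
      unfolding x_def abs_mult[of "sqrt 3 * c t * S t"] using abs_cS[of t] bounds(8)[of t] M2 P2
      by (intro mult_mono) auto
    moreover have "y \<le> 2 * (M t)\<^sup>2 + 3 * (P t)\<^sup>2"
    proof -
      have "\<bar>(M t)\<^sup>2 * A t\<bar> \<le> (M t)\<^sup>2" "\<bar>(P t)\<^sup>2 * A t\<bar> \<le> (P t)\<^sup>2"
        using bounds(7)[of t] by (simp_all add: abs_mult mult_left_le)
      then have "- k t * (A t)\<^sup>2 - 2 * (M t)\<^sup>2 * A t + 3 * (P t)\<^sup>2 * A t \<le> 2 * (M t)\<^sup>2 + 3 * (P t)\<^sup>2"
        using kA by linarith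
      then have "(s t)\<^sup>2 * (- k t * (A t)\<^sup>2 - 2 * (M t)\<^sup>2 * A t + 3 * (P t)\<^sup>2 * A t)
          \<le> (s t)\<^sup>2 * (2 * (M t)\<^sup>2 + 3 * (P t)\<^sup>2)" by (intro mult_left_mono) auto
      also have "\<dots> \<le> 1 * (2 * (M t)\<^sup>2 + 3 * (P t)\<^sup>2)"
        using s2_le M2 P2 by (intro mult_right_mono) auto
      finally show ?thesis by (simp add: y_def)
    qed
    ultimately have "E' t \<le> 10 * ((M t)\<^sup>2 + (P t)\<^sup>2)" using M2 P2 kS by argo
    then show ?thesis using MP[OF that] by linarith
  qed
  have En0: "(En \<longlongrightarrow> 0) at_bot"
  proof -
    have "(En \<longlongrightarrow> b\<^sup>2 + 1/3 * (sin \<psi>)\<^sup>2 * a\<^sup>2) at_bot"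
      unfolding En_def[abs_def] by (intro tendsto_intros limS limit_s limA)
    then show ?thesis using b diag by simp
  qed
  have "En t \<le> K / (2 * r) * exp (2 * r * t)" if "t \<le> T" for t
    by (rule exp_derivative_bound_at_bot[OF dE En0 _ E'_le that]) (use r in auto)
  then have S2: "(S t)\<^sup>2 \<le> K / (2 * r) * exp (2 * r * t)" if "t \<le> T" for t
  proof -
    have "0 \<le> 1/3 * (s t)\<^sup>2 * (A t)\<^sup>2" by simp
    then show ?thesis using \<open>\<And>t. t \<le> T \<Longrightarrow> En t \<le> _ t\<close>[OF that] unfolding En_def by linarith
  qed
  define K' where "K' = sqrt (K / (2 * r))"
  have K0: "K / (2 * r) \<ge> 0" using r by (simp add: K_def)
  then have K': "K' \<ge> 0" by (simp add: K'_def)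
  have S: "\<bar>S t\<bar> \<le> K' * exp (r * t)" if "t \<le> T" for t
  proof -
    have "(S t)\<^sup>2 \<le> (K' * exp (r * t))\<^sup>2"
      using S2[OF that] K0 by (simp add: K'_def power_mult_distrib exp_double[symmetric] mult.assoc)
    then show ?thesis using K' by (simp add: abs_le_square_iff[symmetric])
  qed
  have "\<not> (s \<longlongrightarrow> 0) at_bot"
  proof (rule integrable_rate_not_tendsto_zero[OF ds s_pos r(1)])
    show "- 2 * sqrt 3 * S t * c t \<le> 4 * K' * exp (r * t)" if "t \<le> T" for t
    proof -
      have "- 2 * sqrt 3 * S t * c t = - 2 * (sqrt 3 * c t * S t)" by simp
      also have "\<dots> \<le> 4 * (K' * exp (r * t))" using abs_cS[of t] S[OF that] by linarith
      finally show ?thesis by (simp only: mult.assoc)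
    qed
  qed (use K' in simp)
  then show False using limit_s diag by simp
qed

text \<open>Because b is nonzero, the limiting rate of sin theta is strictly positive. This decay is
  the input for the borderline cases of P and M.\<close>

lemma s_exp_bound:
  "\<exists>r>0. \<exists>K T. \<forall>t\<le>T. (s t)\<^sup>2 \<le> K * exp (r * t)"
proof -
  have "cos \<psi> * b < 0"
    using limit_rate_s_nonneg limit_S_nonzero cos_limit_cases by (auto simp: less_le)
  then have "(2 * sqrt 3) * (- (cos \<psi> * b)) > 0" by (intro mult_pos_pos) auto
  also have "(2 * sqrt 3) * (- (cos \<psi> * b)) = - 2 * sqrt 3 * b * cos \<psi>" by simp
  finally have pos: "- 2 * sqrt 3 * b * cos \<psi> > 0" .
  define r where "r = (- 2 * sqrt 3 * b * cos \<psi>) / 2"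
  have r: "r > 0" "r < - 2 * sqrt 3 * b * cos \<psi>" using pos unfolding r_def by linarith+
  from growth_rate_exp_bound[OF ds s_pos limit_rates(3) r(2)] obtain K T where
    K: "\<And>t. t \<le> T \<Longrightarrow> s t \<le> K * exp (r * t)" by blast
  have "(s t)\<^sup>2 \<le> K\<^sup>2 * exp (2 * r * t)" if "t \<le> T" for t
  proof -
    have "(s t)\<^sup>2 \<le> (K * exp (r * t))\<^sup>2" using K[OF that] s_pos[of t] by (intro power_mono) auto
    then show ?thesis by (simp add: power_mult_distrib exp_double[symmetric] mult.assoc)
  qed
  then show ?thesis using r by (intro exI[of _ "2 * r"]) auto
qed

text \<open>The price, of order s^2, for replacing cos theta by its limit in a growth rate.\<close>

lemma cos_defect:
  assumes "1 - cos \<psi> * c t \<le> (s t)\<^sup>2"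
  shows "sqrt 3 * (c t - cos \<psi>) * S t \<le> 2 * (s t)\<^sup>2"
proof -
  have "cos \<psi> * c t \<le> 1" using cos_limit_cases c_le[of t] by auto
  moreover have "\<bar>c t - cos \<psi>\<bar> = 1 - cos \<psi> * c t" using cos_limit_cases c_le[of t] by auto
  ultimately have le: "cos \<psi> * c t \<le> 1"
    and "\<bar>sqrt 3 * (c t - cos \<psi>) * S t\<bar> = sqrt 3 * (1 - cos \<psi> * c t) * \<bar>S t\<bar>"
    by (simp_all add: abs_mult)
  note this(2)
  also have "\<dots> \<le> 2 * (s t)\<^sup>2 * 1"
    using assms le sqrt3 bounds(8)[of t] by (intro mult_mono) auto
  finally show ?thesis by simp
qed

lemma limit_rate_P_pos: "- 3 * a + sqrt 3 * cos \<psi> * b > 0"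
proof (rule ccontr)
  assume "\<not> - 3 * a + sqrt 3 * cos \<psi> * b > 0"
  then have zero: "- 3 * a + sqrt 3 * cos \<psi> * b = 0" using limit_rate_P_nonneg diag by simp
  obtain r K T1 where r: "r > 0" and sK: "\<And>t. t \<le> T1 \<Longrightarrow> (s t)\<^sup>2 \<le> K * exp (r * t)"
    using s_exp_bound by auto
  obtain T2 where T2: "\<And>t. t \<le> T2 \<Longrightarrow> cos \<psi> * c t \<ge> 0" "\<And>t. t \<le> T2 \<Longrightarrow> 1 - cos \<psi> * c t \<le> (s t)\<^sup>2"
    using eventually_near_axis by auto
  define y where "y t = - 3 * A t + sqrt 3 * cos \<psi> * S t" for t
  define y' where "y' t = - 3 * (- k t * A t - 2 * (M t)\<^sup>2 + 3 * (P t)\<^sup>2)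
    + sqrt 3 * cos \<psi> * (- k t * S t - sqrt 3 * c t * (2 * (M t)\<^sup>2 + (P t)\<^sup>2 - 2/3 * (s t)\<^sup>2 * (A t)\<^sup>2))" for t
  show False
  proof (rule slow_rate_not_tendsto_zero[OF dP P_pos P_limit, of y y' r "min T1 T2" K 8])
    show "(y has_real_derivative y' t) (at t)" for t
      unfolding y_def[abs_def] y'_def by (intro DERIV_add DERIV_cmult dA dS)
    have "(y \<longlongrightarrow> - 3 * a + sqrt 3 * cos \<psi> * b) at_bot"
      unfolding y_def[abs_def] by (intro tendsto_intros limA limS)
    then show "(y \<longlongrightarrow> 0) at_bot" using zero by simp
    show "y' t \<le> - k t * y t + 8 * (s t)\<^sup>2" if "t \<le> min T1 T2" for t
    proof -
      define e where "e = cos \<psi> * c t"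
      have e: "0 \<le> e" "e \<le> 1" "1 - e \<le> (s t)\<^sup>2"
        using T2[of t] that cos_limit_cases c_le[of t] by (auto simp: e_def)
      have q: "sqrt 3 * cos \<psi> * (sqrt 3 * c t * x) = 3 * (e * x)" for x
      proof -
        have "sqrt 3 * cos \<psi> * (sqrt 3 * c t * x) = (sqrt 3 * sqrt 3) * (e * x)"
          unfolding e_def by (simp only: mult_ac)
        then show ?thesis by simp
      qed
      have "y' t = - k t * y t + 6 * ((1 - e) * (M t)\<^sup>2) - 9 * (P t)\<^sup>2 - 3 * (e * (P t)\<^sup>2)
          + 2 * (e * (s t)\<^sup>2 * (A t)\<^sup>2)"
        unfolding y'_def right_diff_distrib[of "sqrt 3 * cos \<psi>"] q y_def by (simp add: algebra_simps)
      moreover have "(1 - e) * (M t)\<^sup>2 \<le> (s t)\<^sup>2 * 1" using e bounds(1)[of t] by (intro mult_mono) auto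
      moreover have "e * (s t)\<^sup>2 * (A t)\<^sup>2 \<le> (1 * (s t)\<^sup>2) * 1"
        using e bounds(3)[of t] by (intro mult_mono) auto
      moreover have "0 \<le> e * (P t)\<^sup>2" using e by simp
      ultimately show ?thesis using zero_le_power2[of "P t"] by linarith
    qed
    show "rate_P t \<le> y t + 8 * (s t)\<^sup>2" if "t \<le> min T1 T2" for t
    proof -
      have "rate_P t = y t - k t - (s t)\<^sup>2 * A t + sqrt 3 * (c t - cos \<psi>) * S t"
        by (simp add: y_def algebra_simps)
      moreover have "\<bar>(s t)\<^sup>2 * A t\<bar> \<le> (s t)\<^sup>2"
        using bounds(7)[of t] by (simp add: abs_mult mult_left_le)
      ultimately show ?thesis
        using cos_defect[OF T2(2), of t] that k_bounds(3)[of t] by (simp add: abs_le_iff)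
    qed
  qed (use r sK in auto)
qed

text \<open>For M the roles change: P^2 has the factor 6 (1 - e), and the constant 2 in
  \<open>z\<close> produces 2 k, which cancels 4 M^2 up to 4/3 s^2 M^2. The constant 12 covers 6 + 4
  + 4/3.\<close>

lemma limit_rate_M_pos: "2 + 2 * a + 2 * sqrt 3 * cos \<psi> * b > 0"
proof (rule ccontr)
  assume "\<not> 2 + 2 * a + 2 * sqrt 3 * cos \<psi> * b > 0"
  then have zero: "2 + 2 * a + 2 * sqrt 3 * cos \<psi> * b = 0"
    using growth_rate_nonneg[OF dM M_pos limit_rates(1) M_limit] by simp
  obtain r K T1 where r: "r > 0" and sK: "\<And>t. t \<le> T1 \<Longrightarrow> (s t)\<^sup>2 \<le> K * exp (r * t)"
    using s_exp_bound by auto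
  obtain T2 where T2: "\<And>t. t \<le> T2 \<Longrightarrow> cos \<psi> * c t \<ge> 0" "\<And>t. t \<le> T2 \<Longrightarrow> 1 - cos \<psi> * c t \<le> (s t)\<^sup>2"
    using eventually_near_axis by auto
  define z where "z t = 2 + 2 * A t + 2 * sqrt 3 * cos \<psi> * S t" for t
  define z' where "z' t = 2 * (- k t * A t - 2 * (M t)\<^sup>2 + 3 * (P t)\<^sup>2)
    + 2 * sqrt 3 * cos \<psi> * (- k t * S t - sqrt 3 * c t * (2 * (M t)\<^sup>2 + (P t)\<^sup>2 - 2/3 * (s t)\<^sup>2 * (A t)\<^sup>2))" for t
  show False
  proof (rule slow_rate_not_tendsto_zero[OF dM M_pos M_limit, of z z' r "min T1 T2" K 12])
    show "(z has_real_derivative z' t) (at t)" for t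
      unfolding z_def[abs_def] z'_def
      by (rule DERIV_cong[OF DERIV_add[OF DERIV_add[OF DERIV_const DERIV_cmult[OF dA]] DERIV_cmult[OF dS]]])
         (simp only: add_0)
    have "(z \<longlongrightarrow> 2 + 2 * a + 2 * sqrt 3 * cos \<psi> * b) at_bot"
      unfolding z_def[abs_def] by (intro tendsto_intros limA limS)
    then show "(z \<longlongrightarrow> 0) at_bot" using zero by simp
    show "z' t \<le> - k t * z t + 12 * (s t)\<^sup>2" if "t \<le> min T1 T2" for t
    proof -
      define e where "e = cos \<psi> * c t"
      have e: "0 \<le> e" "e \<le> 1" "1 - e \<le> (s t)\<^sup>2"
        using T2[of t] that cos_limit_cases c_le[of t] by (auto simp: e_def)
      have k2: "2 * k t = 4 * (M t)\<^sup>2 + 4/3 * ((s t)\<^sup>2 * (M t)\<^sup>2)" by (simp add: k_def field_simps)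
      have q: "2 * sqrt 3 * cos \<psi> * (sqrt 3 * c t * x) = 6 * (e * x)" for x
      proof -
        have "2 * sqrt 3 * cos \<psi> * (sqrt 3 * c t * x) = 2 * (sqrt 3 * sqrt 3) * (e * x)"
          unfolding e_def by (simp only: mult_ac)
        then show ?thesis by simp
      qed
      have "z' t = - k t * z t + 2 * k t - 4 * (M t)\<^sup>2 - 12 * (e * (M t)\<^sup>2) + 6 * ((1 - e) * (P t)\<^sup>2)
          + 4 * (e * (s t)\<^sup>2 * (A t)\<^sup>2)"
        unfolding z'_def right_diff_distrib[of "2 * sqrt 3 * cos \<psi>"] q z_def by (simp add: algebra_simps)
      moreover have "(1 - e) * (P t)\<^sup>2 \<le> (s t)\<^sup>2 * 1" using e bounds(2)[of t] by (intro mult_mono) auto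
      moreover have "e * (s t)\<^sup>2 * (A t)\<^sup>2 \<le> (1 * (s t)\<^sup>2) * 1"
        using e bounds(3)[of t] by (intro mult_mono) auto
      moreover have "(s t)\<^sup>2 * (M t)\<^sup>2 \<le> (s t)\<^sup>2 * 1" using bounds(1)[of t] by (intro mult_left_mono) auto
      moreover have "0 \<le> e * (M t)\<^sup>2" using e by simp
      ultimately show ?thesis using k2 zero_le_power2[of "s t"] by linarith
    qed
    show "rate_M t \<le> z t + 12 * (s t)\<^sup>2" if "t \<le> min T1 T2" for t
    proof -
      have "rate_M t = z t - k t + 2 * (sqrt 3 * (c t - cos \<psi>) * S t)"
        by (simp add: z_def algebra_simps)
      then show ?thesis
        using cos_defect[OF T2(2), of t] that k_bounds(3)[of t] zero_le_power2[of "s t"] by linarith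
    qed
  qed (use r sK in auto)
qed

theorem limit_in_Delta: "(0, 0, \<psi>, a, b) \<in> Delta_minus_123 \<union> Delta_plus_132"
proof -
  have b0: "cos \<psi> * b < 0"
    using limit_rate_s_nonneg limit_S_nonzero cos_limit_cases by (auto simp: less_le)
  have inv: "1 / sqrt 3 = sqrt 3 / 3" by (simp add: field_simps)
  from diag limit_angle_bounds have "\<psi> = 0 \<or> \<psi> = pi"
    using sin_gt_zero[of \<psi>] by fastforce
  then show ?thesis
  proof
    assume \<psi>: "\<psi> = 0"
    then have "b < 0" using b0 by simp
    then have "sqrt 3 * b < 0" by (simp add: mult_pos_neg)
    then show ?thesis
      using limit_rate_P_pos limit_rate_M_pos \<psi> by (simp add: Delta_plus_132_def inv)
  next
    assume \<psi>: "\<psi> = pi"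
    then have "b > 0" using b0 by simp
    then have "sqrt 3 * b > 0" by simp
    then show ?thesis
      using limit_rate_P_pos limit_rate_M_pos \<psi> by (simp add: Delta_minus_123_def inv)
  qed
qed

end

end

end

section \<open>Transversality at the equilibria with theta = pi/2\<close>

text \<open>At the equilibrium with theta = pi/2 the linearization in (theta, Sigma-minus)
  has eigenvalues 2a and -2a with eigencoordinates s + r h and s - r h,
  where r = -a / sqrt 3; all remaining eigenvalues are nonnegative. The quadratic form of
  the following map is (s + r h)^2 - (s - r h)^2 - m^2 - p^2 - \<alpha>^2, which singles out the
  only direction that expands backwards in time.\<close>

definition cone_map :: "real \<Rightarrow> state \<Rightarrow> state" where
  "cone_map r = (\<lambda>(m, p, h, \<alpha>, s). (- m, - p, 2 * r * s, - \<alpha>, 2 * r * h))"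

lemma inner_state:
  "inner (m, p, h, \<alpha>, s) (m', p', h', \<alpha>', s') = m * m' + p * p' + h * h' + \<alpha> * \<alpha>' + s * (s' :: real)"
  by (simp add: inner_prod_def)

lemma cone_map_scaleR: "cone_map r (c *\<^sub>R d) = c *\<^sub>R cone_map r d"
  by (cases d) (simp add: cone_map_def)

lemma cone_map_symmetric: "inner (cone_map r x) y = inner (cone_map r y) x"
  by (cases x; cases y) (simp add: cone_map_def inner_state)

lemma continuous_on_cone_map [continuous_intros]:
  fixes f :: "'a::t2_space \<Rightarrow> state"
  assumes "continuous_on X f"
  shows "continuous_on X (\<lambda>x. cone_map r (f x))"
  unfolding cone_map_def split_beta by (auto intro!: continuous_intros assms)

lemma cone_map_derivative:
  assumes "(u has_vector_derivative w) (at t)"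
  shows "((\<lambda>t. inner (cone_map r (u t)) (u t)) has_real_derivative 2 * inner (cone_map r (u t)) w) (at t)"
proof -
  have "bounded_linear (cone_map r)"
    unfolding linear_conv_bounded_linear[symmetric]
    by (intro linearI) (auto simp: cone_map_def algebra_simps)
  from bounded_linear.has_vector_derivative[OF this assms]
  have "((\<lambda>t. cone_map r (u t)) has_vector_derivative cone_map r w) (at t)" .
  from bounded_bilinear.has_vector_derivative[OF bounded_bilinear_inner this assms]
  show ?thesis
    by (simp add: has_real_derivative_iff_has_vector_derivative cone_map_symmetric[of r w])
qed

text \<open>Put a = - sqrt 3 r. The positive direction of the form has eigenvalue 2a < a and the
  negative ones have eigenvalues >= 0 > a, so subtracting a from the linearization leaves a negative
  definite form.\<close>

lemma cone_contraction_at_equilibrium: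
  assumes r: "r > 0" "sqrt 3 * r < 1" and d: "d \<noteq> 0"
  shows "inner (cone_map r d) (dvfield (0, 0, pi / 2, - (sqrt 3 * r), 0) d)
    < - (sqrt 3 * r) * inner (cone_map r d) d"
proof -
  obtain m p h \<alpha> s where e: "d = (m, p, h, \<alpha>, s)" by (metis surj_pair)
  define q where "q = sqrt 3"
  have q: "q * q = 3" "q > 0" "q * r < 1" using r by (auto simp: q_def)
  have dv: "dvfield (0, 0, pi / 2, - (sqrt 3 * r), 0) d =
    ((2 - 2 * (q * r)) * m, 4 * (q * r) * p, - 2 * q * s, 0, - 2 * (q * r) * r * h)"
  proof -
    have "sqrt 3 * (2 / 3 * (sqrt 3 * r)\<^sup>2) = 2 * (sqrt 3 * r) * r"
      by (simp add: power_mult_distrib power2_eq_square)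
    then show ?thesis by (simp add: e dvfield_def Let_def q_def algebra_simps)
  qed
  \<comment> \<open>The coefficients are the distances of the eigenvalues from a; the last bracket,
    doubled, is (s + r h)^2 + 3 (s - r h)^2.\<close>
  define Q where "Q = (2 - q * r) * m\<^sup>2 + 5 * (q * r) * p\<^sup>2 + q * r * \<alpha>\<^sup>2
    + 2 * (q * r) * (s\<^sup>2 + (r * h)\<^sup>2 + (s - r * h)\<^sup>2)"
  have id: "- (sqrt 3 * r) * inner (cone_map r d) d
      - inner (cone_map r d) (dvfield (0, 0, pi / 2, - (sqrt 3 * r), 0) d) = Q + 0"
    unfolding dv unfolding e Q_def q_def[symmetric]
    by (simp add: cone_map_def inner_state power2_eq_square algebra_simps)
  have qr: "q * r > 0" using q r by simp
  have nn: "0 \<le> (2 - q * r) * m\<^sup>2" "0 \<le> 5 * (q * r) * p\<^sup>2" "0 \<le> q * r * \<alpha>\<^sup>2"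
    "0 \<le> 2 * (q * r) * (s\<^sup>2 + (r * h)\<^sup>2 + (s - r * h)\<^sup>2)"
    using q qr r by (auto intro!: mult_nonneg_nonneg add_nonneg_nonneg)
  have "Q > 0"
  proof (rule ccontr)
    assume "\<not> Q > 0"
    then have "(2 - q * r) * m\<^sup>2 = 0" "5 * (q * r) * p\<^sup>2 = 0" "q * r * \<alpha>\<^sup>2 = 0"
      "2 * (q * r) * (s\<^sup>2 + (r * h)\<^sup>2 + (s - r * h)\<^sup>2) = 0"
      using nn unfolding Q_def by linarith+
    moreover have "s\<^sup>2 + (r * h)\<^sup>2 + (s - r * h)\<^sup>2 = 0 \<longleftrightarrow> s = 0 \<and> r * h = 0 \<and> s - r * h = 0"
      by (simp add: add_nonneg_eq_0_iff)
    ultimately have "d = 0" using q qr r by (auto simp: e zero_prod_def)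
    then show False using d by simp
  qed
  then show ?thesis using id by linarith
qed

text \<open>The strict inequality holds on the compact unit sphere, so by the tube lemma it persists
  for all nearby base points at once; both sides are quadratic in \<open>d\<close>, which extends it
  to all vectors.\<close>

lemma cone_contraction_near_equilibrium:
  assumes r: "r > 0" "sqrt 3 * r < 1"
  shows "\<exists>\<eta>>0. \<forall>z\<in>cball (0, 0, pi / 2, - (sqrt 3 * r), 0) \<eta>. \<forall>d.
    inner (cone_map r d) (dvfield z d) \<le> - (sqrt 3 * r) * inner (cone_map r d) d"
proof -
  define p :: state where "p = (0, 0, pi / 2, - (sqrt 3 * r), 0)"
  define \<Phi> where "\<Phi> w = inner (cone_map r (snd w)) (dvfield (fst w) (snd w))
    - (- (sqrt 3 * r) * inner (cone_map r (snd w)) (snd w))" for w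
  have op: "open {w. \<Phi> w < 0}"
    unfolding \<Phi>_def by (intro open_Collect_less continuous_intros)
  have sub: "{p} \<times> sphere (0 :: state) 1 \<subseteq> {w. \<Phi> w < 0}"
  proof
    fix w assume "w \<in> {p} \<times> sphere (0 :: state) 1"
    then have "fst w = p" "snd w \<noteq> 0" by auto
    then show "w \<in> {w. \<Phi> w < 0}"
      using cone_contraction_at_equilibrium[OF r, of "snd w"] by (simp add: \<Phi>_def p_def)
  qed
  from Elementary_Topology.tube_lemma[OF compact_sphere op sub]
  obtain X where X: "p \<in> X" "open X" "X \<times> sphere 0 1 \<subseteq> {w. \<Phi> w < 0}"
    by blast
  then obtain \<eta> where \<eta>: "\<eta> > 0" "cball p \<eta> \<subseteq> X" by (meson open_contains_cball)
  have "inner (cone_map r d) (dvfield z d) \<le> - (sqrt 3 * r) * inner (cone_map r d) d"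
    if z: "z \<in> cball p \<eta>" for z d
  proof (cases "d = 0")
    case True
    then show ?thesis using cone_map_scaleR[of r 0 d] by simp
  next
    case False
    define n where "n = norm d"
    define e where "e = d /\<^sub>R n"
    have n: "n > 0" "d = n *\<^sub>R e" "norm e = 1" using False by (auto simp: n_def e_def)
    then have "e \<in> sphere 0 1" by (simp only: mem_sphere_0)
    moreover have "z \<in> X" using \<eta>(2) z by blast
    ultimately have "\<Phi> (z, e) < 0" using X(3) by blast
    then have "inner (cone_map r e) (dvfield z e) \<le> - (sqrt 3 * r) * inner (cone_map r e) e"
      by (simp add: \<Phi>_def)
    then have "n * n * inner (cone_map r e) (dvfield z e) \<le> n * n * (- (sqrt 3 * r) * inner (cone_map r e) e)"
      using n(1) by (intro mult_left_mono) auto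
    then show ?thesis unfolding n(2) cone_map_scaleR dvfield_scaleR by (simp add: mult_ac)
  qed
  then show ?thesis using \<eta>(1) unfolding p_def by blast
qed

text \<open>The backward local stable set of the equilibrium: by the cone condition it meets each line
  in the backward expanding direction at most once.\<close>

definition trapped :: "state \<Rightarrow> real \<Rightarrow> state set" where
  "trapped p \<eta> = {x \<in> B_plus_Omega. \<forall>t\<le>0. flow t x \<in> cball p \<eta>}"

text \<open>The form of the difference of the two orbits starts at 4 r^2 \<tau>^2 and grows
  exponentially backwards, whereas both orbits stay in a bounded ball. Convexity of the ball keeps
  the mean value points where the cone condition holds.\<close>

lemma trapped_transversal:
  assumes r: "r > 0"
    and cone: "\<And>z d. z \<in> cball p \<eta> \<Longrightarrow>
      inner (cone_map r d) (dvfield z d) \<le> - (sqrt 3 * r) * inner (cone_map r d) d"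
    and x: "x \<in> trapped p \<eta>" and y: "x + \<tau> *\<^sub>R (0, 0, 1, 0, r) \<in> trapped p \<eta>"
  shows "\<tau> = 0"
proof (rule ccontr)
  assume \<tau>: "\<tau> \<noteq> 0"
  define y' where "y' = x + \<tau> *\<^sub>R (0, 0, 1, 0, r)"
  define \<delta> where "\<delta> t = flow t y' - flow t x" for t
  define V where "V t = inner (cone_map r (\<delta> t)) (\<delta> t)" for t
  define c where "c = 2 * (sqrt 3 * r)"
  have c: "c > 0" using r by (simp add: c_def)
  have xB: "x \<in> B_plus_Omega" "y' \<in> B_plus_Omega" using x y by (auto simp: trapped_def y'_def)
  have ball: "flow t x \<in> cball p \<eta>" "flow t y' \<in> cball p \<eta>" if "t \<le> 0" for t
    using x y that by (auto simp: trapped_def y'_def)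
  have V0: "V 0 = 4 * r\<^sup>2 * \<tau>\<^sup>2"
    using flow_0[OF xB(1)] flow_0[OF xB(2)]
    by (simp add: V_def \<delta>_def y'_def cone_map_def inner_state power2_eq_square)
  have dV: "(V has_real_derivative 2 * inner (cone_map r (\<delta> t)) (vfield (flow t y') - vfield (flow t x))) (at t)" for t
    unfolding V_def[abs_def]
    by (rule cone_map_derivative) (auto simp: \<delta>_def[abs_def] intro!: derivative_intros flow_has_vector_derivative xB)
  have V': "2 * inner (cone_map r (\<delta> t)) (vfield (flow t y') - vfield (flow t x)) \<le> - c * V t" if "t \<le> 0" for t
  proof -
    obtain \<xi> where \<xi>: "0 < \<xi>" "\<xi> < 1"
      "inner (cone_map r (\<delta> t)) (vfield (flow t y') - vfield (flow t x))
        = inner (cone_map r (\<delta> t)) (dvfield (flow t x + \<xi> *\<^sub>R (flow t y' - flow t x)) (flow t y' - flow t x))"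
      by (rule vfield_mvt)
    have "flow t x + \<xi> *\<^sub>R (flow t y' - flow t x) = (1 - \<xi>) *\<^sub>R flow t x + \<xi> *\<^sub>R flow t y'"
      by (simp add: algebra_simps)
    also have "\<dots> \<in> cball p \<eta>" using convex_cball[of p \<eta>] ball[OF that] \<xi> by (intro convexD) auto
    finally have "flow t x + \<xi> *\<^sub>R (flow t y' - flow t x) \<in> cball p \<eta>" .
    from cone[OF this, of "\<delta> t"]
    have "inner (cone_map r (\<delta> t)) (vfield (flow t y') - vfield (flow t x)) \<le> - (sqrt 3 * r) * V t"
      unfolding \<xi>(3) V_def by (simp only: \<delta>_def)
    moreover have "- c * V t = 2 * (- (sqrt 3 * r) * V t)" by (simp add: c_def)
    ultimately show ?thesis by linarith
  qed
  have growth: "V 0 * exp (- (c * t)) \<le> V t" if "t \<le> 0" for t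
  proof -
    have "- (V t * exp (c * t)) \<le> - (V 0 * exp (c * 0))"
    proof (rule deriv_nonneg_mono_on_le[OF _ _ that order_refl])
      show "((\<lambda>t. - (V t * exp (c * t))) has_real_derivative
        - ((2 * inner (cone_map r (\<delta> t)) (vfield (flow t y') - vfield (flow t x)) + c * V t) * exp (c * t))) (at t)" for t
        by (rule derivative_eq_intros dV refl)+ (simp add: algebra_simps)
      show "- ((2 * inner (cone_map r (\<delta> t)) (vfield (flow t y') - vfield (flow t x)) + c * V t) * exp (c * t)) \<ge> 0"
        if "t \<le> 0" for t
        using V'[OF that] by (simp add: mult_nonpos_nonneg)
    qed
    then show ?thesis by (simp add: exp_minus field_simps)
  qed
  have "bounded ((\<lambda>d. inner (cone_map r d) d) ` cball 0 (2 * \<eta>))"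
    by (intro compact_imp_bounded compact_continuous_image continuous_intros compact_cball)
  then obtain C where C: "\<forall>d\<in>cball 0 (2 * \<eta>). \<bar>inner (cone_map r d) d\<bar> \<le> C"
    unfolding bounded_iff ball_simps real_norm_def by blast
  have bd: "V t \<le> C" if "t \<le> 0" for t
  proof -
    have "norm (\<delta> t) \<le> 2 * \<eta>"
      using ball[OF that] norm_triangle_ineq4[of "flow t y' - p" "flow t x - p"]
      by (simp add: \<delta>_def dist_norm norm_minus_commute)
    then have "\<delta> t \<in> cball 0 (2 * \<eta>)" by (simp only: mem_cball_0)
    with C have "\<bar>inner (cone_map r (\<delta> t)) (\<delta> t)\<bar> \<le> C" by blast
    then show ?thesis by (simp add: V_def)
  qed
  have V0pos: "V 0 > 0" using r \<tau> by (simp add: V0)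
  \<comment> \<open>Early enough that already the linear lower bound V 0 (1 - c t) = V 0 + C exceeds
    C.\<close>
  define t where "t = - (C / V 0) / c"
  have "C > 0" using bd[of 0] V0pos by simp
  then have t: "t \<le> 0" using c V0pos by (simp add: t_def)
  have "V 0 * (1 + - (c * t)) \<le> V 0 * exp (- (c * t))"
    using V0pos exp_ge_add_one_self[of "- (c * t)"] by (intro mult_left_mono) auto
  also have "\<dots> \<le> C" using growth[OF t] bd[OF t] by linarith
  also have "C = V 0 * - (c * t)" using V0pos c by (simp add: t_def)
  finally show False using V0pos by (simp add: algebra_simps)
qed

section \<open>Measure zero and empty interior of the trapped sets\<close>

lemma negligible_if_disjoint_translates:
  fixes S :: "'a::euclidean_space set"
  assumes S: "S \<in> sets lebesgue" "bounded S"
    and tr: "\<And>x \<tau>. x \<in> S \<Longrightarrow> x + \<tau> *\<^sub>R e \<in> S \<Longrightarrow> \<tau> = 0"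
  shows "negligible S"
proof -
  have Sm: "S \<in> lmeasurable" using S by (metis bounded_set_imp_lmeasurable)
  \<comment> \<open>The shifts 1 / (n + 1) are pairwise different and at most 1, so the union of the
    translates is bounded; its finite measure is a series of equal terms, which must be 0.\<close>
  define T where "T n = (+) (inverse (real (Suc n)) *\<^sub>R e) ` S" for n
  have "(\<lambda>n. measure lebesgue (T n)) sums measure lebesgue (\<Union>n. T n)"
  proof (rule measure_countable_negligible_Union_bounded)
    show "T n \<in> lmeasurable" for n unfolding T_def using Sm by (rule measurable_translation)
    have "T m \<inter> T n = {}" if "m \<noteq> n" for m n
    proof (rule ccontr)
      assume "T m \<inter> T n \<noteq> {}"
      then obtain x y where xy: "x \<in> S" "y \<in> S"
        "inverse (real (Suc m)) *\<^sub>R e + x = inverse (real (Suc n)) *\<^sub>R e + y"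
        by (auto simp: T_def)
      then have "y = x + (inverse (real (Suc m)) - inverse (real (Suc n))) *\<^sub>R e"
        by (simp add: algebra_simps)
      then have "inverse (real (Suc m)) - inverse (real (Suc n)) = 0" using tr xy by blast
      then show False using that by simp
    qed
    then show "pairwise (\<lambda>m n. negligible (T m \<inter> T n)) UNIV" by (simp add: pairwise_def)
    obtain B where B: "\<And>x. x \<in> S \<Longrightarrow> norm x \<le> B" using S(2) by (auto simp: bounded_iff)
    have "norm z \<le> norm e + B" if z: "z \<in> T n" for z n
    proof -
      obtain x where x: "x \<in> S" "z = inverse (real (Suc n)) *\<^sub>R e + x" using z unfolding T_def by blast
      have "norm z \<le> inverse (real (Suc n)) * norm e + norm x"
        unfolding x(2) using norm_triangle_ineq by (metis abs_of_nonneg inverse_nonnegative_iff_nonnegative norm_scaleR of_nat_0_le_iff)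
      also have "\<dots> \<le> 1 * norm e + B"
        using B[OF x(1)] by (intro add_mono mult_right_mono) (auto simp: inverse_le_1_iff)
      finally show ?thesis by simp
    qed
    then show "bounded (\<Union>n. T n)" by (auto simp: bounded_iff)
  qed
  then have "(\<lambda>n::nat. measure lebesgue S) sums measure lebesgue (\<Union>n. T n)"
    by (simp add: T_def measure_translation)
  then have "measure lebesgue S = 0"
    using sums_summable summable_const_iff by blast
  then show ?thesis using Sm negligible_iff_measure by blast
qed

lemma continuous_on_Omega: "continuous_on X Omega"
  unfolding Omega_def split_beta by (auto intro!: continuous_intros)

lemma B_plus_Omega_lebesgue: "B_plus_Omega \<in> sets lebesgue"
proof -
  have eq: "B_plus_Omega = {z. 0 < fst z} \<inter> {z. 0 \<le> fst (snd z)} \<inter> {z. 0 < fst (snd (snd z))}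
      \<inter> {z. fst (snd (snd z)) < pi} \<inter> {z. 0 < Omega z}"
    by (auto simp: B_plus_Omega_iff)
  have "B_plus_Omega \<in> sets borel"
    unfolding eq by (intro sets.Int borel_open borel_closed open_Collect_less closed_Collect_le
        continuous_intros continuous_on_Omega)
  then show ?thesis by simp
qed

text \<open>The intersection runs over uncountably many times, so closedness of each condition is
  used, by continuity of the time maps. It yields both measurability and the relatively open
  complements.\<close>

lemma closedin_trapped: "closedin (top_of_set B_plus_Omega) (trapped p \<eta>)"
proof -
  have "closedin (top_of_set B_plus_Omega) {x \<in> B_plus_Omega. flow t x \<in> cball p \<eta>}" for t
  proof -
    have "{x \<in> B_plus_Omega. flow t x \<in> cball p \<eta>} = B_plus_Omega \<inter> flow t -` cball p \<eta>" by blast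
    then show ?thesis
      using continuous_closedin_preimage[OF continuous_on_flow closed_cball, of t p \<eta>] by simp
  qed
  then have "closedin (top_of_set B_plus_Omega) (\<Inter>t\<in>{..0}. {x \<in> B_plus_Omega. flow t x \<in> cball p \<eta>})"
    by (intro closedin_Inter) auto
  moreover have "(\<Inter>t\<in>{..0}. {x \<in> B_plus_Omega. flow t x \<in> cball p \<eta>}) = trapped p \<eta>"
    by (auto simp: trapped_def)
  ultimately show ?thesis by simp
qed

lemma negligible_trapped:
  assumes "\<And>x \<tau>. x \<in> trapped p \<eta> \<Longrightarrow> x + \<tau> *\<^sub>R e \<in> trapped p \<eta> \<Longrightarrow> \<tau> = 0"
  shows "negligible (trapped p \<eta>)"
proof (rule negligible_if_disjoint_translates[OF _ _ assms])
  obtain T where "closed T" "trapped p \<eta> = B_plus_Omega \<inter> T"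
    using closedin_trapped unfolding closedin_closed by blast
  then show "trapped p \<eta> \<in> sets lebesgue"
    using B_plus_Omega_lebesgue by (auto intro!: sets.Int)
  show "bounded (trapped p \<eta>)"
    by (rule bounded_subset[OF bounded_cball[of 0 8]])
       (use B_plus_Omega_subset_cball in \<open>auto simp: trapped_def\<close>)
qed

text \<open>All defining conditions of the phase space are open except P >= 0, which a direction
  with nonnegative P-component preserves.\<close>

lemma B_plus_Omega_translate:
  assumes x: "x \<in> B_plus_Omega" and e: "fst (snd e) \<ge> 0" and T: "open T" "x \<in> T"
  obtains \<tau> where "\<tau> > 0" "x + \<tau> *\<^sub>R e \<in> B_plus_Omega" "x + \<tau> *\<^sub>R e \<in> T"
proof -
  define G where "G = T \<inter> {z. 0 < fst z} \<inter> {z. 0 < fst (snd (snd z))}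
      \<inter> {z. fst (snd (snd z)) < pi} \<inter> {z. 0 < Omega z}"
  have "open G" unfolding G_def
    by (intro open_Int T open_Collect_less continuous_intros continuous_on_Omega)
  then have "open ((\<lambda>\<tau>::real. x + \<tau> *\<^sub>R e) -` G)"
    by (rule open_vimage) (intro continuous_intros)
  moreover have "x \<in> G" using x T by (cases x) (auto simp: G_def B_plus_Omega_iff)
  then have "0 \<in> (\<lambda>\<tau>::real. x + \<tau> *\<^sub>R e) -` G" by simp
  ultimately obtain d where d: "d > 0" "ball 0 d \<subseteq> (\<lambda>\<tau>::real. x + \<tau> *\<^sub>R e) -` G"
    by (meson open_contains_ball)
  have "d / 2 \<in> ball 0 d" using d(1) by simp
  with d(2) have G: "x + (d / 2) *\<^sub>R e \<in> G" by blast
  have "0 \<le> fst (snd (x + (d / 2) *\<^sub>R e))" using x e d(1) by (cases x) (auto simp: B_plus_Omega_iff)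
  with G have "x + (d / 2) *\<^sub>R e \<in> B_plus_Omega"
    by (cases "x + (d / 2) *\<^sub>R e") (auto simp: G_def B_plus_Omega_iff)
  then show ?thesis using that[of "d / 2"] d(1) G by (simp add: G_def)
qed

text \<open>Orbits inside the ball at all times up to -n; the union over n catches every orbit that
  converges to an interior point of the ball.\<close>

definition trapped_before :: "nat \<Rightarrow> state \<Rightarrow> real \<Rightarrow> state set" where
  "trapped_before n p \<eta> = {x \<in> B_plus_Omega. flow (- real n) x \<in> trapped p \<eta>}"

text \<open>The time-n map is Lipschitz on the phase space, so it maps null sets to null
  sets.\<close>

lemma negligible_trapped_before:
  assumes "negligible (trapped p \<eta>)"
  shows "negligible (trapped_before n p \<eta>)"
proof -
  have "negligible (flow (real n) ` trapped p \<eta>)"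
  proof (rule negligible_locally_Lipschitz_image[OF order_refl assms])
    fix x assume "x \<in> trapped p \<eta>"
    then have "norm (flow (real n) y - flow (real n) x) \<le> exp (lipschitz_rate * \<bar>real n\<bar>) * norm (y - x)"
      if "y \<in> trapped p \<eta> \<inter> UNIV" for y
      using that by (intro flow_lipschitz) (simp_all add: trapped_def)
    then show "\<exists>T B. open T \<and> x \<in> T \<and> (\<forall>y\<in>trapped p \<eta> \<inter> T.
        norm (flow (real n) y - flow (real n) x) \<le> B * norm (y - x))"
      using open_UNIV UNIV_I by blast
  qed
  moreover have "trapped_before n p \<eta> \<subseteq> flow (real n) ` trapped p \<eta>"
  proof
    fix x assume x: "x \<in> trapped_before n p \<eta>"
    then have "x = flow (real n) (flow (- real n) x)"
      by (simp add: trapped_before_def flow_flow flow_0)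
    then show "x \<in> flow (real n) ` trapped p \<eta>" using x by (auto simp: trapped_before_def)
  qed
  ultimately show ?thesis by (rule negligible_subset)
qed

lemma openin_complement_trapped_before:
  "openin (top_of_set B_plus_Omega) (B_plus_Omega - trapped_before n p \<eta>)"
proof -
  have "closedin (top_of_set B_plus_Omega) (B_plus_Omega \<inter> flow (- real n) -` trapped p \<eta>)"
    by (rule continuous_closedin_preimage_gen[OF continuous_on_flow _ closedin_trapped])
       (auto intro: flow_in_B_plus_Omega)
  moreover have "B_plus_Omega \<inter> flow (- real n) -` trapped p \<eta> = trapped_before n p \<eta>"
    by (auto simp: trapped_before_def)
  ultimately show ?thesis by (simp add: openin_diff)
qed

text \<open>Pull the point back by time n, move it off the trapped set by a small positive step
  along \<open>e\<close>, and push it forward again by the continuous time-n map.\<close>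

lemma dense_complement_trapped_before:
  assumes e: "fst (snd e) \<ge> 0"
    and tr: "\<And>x \<tau>. x \<in> trapped p \<eta> \<Longrightarrow> x + \<tau> *\<^sub>R e \<in> trapped p \<eta> \<Longrightarrow> \<tau> = 0"
  shows "B_plus_Omega \<subseteq> closure (B_plus_Omega - trapped_before n p \<eta>)"
proof
  fix x assume x: "x \<in> B_plus_Omega"
  show "x \<in> closure (B_plus_Omega - trapped_before n p \<eta>)"
  proof (cases "x \<in> trapped_before n p \<eta>")
    case False
    with x have "x \<in> B_plus_Omega - trapped_before n p \<eta>" by blast
    then show ?thesis by (rule subsetD[OF closure_subset])
  next
    case True
    define y where "y = flow (- real n) x"
    have y: "y \<in> trapped p \<eta>" "y \<in> B_plus_Omega" "flow (real n) y = x"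
      using True by (auto simp: y_def trapped_before_def trapped_def flow_flow flow_0)
    show ?thesis
      unfolding closure_iff_nhds_not_empty
    proof (intro allI impI)
      fix G T assume GT: "T \<subseteq> G" "open T" "x \<in> T"
      have "openin (top_of_set B_plus_Omega) (B_plus_Omega \<inter> flow (real n) -` T)"
        by (rule continuous_openin_preimage_gen[OF continuous_on_flow GT(2)])
      then obtain T' where T': "open T'" "B_plus_Omega \<inter> flow (real n) -` T = B_plus_Omega \<inter> T'"
        by (auto simp: openin_open)
      have "y \<in> T'" using y GT T' by auto
      then obtain \<tau> where \<tau>: "\<tau> > 0" "y + \<tau> *\<^sub>R e \<in> B_plus_Omega" "y + \<tau> *\<^sub>R e \<in> T'"
        using B_plus_Omega_translate[OF y(2) e T'(1)] by blast
      define z where "z = flow (real n) (y + \<tau> *\<^sub>R e)"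
      have "z \<in> T" using \<tau> T' by (auto simp: z_def)
      moreover have "y + \<tau> *\<^sub>R e \<notin> trapped p \<eta>" using tr[OF y(1), of \<tau>] \<tau>(1) by auto
      then have "z \<in> B_plus_Omega - trapped_before n p \<eta>"
        using \<tau>(2) by (auto simp: z_def trapped_before_def flow_in_B_plus_Omega flow_flow flow_0)
      ultimately show "(B_plus_Omega - trapped_before n p \<eta>) \<inter> G \<noteq> {}" using GT by blast
    qed
  qed
qed

section \<open>Eigenvalues of the Weingarten map\<close>

lemma tendsto_det:
  fixes A :: "'x \<Rightarrow> real mat"
  assumes A: "\<And>t. A t \<in> carrier_mat n n" and B: "B \<in> carrier_mat n n"
    and lim: "\<And>i j. i < n \<Longrightarrow> j < n \<Longrightarrow> ((\<lambda>t. A t $$ (i, j)) \<longlongrightarrow> B $$ (i, j)) F"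
  shows "((\<lambda>t. Determinant.det (A t)) \<longlongrightarrow> Determinant.det B) F"
proof -
  have "((\<lambda>t. \<Sum>p\<in>{p. p permutes {0..<n}}. signof p * (\<Prod>i = 0..<n. A t $$ (i, p i)))
    \<longlongrightarrow> (\<Sum>p\<in>{p. p permutes {0..<n}}. signof p * (\<Prod>i = 0..<n. B $$ (i, p i)))) F"
  proof (intro tendsto_sum tendsto_mult tendsto_const tendsto_prod lim)
    fix p i assume "p \<in> {p. p permutes {0..<n}}" "i \<in> {0..<n}"
    then show "i < n" "p i < n" using permutes_in_image[of p "{0..<n}" i] by auto
  qed
  then show ?thesis using det_def'[OF A] det_def'[OF B] by simp
qed

lemma tendsto_poly_char_poly:
  fixes A :: "'x \<Rightarrow> real mat"
  assumes A: "\<And>t. A t \<in> carrier_mat n n" and B: "B \<in> carrier_mat n n"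
    and lim: "\<And>i j. i < n \<Longrightarrow> j < n \<Longrightarrow> ((\<lambda>t. A t $$ (i, j)) \<longlongrightarrow> B $$ (i, j)) F"
  shows "((\<lambda>t. poly (char_poly (A t)) x) \<longlongrightarrow> poly (char_poly B) x) F"
proof -
  have carr: "- char_matrix C x \<in> carrier_mat n n" if "C \<in> carrier_mat n n" for C :: "real mat"
    using char_matrix_closed[OF that] by (rule uminus_carrier_mat)
  have idx: "(- char_matrix C x) $$ (i, j) = - (C $$ (i, j) + (if i = j then - x else 0))"
    if "C \<in> carrier_mat n n" "i < n" "j < n" for C :: "real mat" and i j
    using that by (auto simp: char_matrix_def)
  have "((\<lambda>t. Determinant.det (- char_matrix (A t) x)) \<longlongrightarrow> Determinant.det (- char_matrix B x)) F"
  proof (rule tendsto_det[OF carr[OF A] carr[OF B]])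
    fix i j assume ij: "i < n" "j < n"
    have "((\<lambda>t. - (A t $$ (i, j) + (if i = j then - x else 0)))
        \<longlongrightarrow> - (B $$ (i, j) + (if i = j then - x else 0))) F"
      by (intro tendsto_intros lim ij)
    then show "((\<lambda>t. (- char_matrix (A t) x) $$ (i, j)) \<longlongrightarrow> (- char_matrix B x) $$ (i, j)) F"
      by (simp only: idx[OF A ij] idx[OF B ij])
  qed
  then show ?thesis by (simp only: char_poly_matrix[OF A] char_poly_matrix[OF B])
qed

text \<open>Three different roots exhaust the degree, so all are simple and there are no
  others.\<close>

lemma sorted_roots_cubic:
  fixes p :: "real poly"
  assumes deg: "degree p = 3" and r: "r1 < r2" "r2 < r3"
    and root: "poly p r1 = 0" "poly p r2 = 0" "poly p r3 = 0"
  shows "sorted_list_of_multiset (proots p) = [r1, r2, r3]"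
proof -
  have p0: "p \<noteq> 0" using deg by auto
  have sub: "mset [r1, r2, r3] \<subseteq># proots p"
  proof (rule mset_subset_eqI)
    fix a
    have "count (mset [r1, r2, r3]) a \<le> (if a \<in> {r1, r2, r3} then 1 else 0)" using r by auto
    also have "\<dots> \<le> order a p" using root p0 by (auto simp: order_root Suc_le_eq)
    finally show "count (mset [r1, r2, r3]) a \<le> count (proots p) a" using p0 by simp
  qed
  moreover have "size (proots p) \<le> size (mset [r1, r2, r3])" using size_proots_le[of p] deg by simp
  ultimately have "proots p = mset [r1, r2, r3]"
    by (metis mset_subset_size not_less subset_mset.le_imp_less_or_eq)
  then show ?thesis using r by (simp only: sorted_list_of_multiset_mset) simp
qed

text \<open>The limit cubic changes sign strictly across each of its simple roots. Convergence at
  six points therefore traps one root of \<open>p t\<close> near each of them.\<close>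

lemma cubic_roots_converge:
  fixes p :: "'x \<Rightarrow> real poly"
  assumes deg: "\<And>t. degree (p t) = 3" and k: "k1 < k2" "k2 < k3"
    and lim: "\<And>x. ((\<lambda>t. poly (p t) x) \<longlongrightarrow> (x - k1) * (x - k2) * (x - k3)) F"
  shows "((\<lambda>t. sorted_list_of_multiset (proots (p t)) ! 0) \<longlongrightarrow> k1) F"
    "((\<lambda>t. sorted_list_of_multiset (proots (p t)) ! 1) \<longlongrightarrow> k2) F"
    "((\<lambda>t. sorted_list_of_multiset (proots (p t)) ! 2) \<longlongrightarrow> k3) F"
proof -
  have ev: "eventually (\<lambda>t. \<exists>r1 r2 r3. sorted_list_of_multiset (proots (p t)) = [r1, r2, r3]
      \<and> \<bar>r1 - k1\<bar> < e \<and> \<bar>r2 - k2\<bar> < e \<and> \<bar>r3 - k3\<bar> < e) F" if e: "e > 0" for e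
  proof -
    \<comment> \<open>Half the smallest gap at most, so that the three open intervals do not overlap
      and the roots come out in increasing order.\<close>
    define d where "d = min e (min (k2 - k1) (k3 - k2)) / 2"
    have d: "d > 0" "d < e" "2 * d \<le> k2 - k1" "2 * d \<le> k3 - k2" using e k by (auto simp: d_def)
    define g where "g x = (x - k1) * (x - k2) * (x - k3)" for x
    have "g (k1 - d) < 0" unfolding g_def using d k by (intro mult_pos_neg mult_neg_neg) auto
    moreover have "g (k1 + d) > 0" unfolding g_def using d k by (intro mult_neg_neg mult_pos_neg) auto
    moreover have "g (k2 - d) > 0" unfolding g_def using d k by (intro mult_neg_neg mult_pos_neg) auto
    moreover have "g (k2 + d) < 0" unfolding g_def using d k by (intro mult_pos_neg mult_pos_pos) auto
    moreover have "g (k3 - d) < 0" unfolding g_def using d k by (intro mult_pos_neg mult_pos_pos) auto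
    moreover have "g (k3 + d) > 0" unfolding g_def using d k by (intro mult_pos_pos) auto
    ultimately have "eventually (\<lambda>t. poly (p t) (k1 - d) < 0 \<and> poly (p t) (k1 + d) > 0 \<and> poly (p t) (k2 - d) > 0
        \<and> poly (p t) (k2 + d) < 0 \<and> poly (p t) (k3 - d) < 0 \<and> poly (p t) (k3 + d) > 0) F"
      unfolding g_def by (intro eventually_conj order_tendstoD[OF lim])
    then show ?thesis
    proof eventually_elim
      fix t
      assume s: "poly (p t) (k1 - d) < 0 \<and> poly (p t) (k1 + d) > 0 \<and> poly (p t) (k2 - d) > 0
        \<and> poly (p t) (k2 + d) < 0 \<and> poly (p t) (k3 - d) < 0 \<and> poly (p t) (k3 + d) > 0"
      obtain r1 where r1: "k1 - d < r1" "r1 < k1 + d" "poly (p t) r1 = 0"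
        using poly_IVT_pos[of "k1 - d" "k1 + d" "p t"] s d by auto
      obtain r2 where r2: "k2 - d < r2" "r2 < k2 + d" "poly (p t) r2 = 0"
        using poly_IVT_neg[of "k2 - d" "k2 + d" "p t"] s d by auto
      obtain r3 where r3: "k3 - d < r3" "r3 < k3 + d" "poly (p t) r3 = 0"
        using poly_IVT_pos[of "k3 - d" "k3 + d" "p t"] s d by auto
      have "r1 < r2" "r2 < r3" using r1 r2 r3 d by linarith+
      from sorted_roots_cubic[OF deg this r1(3) r2(3) r3(3)]
      have "sorted_list_of_multiset (proots (p t)) = [r1, r2, r3]" .
      moreover have "\<bar>r1 - k1\<bar> < e" "\<bar>r2 - k2\<bar> < e" "\<bar>r3 - k3\<bar> < e" using r1 r2 r3 d by linarith+
      ultimately show "\<exists>r1 r2 r3. sorted_list_of_multiset (proots (p t)) = [r1, r2, r3]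
        \<and> \<bar>r1 - k1\<bar> < e \<and> \<bar>r2 - k2\<bar> < e \<and> \<bar>r3 - k3\<bar> < e" by blast
    qed
  qed
  show "((\<lambda>t. sorted_list_of_multiset (proots (p t)) ! 0) \<longlongrightarrow> k1) F"
  proof (rule tendstoI)
    show "eventually (\<lambda>t. dist (sorted_list_of_multiset (proots (p t)) ! 0) k1 < e) F" if "e > 0" for e
      using ev[OF that] by eventually_elim (auto simp: dist_real_def)
  qed
  show "((\<lambda>t. sorted_list_of_multiset (proots (p t)) ! 1) \<longlongrightarrow> k2) F"
  proof (rule tendstoI)
    show "eventually (\<lambda>t. dist (sorted_list_of_multiset (proots (p t)) ! 1) k2 < e) F" if "e > 0" for e
      using ev[OF that] by eventually_elim (auto simp: dist_real_def)
  qed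
  show "((\<lambda>t. sorted_list_of_multiset (proots (p t)) ! 2) \<longlongrightarrow> k3) F"
  proof (rule tendstoI)
    show "eventually (\<lambda>t. dist (sorted_list_of_multiset (proots (p t)) ! 2) k3 < e) F" if "e > 0" for e
      using ev[OF that] by eventually_elim (auto simp: dist_real_def)
  qed
qed

lemma weingarten_carrier: "weingarten z \<in> carrier_mat 3 3"
  by (cases z) (auto simp: weingarten_def shear_def mat_of_rows_list_def Let_def)

lemma weingarten_index:
  "weingarten (M, P, \<theta>, A, S) $$ (0, 0) = - 2/3 * A + 1/3"
  "weingarten (M, P, \<theta>, A, S) $$ (1, 1) = 1/3 * (A + sqrt 3 * S) + 1/3"
  "weingarten (M, P, \<theta>, A, S) $$ (2, 2) = 1/3 * (A - sqrt 3 * S) + 1/3"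
  "weingarten (M, P, \<theta>, A, S) $$ (0, 1) = 1 / sqrt 3 * P * sin (\<theta> / 2)"
  "weingarten (M, P, \<theta>, A, S) $$ (1, 0) = 1 / sqrt 3 * P * sin (\<theta> / 2)"
  "weingarten (M, P, \<theta>, A, S) $$ (0, 2) = 1 / sqrt 3 * P * cos (\<theta> / 2)"
  "weingarten (M, P, \<theta>, A, S) $$ (2, 0) = 1 / sqrt 3 * P * cos (\<theta> / 2)"
  "weingarten (M, P, \<theta>, A, S) $$ (1, 2) = 1/3 * A * sin \<theta>"
  "weingarten (M, P, \<theta>, A, S) $$ (2, 1) = 1/3 * A * sin \<theta>"
  by (simp_all add: weingarten_def shear_def mat_of_rows_list_def Let_def)

lemma tendsto_weingarten:
  fixes u :: "'x::t2_space \<Rightarrow> state"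
  assumes u: "(u \<longlongrightarrow> y) F" and ij: "i < 3" "j < 3"
  shows "((\<lambda>t. weingarten (u t) $$ (i, j)) \<longlongrightarrow> weingarten y $$ (i, j)) F"
proof -
  have idx: "i = 0 \<or> i = 1 \<or> i = 2" "j = 0 \<or> j = 1 \<or> j = 2" using ij by auto
  have eta: "z = (fst z, fst (snd z), fst (snd (snd z)), fst (snd (snd (snd z))), snd (snd (snd (snd z))))"
    for z :: state by simp
  have "((\<lambda>t. weingarten (fst (u t), fst (snd (u t)), fst (snd (snd (u t))), fst (snd (snd (snd (u t)))),
        snd (snd (snd (snd (u t))))) $$ (i, j))
    \<longlongrightarrow> weingarten (fst y, fst (snd y), fst (snd (snd y)), fst (snd (snd (snd y))),
        snd (snd (snd (snd y)))) $$ (i, j)) F"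
    using idx by (elim disjE; hypsubst; simp only: weingarten_index; auto intro!: tendsto_intros u)
  then show ?thesis by simp
qed

text \<open>At P = 0 and sin theta = 0 all off-diagonal entries vanish. The factors are listed in
  the increasing order of the roots on \<open>Delta_minus_123\<close>.\<close>

lemma char_poly_weingarten_diagonal:
  assumes "sin \<theta> = 0"
  shows "poly (char_poly (weingarten (M, 0, \<theta>, A, S))) x
    = (x - (1/3 * (A - sqrt 3 * S) + 1/3)) * (x - (1/3 * (A + sqrt 3 * S) + 1/3)) * (x - (- 2/3 * A + 1/3))"
proof -
  let ?D = "weingarten (M, 0, \<theta>, A, S)"
  have "upper_triangular ?D"
  proof (rule upper_triangularI)
    fix i j assume "j < i" "i < dim_row ?D"
    then have "i = 1 \<and> j = 0 \<or> i = 2 \<and> j = 0 \<or> i = 2 \<and> j = 1"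
      using weingarten_carrier[of "(M, 0, \<theta>, A, S)"] by auto
    then show "?D $$ (i, j) = 0"
      by (elim disjE conjE; hypsubst; simp only: weingarten_index assms; simp)
  qed
  from char_poly_upper_triangular[OF weingarten_carrier this]
  have "char_poly ?D = (\<Prod>a\<leftarrow>diag_mat ?D. [:- a, 1:])" .
  moreover have "diag_mat ?D = [- 2/3 * A + 1/3, 1/3 * (A + sqrt 3 * S) + 1/3, 1/3 * (A - sqrt 3 * S) + 1/3]"
  proof -
    have "dim_row ?D = 3" using weingarten_carrier[of "(M, 0, \<theta>, A, S)"] by auto
    then have "diag_mat ?D = [?D $$ (0, 0), ?D $$ (1, 1), ?D $$ (2, 2)]"
      by (simp add: diag_mat_def upt_rec numeral_2_eq_2)
    then show ?thesis by (simp only: weingarten_index)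
  qed
  moreover have "poly (\<Prod>a\<leftarrow>[l1, l2, l3]. [:- a, 1:]) x = (x - l3) * (x - l2) * (x - l1)" for l1 l2 l3 :: real
    by (simp add: algebra_simps)
  ultimately show ?thesis by (simp only:)
qed

text \<open>The inequalities defining a limit set are eigenvalue conditions: that of the M-rate is
  k1 > 0, that of the rate of sin theta is k1 < k2, and that of the P-rate is k2 < k3.\<close>

theorem weingarten_eigenvalues_converge:
  fixes u :: "'x::t2_space \<Rightarrow> state"
  assumes u: "(u \<longlongrightarrow> y) F" and y: "y \<in> Delta_minus_123 \<union> Delta_plus_132"
  shows "\<exists>k1 k2 k3 :: real.
      ((\<lambda>\<tau>. eigenvalue_list (weingarten (u \<tau>)) ! 0) \<longlongrightarrow> k1) F
    \<and> ((\<lambda>\<tau>. eigenvalue_list (weingarten (u \<tau>)) ! 1) \<longlongrightarrow> k2) F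
    \<and> ((\<lambda>\<tau>. eigenvalue_list (weingarten (u \<tau>)) ! 2) \<longlongrightarrow> k3) F
    \<and> distinct [k1, k2, k3] \<and> k1 > 0 \<and> k2 > 0 \<and> k3 > 0"
proof -
  have key: ?thesis if "k1 < k2" "k2 < k3" "k1 > 0"
    and "\<And>x. poly (char_poly (weingarten y)) x = (x - k1) * (x - k2) * (x - k3)" for k1 k2 k3
  proof -
    have lim: "((\<lambda>\<tau>. poly (char_poly (weingarten (u \<tau>))) x) \<longlongrightarrow> (x - k1) * (x - k2) * (x - k3)) F" for x
      unfolding that(4)[symmetric]
      by (rule tendsto_poly_char_poly[OF weingarten_carrier weingarten_carrier tendsto_weingarten[OF u]])
    have "degree (char_poly (weingarten z)) = 3" for z
      using degree_monic_char_poly[OF weingarten_carrier] by blast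
    from cubic_roots_converge[OF this that(1,2) lim] that(1-3) show ?thesis
      unfolding eigenvalue_list_def by (intro exI[of _ k1] exI[of _ k2] exI[of _ k3]) auto
  qed
  have inv: "1 / sqrt 3 = sqrt 3 / 3" by (simp add: field_simps)
  from y show ?thesis
  proof
    assume "y \<in> Delta_minus_123"
    then obtain A S where y: "y = (0, 0, pi, A, S)" and
      AS: "A < - (sqrt 3 * S / 3)" "sqrt 3 * S > 0" "A - sqrt 3 * S > -1"
      by (auto simp: Delta_minus_123_def inv)
    show ?thesis
    proof (rule key)
      show "1/3 * (A - sqrt 3 * S) + 1/3 < 1/3 * (A + sqrt 3 * S) + 1/3"
        "1/3 * (A + sqrt 3 * S) + 1/3 < - 2/3 * A + 1/3" "1/3 * (A - sqrt 3 * S) + 1/3 > 0"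
        using AS by argo+
    qed (simp only: y sin_pi char_poly_weingarten_diagonal)
  next
    assume "y \<in> Delta_plus_132"
    then obtain A S where y: "y = (0, 0, 0, A, S)" and
      AS: "A < sqrt 3 * S / 3" "sqrt 3 * S < 0" "A + sqrt 3 * S > -1"
      by (auto simp: Delta_plus_132_def inv)
    show ?thesis
    proof (rule key)
      show "1/3 * (A + sqrt 3 * S) + 1/3 < 1/3 * (A - sqrt 3 * S) + 1/3"
        "1/3 * (A - sqrt 3 * S) + 1/3 < - 2/3 * A + 1/3" "1/3 * (A + sqrt 3 * S) + 1/3 > 0"
        using AS by argo+
    qed (simp only: y sin_zero char_poly_weingarten_diagonal mult_ac)
  qed
qed

section \<open>Generic backward limits\<close>

text \<open>P obeys a linear equation along the orbit, so it vanishes always or never; this makes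
  the complement of \<open>OT_plus_Omega\<close> invariant.\<close>

lemma flow_P:
  assumes x: "x \<in> B_plus_Omega"
  shows "\<exists>K. fst (snd (flow t x)) = fst (snd x) * exp K"
proof -
  define l where "l z = (case z of (M, P, \<theta>, A, S) \<Rightarrow>
    - (2 * (1 + 1/3 * (sin \<theta>)\<^sup>2) * M\<^sup>2) - (3 + (sin \<theta>)\<^sup>2) * A + sqrt 3 * cos \<theta> * S)" for z :: state
  have "((\<lambda>t. fst (snd (flow t x))) has_real_derivative l (flow t x) * fst (snd (flow t x))) (at t)" for t
  proof -
    have "fst (snd (vfield z)) = l z * fst (snd z)" for z
      by (cases z) (simp add: vfield_simps l_def)
    then show ?thesis
      using has_vector_derivative_components(2)[OF flow_has_vector_derivative[OF x]] by simp
  qed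
  moreover have "continuous_on UNIV (\<lambda>t. flow t x)"
    using flow_has_vector_derivative[OF x]
    by (intro continuous_at_imp_continuous_on ballI has_vector_derivative_continuous)
  then have "continuous_on UNIV (\<lambda>t. l (flow t x))"
    unfolding l_def split_beta by (auto intro!: continuous_intros)
  ultimately obtain K where "\<And>t. fst (snd (flow t x)) = fst (snd (flow 0 x)) * exp (K t)"
    using linear_ode_solution[of "\<lambda>t. fst (snd (flow t x))" "\<lambda>t. l (flow t x)"] by metis
  then show ?thesis using flow_0[OF x] by auto
qed

lemma OT_plus_Omega_iff: "x \<in> OT_plus_Omega \<longleftrightarrow> x \<in> B_plus_Omega \<and> fst (snd x) = 0"
  by (cases x) (auto simp: OT_plus_Omega_def)

lemma flow_notin_OT:
  assumes "x \<in> B_plus_Omega - OT_plus_Omega"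
  shows "flow t x \<in> B_plus_Omega - OT_plus_Omega"
proof -
  have x: "x \<in> B_plus_Omega" "fst (snd x) \<noteq> 0" using assms by (auto simp: OT_plus_Omega_iff)
  with flow_P[OF x(1), of t] have "fst (snd (flow t x)) \<noteq> 0" by auto
  then show ?thesis using flow_in_B_plus_Omega[OF x(1)] by (simp add: OT_plus_Omega_iff)
qed

text \<open>The bound a > -1 is recorded because it puts a limit with theta = pi/2 into the
  parameter range of the cone condition.\<close>

lemma flow_limit:
  assumes x: "x \<in> B_plus_Omega - OT_plus_Omega"
  shows "\<exists>\<psi> a b. ((\<lambda>t. flow t x) \<longlongrightarrow> (0, 0, \<psi>, a, b)) at_bot \<and> (a, b) \<noteq> (0, 0) \<and> a > -1
    \<and> (sin \<psi> = 0 \<or> \<psi> = pi / 2 \<and> b = 0 \<and> a < 0)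
    \<and> (sin \<psi> = 0 \<longrightarrow> (0, 0, \<psi>, a, b) \<in> Delta_minus_123 \<union> Delta_plus_132)"
proof -
  define M P \<theta> A S where "M = (\<lambda>t. fst (flow t x))" and "P = (\<lambda>t. fst (snd (flow t x)))"
    and "\<theta> = (\<lambda>t. fst (snd (snd (flow t x))))" and "A = (\<lambda>t. fst (snd (snd (snd (flow t x)))))"
    and "S = (\<lambda>t. snd (snd (snd (snd (flow t x)))))"
  have eq: "flow t x = (M t, P t, \<theta> t, A t, S t)" for t
    by (simp add: M_def P_def \<theta>_def A_def S_def)
  interpret orbit M P \<theta> A S
  proof
    show "((\<lambda>t. (M t, P t, \<theta> t, A t, S t)) has_vector_derivative
      vfield (M t, P t, \<theta> t, A t, S t)) (at t)" for t
      using flow_has_vector_derivative[of x t] x unfolding eq by blast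
    show inB: "(M t, P t, \<theta> t, A t, S t) \<in> B_plus_Omega" for t
      using flow_in_B_plus_Omega[of x t] x unfolding eq by blast
    show "P t > 0" for t
      using flow_notin_OT[OF x, of t] inB[of t] unfolding eq
      by (auto simp: OT_plus_Omega_iff B_plus_Omega_iff less_le)
  qed
  obtain \<psi> a b where lim: "(\<theta> \<longlongrightarrow> \<psi>) at_bot" "(A \<longlongrightarrow> a) at_bot" "(S \<longlongrightarrow> b) at_bot"
    and ab: "(a, b) \<noteq> (0, 0)" by (rule limit_exists)
  show ?thesis
  proof (intro exI conjI impI)
    show "((\<lambda>t. flow t x) \<longlongrightarrow> (0, 0, \<psi>, a, b)) at_bot"
      unfolding eq by (intro tendsto_Pair M_limit P_limit lim)
    show "a > -1"
    proof -
      have "a\<^sup>2 < 1" using limit_shear_lt_1[OF lim] zero_le_power2[of b] by linarith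
      then show ?thesis by (simp add: abs_square_less_1)
    qed
    show "sin \<psi> = 0 \<or> \<psi> = pi / 2 \<and> b = 0 \<and> a < 0" by (rule limit_stationary[OF lim ab])
    show "(a, b) \<noteq> (0, 0)" by (rule ab)
    assume "sin \<psi> = 0"
    then show "(0, 0, \<psi>, a, b) \<in> Delta_minus_123 \<union> Delta_plus_132"
      by (rule limit_in_Delta[OF lim _ ab])
  qed
qed

lemma AD_limit_in_Delta:
  assumes x: "x \<in> AD_plus_Omega - OT_plus_Omega"
  shows "\<exists>y \<in> Delta_minus_123 \<union> Delta_plus_132. ((\<lambda>t. flow t x) \<longlongrightarrow> y) at_bot"
proof -
  have "x \<in> B_plus_Omega - OT_plus_Omega" using x by (auto simp: AD_plus_Omega_def)
  then obtain \<psi> a b where lim: "((\<lambda>t. flow t x) \<longlongrightarrow> (0, 0, \<psi>, a, b)) at_bot"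
    and Delta: "sin \<psi> = 0 \<longrightarrow> (0, 0, \<psi>, a, b) \<in> Delta_minus_123 \<union> Delta_plus_132"
    using flow_limit[of x] by blast
  from x obtain \<psi>' a' b' where lim': "((\<lambda>t. flow t x) \<longlongrightarrow> (0, 0, \<psi>', a', b')) at_bot" "sin \<psi>' = 0"
    by (auto simp: AD_plus_Omega_def)
  from tendsto_unique[OF trivial_limit_at_bot_linorder lim lim'(1)] lim'(2) have "sin \<psi> = 0" by simp
  with Delta lim show ?thesis by blast
qed

lemma flow_in_AD:
  assumes x: "x \<in> AD_plus_Omega"
  shows "flow \<tau> x \<in> AD_plus_Omega"
proof -
  have xB: "x \<in> B_plus_Omega" using x by (simp add: AD_plus_Omega_def)
  have shift: "((\<lambda>t. flow t (flow \<tau> x)) \<longlongrightarrow> y) at_bot" if "((\<lambda>t. flow t x) \<longlongrightarrow> y) at_bot" for y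
  proof -
    have "filterlim (\<lambda>t. t + \<tau>) at_bot at_bot"
    proof -
      have "\<exists>N. \<forall>n\<le>N. n + \<tau> \<le> Z" for Z :: real by (intro exI[of _ "Z - \<tau>"]) simp
      then show ?thesis by (simp add: filterlim_at_bot eventually_at_bot_linorder)
    qed
    from filterlim_compose[OF that this] show ?thesis by (simp add: flow_flow[OF xB])
  qed
  from x shift show ?thesis
    using flow_in_B_plus_Omega[OF xB] unfolding AD_plus_Omega_def by blast
qed

lemma negligible_OT: "negligible OT_plus_Omega"
proof (rule negligible_subset)
  show "negligible {z :: state. inner (0, 1, 0, 0, 0) z = 0}"
    by (rule negligible_hyperplane) (simp add: zero_prod_def)
  show "OT_plus_Omega \<subseteq> {z. inner (0, 1, 0, 0, 0) z = 0}"
    by (auto simp: OT_plus_Omega_def inner_state)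
qed

lemma openin_complement_OT: "openin (top_of_set B_plus_Omega) (B_plus_Omega - OT_plus_Omega)"
proof -
  have "B_plus_Omega - OT_plus_Omega = B_plus_Omega \<inter> {z. fst (snd z) \<noteq> 0}"
    by (auto simp: OT_plus_Omega_iff)
  moreover have "open {z :: state. fst (snd z) \<noteq> 0}"
    by (intro open_Collect_neq continuous_intros)
  ultimately show ?thesis by (auto simp: openin_open)
qed

lemma dense_complement_OT: "B_plus_Omega \<subseteq> closure (B_plus_Omega - OT_plus_Omega)"
proof
  fix x assume x: "x \<in> B_plus_Omega"
  show "x \<in> closure (B_plus_Omega - OT_plus_Omega)"
    unfolding closure_iff_nhds_not_empty
  proof (intro allI impI)
    fix G T assume GT: "T \<subseteq> G" "open T" "x \<in> T"
    have "fst (snd (0, 1, 0, 0, 0) :: real \<times> real \<times> real \<times> real) \<ge> 0" by simp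
    from B_plus_Omega_translate[OF x this GT(2,3)] obtain \<tau> where
      \<tau>: "\<tau> > 0" "x + \<tau> *\<^sub>R (0, 1, 0, 0, 0) \<in> B_plus_Omega" "x + \<tau> *\<^sub>R (0, 1, 0, 0, 0) \<in> T" .
    have "fst (snd (x + \<tau> *\<^sub>R (0, 1, 0, 0, 0))) > 0"
      using x \<tau>(1) by (cases x) (auto simp: B_plus_Omega_iff)
    then have "x + \<tau> *\<^sub>R (0, 1, 0, 0, 0) \<notin> OT_plus_Omega" unfolding OT_plus_Omega_iff by linarith
    then show "(B_plus_Omega - OT_plus_Omega) \<inter> G \<noteq> {}" using \<tau> GT(1) by blast
  qed
qed

text \<open>By Lindelof, countably many of the neighbourhoods on which the cone condition holds cover the
  line of equilibria with theta = pi/2.\<close>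

lemma exceptional_cover:
  "\<exists>\<N>. countable \<N> \<and> B_plus_Omega - OT_plus_Omega - AD_plus_Omega \<subseteq> \<Union>\<N>
    \<and> (\<forall>X\<in>\<N>. negligible X \<and> openin (top_of_set B_plus_Omega) (B_plus_Omega - X)
      \<and> B_plus_Omega \<subseteq> closure (B_plus_Omega - X))"
proof -
  define p :: "real \<Rightarrow> state" where "p r = (0, 0, pi / 2, - (sqrt 3 * r), 0)" for r
  \<comment> \<open>With a = - sqrt 3 r these are the values -1 < a < 0.\<close>
  define R where "R = {r. r > 0 \<and> sqrt 3 * r < 1}"
  have "\<forall>r\<in>R. \<exists>\<eta>>0. \<forall>z\<in>cball (p r) \<eta>. \<forall>d.
      inner (cone_map r d) (dvfield z d) \<le> - (sqrt 3 * r) * inner (cone_map r d) d"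
    unfolding p_def R_def using cone_contraction_near_equilibrium by blast
  then obtain \<eta> where \<eta>: "\<And>r. r \<in> R \<Longrightarrow> \<eta> r > 0"
    and cone: "\<And>r z d. r \<in> R \<Longrightarrow> z \<in> cball (p r) (\<eta> r) \<Longrightarrow>
      inner (cone_map r d) (dvfield z d) \<le> - (sqrt 3 * r) * inner (cone_map r d) d"
    by metis
  have transversal: "\<tau> = 0"
    if "r \<in> R" "x \<in> trapped (p r) (\<eta> r)" "x + \<tau> *\<^sub>R (0, 0, 1, 0, r) \<in> trapped (p r) (\<eta> r)" for r x \<tau>
    by (rule trapped_transversal[OF _ cone[OF that(1)] that(2,3)]) (use that(1) in \<open>simp_all add: R_def\<close>)
  obtain \<F> where \<F>: "\<F> \<subseteq> (\<lambda>r. ball (p r) (\<eta> r)) ` R" "countable \<F>" "\<Union>\<F> = \<Union>((\<lambda>r. ball (p r) (\<eta> r)) ` R)"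
    by (rule Lindelof[of "(\<lambda>r. ball (p r) (\<eta> r)) ` R"]) auto
  then obtain R0 where R0: "countable R0" "R0 \<subseteq> R" "\<F> = (\<lambda>r. ball (p r) (\<eta> r)) ` R0"
    using countable_subset_image[of \<F> "\<lambda>r. ball (p r) (\<eta> r)" R] by auto
  define \<N> where "\<N> = (\<lambda>(n, r). trapped_before n (p r) (\<eta> r)) ` (UNIV \<times> R0)"
  show ?thesis
  proof (intro exI conjI ballI)
    show "countable \<N>" unfolding \<N>_def using R0(1) by (intro countable_image countable_SIGMA) auto
    show "B_plus_Omega - OT_plus_Omega - AD_plus_Omega \<subseteq> \<Union>\<N>"
    proof
      fix x assume x: "x \<in> B_plus_Omega - OT_plus_Omega - AD_plus_Omega"
      then have xB: "x \<in> B_plus_Omega - OT_plus_Omega" by blast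
      then obtain \<psi> a b where lim: "((\<lambda>t. flow t x) \<longlongrightarrow> (0, 0, \<psi>, a, b)) at_bot" "(a, b) \<noteq> (0, 0)" "a > -1"
        and or: "sin \<psi> = 0 \<or> \<psi> = pi / 2 \<and> b = 0 \<and> a < 0"
        using flow_limit[of x] by blast
      have "sin \<psi> \<noteq> 0" using x lim unfolding AD_plus_Omega_def by blast
      with or have or: "\<psi> = pi / 2" "b = 0" "a < 0" by auto
      define r where "r = - a / sqrt 3"
      have a: "a = - (sqrt 3 * r)" by (simp add: r_def)
      have r: "r \<in> R" using or(3) lim(3) by (simp add: R_def r_def divide_neg_pos)
      have "(0, 0, \<psi>, a, b) = p r" using or(1,2) a by (simp add: p_def)
      with lim(1) have lim: "((\<lambda>t. flow t x) \<longlongrightarrow> p r) at_bot" by simp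
      have "p r \<in> \<Union>\<F>" unfolding \<F>(3) using r \<eta> by force
      \<comment> \<open>The centre \<open>p q\<close> may differ from the limit \<open>p r\<close>:
        the cone condition of \<open>q\<close> applies to every orbit staying in its ball, whichever
        equilibrium it approaches.\<close>
      then obtain q where q: "q \<in> R0" "p r \<in> ball (p q) (\<eta> q)" unfolding R0(3) by blast
      from topological_tendstoD[OF lim open_ball q(2)] obtain T where
        T: "\<And>t. t \<le> T \<Longrightarrow> flow t x \<in> ball (p q) (\<eta> q)"
        by (auto simp: eventually_at_bot_linorder)
      obtain n where n: "- T \<le> real n" using real_arch_simple by blast
      have "x \<in> trapped_before n (p q) (\<eta> q)"
        unfolding trapped_before_def trapped_def
      proof (intro CollectI conjI allI impI)
        show "x \<in> B_plus_Omega" "flow (- real n) x \<in> B_plus_Omega"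
          using xB by (simp_all add: flow_in_B_plus_Omega)
        fix t :: real assume "t \<le> 0"
        then have "flow (t + - real n) x \<in> ball (p q) (\<eta> q)" using n by (intro T) simp
        moreover have "flow t (flow (- real n) x) = flow (t + - real n) x"
          using xB by (intro flow_flow) simp
        ultimately show "flow t (flow (- real n) x) \<in> cball (p q) (\<eta> q)"
          using ball_subset_cball by (metis subsetD)
      qed
      then show "x \<in> \<Union>\<N>" using q(1) by (auto simp: \<N>_def)
    qed
    fix X assume "X \<in> \<N>"
    then obtain n r where X: "X = trapped_before n (p r) (\<eta> r)" and r: "r \<in> R"
      using R0(2) by (auto simp: \<N>_def)
    show "negligible X"
      unfolding X by (rule negligible_trapped_before[OF negligible_trapped[OF transversal[OF r]]])
    show "openin (top_of_set B_plus_Omega) (B_plus_Omega - X)"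
      unfolding X by (rule openin_complement_trapped_before)
    show "B_plus_Omega \<subseteq> closure (B_plus_Omega - X)"
      \<comment> \<open>The expanding direction has P-component 0, hence is admissible at the
        boundary P = 0.\<close>
      unfolding X by (rule dense_complement_trapped_before[where e = "(0, 0, 1, 0, r)", OF _ transversal[OF r]]) simp
  qed
qed

theorem theorem6p1:
  shows "AD_plus_Omega - OT_plus_Omega \<subseteq> B_plus_Omega
    \<and> (\<forall>x \<in> AD_plus_Omega - OT_plus_Omega. \<forall>\<tau>. flow \<tau> x \<in> AD_plus_Omega - OT_plus_Omega)
    \<and> B_plus_Omega - (AD_plus_Omega - OT_plus_Omega) \<in> null_sets lebesgue
    \<and> (\<exists>U :: nat \<Rightarrow> state set.
         (\<forall>n. openin (top_of_set B_plus_Omega) (U n) \<and> B_plus_Omega \<subseteq> closure (U n))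
         \<and> (\<Inter>n. U n) \<subseteq> AD_plus_Omega - OT_plus_Omega)
    \<and> (\<forall>x \<in> AD_plus_Omega - OT_plus_Omega.
         (\<exists>y \<in> Delta_minus_123 \<union> Delta_plus_132. ((\<lambda>\<tau>. flow \<tau> x) \<longlongrightarrow> y) at_bot)
         \<and> (\<exists>k\<^sub>1 k\<^sub>2 k\<^sub>3 :: real.
              ((\<lambda>\<tau>. eigenvalue_list (weingarten (flow \<tau> x)) ! 0) \<longlongrightarrow> k\<^sub>1) at_bot
              \<and> ((\<lambda>\<tau>. eigenvalue_list (weingarten (flow \<tau> x)) ! 1) \<longlongrightarrow> k\<^sub>2) at_bot
              \<and> ((\<lambda>\<tau>. eigenvalue_list (weingarten (flow \<tau> x)) ! 2) \<longlongrightarrow> k\<^sub>3) at_bot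
              \<and> distinct [k\<^sub>1, k\<^sub>2, k\<^sub>3]
              \<and> k\<^sub>1 > 0 \<and> k\<^sub>2 > 0 \<and> k\<^sub>3 > 0))"
proof (intro conjI ballI allI)
  show sub: "AD_plus_Omega - OT_plus_Omega \<subseteq> B_plus_Omega" by (auto simp: AD_plus_Omega_def)
  fix x \<tau> assume x: "x \<in> AD_plus_Omega - OT_plus_Omega"
  then have "flow \<tau> x \<in> AD_plus_Omega" by (intro flow_in_AD) blast
  moreover have "x \<in> B_plus_Omega - OT_plus_Omega" using x sub by blast
  then have "flow \<tau> x \<in> B_plus_Omega - OT_plus_Omega" by (rule flow_notin_OT)
  ultimately show "flow \<tau> x \<in> AD_plus_Omega - OT_plus_Omega" by blast
next
  fix x assume x: "x \<in> AD_plus_Omega - OT_plus_Omega"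
  show "\<exists>y \<in> Delta_minus_123 \<union> Delta_plus_132. ((\<lambda>\<tau>. flow \<tau> x) \<longlongrightarrow> y) at_bot"
    by (rule AD_limit_in_Delta[OF x])
  then show "\<exists>k\<^sub>1 k\<^sub>2 k\<^sub>3 :: real.
      ((\<lambda>\<tau>. eigenvalue_list (weingarten (flow \<tau> x)) ! 0) \<longlongrightarrow> k\<^sub>1) at_bot
      \<and> ((\<lambda>\<tau>. eigenvalue_list (weingarten (flow \<tau> x)) ! 1) \<longlongrightarrow> k\<^sub>2) at_bot
      \<and> ((\<lambda>\<tau>. eigenvalue_list (weingarten (flow \<tau> x)) ! 2) \<longlongrightarrow> k\<^sub>3) at_bot
      \<and> distinct [k\<^sub>1, k\<^sub>2, k\<^sub>3] \<and> k\<^sub>1 > 0 \<and> k\<^sub>2 > 0 \<and> k\<^sub>3 > 0"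
    using weingarten_eigenvalues_converge by blast
next
  obtain \<N> where \<N>: "countable \<N>" "B_plus_Omega - OT_plus_Omega - AD_plus_Omega \<subseteq> \<Union>\<N>"
    "\<forall>X\<in>\<N>. negligible X \<and> openin (top_of_set B_plus_Omega) (B_plus_Omega - X)
      \<and> B_plus_Omega \<subseteq> closure (B_plus_Omega - X)"
    using exceptional_cover by blast
  have "negligible (OT_plus_Omega \<union> \<Union>\<N>)"
    using \<N> by (intro negligible_Un negligible_OT negligible_countable_Union) auto
  then have "negligible (B_plus_Omega - (AD_plus_Omega - OT_plus_Omega))"
    by (rule negligible_subset) (use \<N>(2) in blast)
  then show "B_plus_Omega - (AD_plus_Omega - OT_plus_Omega) \<in> null_sets lebesgue"
    by (simp add: negligible_iff_null_sets)
  \<comment> \<open>The inserted complement of \<open>OT_plus_Omega\<close> both removes P = 0 and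
    makes the family nonempty, so that \<open>from_nat_into\<close> enumerates exactly it even when
    \<open>\<N>\<close> is finite or empty.\<close>
  define \<V> where "\<V> = insert (B_plus_Omega - OT_plus_Omega) ((\<lambda>X. B_plus_Omega - X) ` \<N>)"
  have "range (from_nat_into \<V>) = \<V>"
    using \<N>(1) by (intro range_from_nat_into) (auto simp: \<V>_def)
  have V: "openin (top_of_set B_plus_Omega) X \<and> B_plus_Omega \<subseteq> closure X" if "X \<in> \<V>" for X
  proof -
    from that consider "X = B_plus_Omega - OT_plus_Omega" | Y where "Y \<in> \<N>" "X = B_plus_Omega - Y"
      unfolding \<V>_def by blast
    then show ?thesis
      by cases (use \<N>(3) openin_complement_OT dense_complement_OT in simp_all)
  qed
  show "\<exists>U :: nat \<Rightarrow> state set.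
     (\<forall>n. openin (top_of_set B_plus_Omega) (U n) \<and> B_plus_Omega \<subseteq> closure (U n))
     \<and> (\<Inter>n. U n) \<subseteq> AD_plus_Omega - OT_plus_Omega"
  proof (intro exI conjI allI)
    show "openin (top_of_set B_plus_Omega) (from_nat_into \<V> n)" "B_plus_Omega \<subseteq> closure (from_nat_into \<V> n)" for n
      using V[of "from_nat_into \<V> n"] \<open>range (from_nat_into \<V>) = \<V>\<close> by blast+
    show "(\<Inter>n. from_nat_into \<V> n) \<subseteq> AD_plus_Omega - OT_plus_Omega"
    proof
      fix x assume "x \<in> (\<Inter>n. from_nat_into \<V> n)"
      then have x: "x \<in> X" if "X \<in> \<V>" for X
        using that \<open>range (from_nat_into \<V>) = \<V>\<close> by blast
      have "x \<in> B_plus_Omega - OT_plus_Omega" by (rule x) (simp add: \<V>_def)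
      moreover have "x \<notin> X" if "X \<in> \<N>" for X
        using x[of "B_plus_Omega - X"] that by (auto simp: \<V>_def)
      ultimately show "x \<in> AD_plus_Omega - OT_plus_Omega" using \<N>(2) by blast
    qed
  qed
qed

end
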